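(* Let $X$ and $Y$ be Banach spaces over $\mathbb{K}\in\{\mathbb{R},\mathbb{C}\}$. (1) The set $\mathrm{NA}_{\mathrm{nu}}(X,Y^* )$ of nuclear operators from $X$ to $Y^*$ that attain their nuclear norm is $w^*$-dense in $\mathcal{I}(X,Y^* )$. (2) If $X\widehat\otimes_\varepsilon Y$ does not contain any isomorphic copy of $\ell_1$, then $\mathrm{NA}_{\mathrm{nu}}(X,Y^* )$ is norm-dense in $\mathcal{I}(X,Y^* )$.
   Context: $X\widehat\otimes_\varepsilon Y$ is the completed injective tensor product, i.e. the completion of $X\otimes Y$ under $\|z\|_\varepsilon=\sup\{|\sum_{i=1}^n x^*(x_i)y^*(y_i)|: x^*\in B_{X^*}, y^*\in B_{Y^*}\}$ for $z=\sum_{i=1}^n x_i\otimes y_i$. A Radon measure on a compact Hausdorff space is a ($\mathbb{K}$-valued, finite) regular Borel measure; $|\mu|_{\mathrm{TV}}$ is its total variation norm. An operator $T\in\mathcal{L}(X,Y^* )$ is integral if there is a Radon measure $\mu$ on $(B_{X^*}\times B_{Y^*},w^*\times w^* )$ with $\langle Tx,y\rangle=\int x^*(x)y^*(y)\,d\mu(x^*,y^* )$ for all $x\in X$, $y\in Y$ ($\mu$ represents $T$); $\|T\|_{\mathcal I}=\inf|\mu|_{\mathrm{TV}}$ over all $\mu$ representing $T$. $\mathcal{I}(X,Y^* )$ is the space of integral operators with norm $\|\cdot\|_{\mathcal I}$; it is canonically isometric to $(X\widehat\otimes_\varepsilon Y)^*$ via $\langle T,x\otimes y\rangle=\langle Tx,y\rangle$,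 and the $w^*$-topology on $\mathcal I(X,Y^* )$ is the one from this duality. Norm-density is with respect to $\|\cdot\|_{\mathcal I}$. An operator $T\in\mathcal L(X,Z)$ is nuclear if $T=\sum_{i=1}^\infty x_i^*\otimes z_i$ (i.e. $Tx=\sum_i x_i^*(x)z_i$) with $x_i^*\in X^*$, $z_i\in Z$, $\sum_i\|x_i^*\|\|z_i\|<\infty$; its nuclear norm $\|T\|_{\mathrm{nu}}$ is the infimum of $\sum_i\|x_i^*\|\|z_i\|$ over all such representations. $T$ attains its nuclear norm if this infimum is a minimum; $\mathrm{NA}_{\mathrm{nu}}(X,Z)$ is the set of such operators. Every nuclear operator $T\in\mathcal L(X,Y^* )$ is integral with $\|T\|_{\mathcal I}\le\|T\|_{\mathrm{nu}}$. *)

theory Defs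
  imports "HOL-Analysis.Analysis" "HOL-Probability.Discrete_Topology"
begin

text \<open>
  The scalar field: the last axiom says that the field is \<open>\<real>\<close>, or is \<open>\<real> + \<real>i\<close> with
  \<open>i * i = -1\<close>. As the norm is multiplicative and extends the absolute value of \<open>\<real>\<close>, the
  instances of this class are, up to isometric isomorphism, exactly \<open>\<real>\<close> and \<open>\<complex>\<close>.
\<close>

class rc_field = real_normed_field + banach + second_countable_topology +
  assumes real_or_complex:
    "(\<forall>k. \<exists>a. k = a *\<^sub>R 1) \<or>
     (\<exists>i. i * i = - 1 \<and> (\<forall>k. \<exists>a b. k = a *\<^sub>R 1 + b *\<^sub>R i))"

instance real :: rc_field
  by standard auto

instance complex :: rc_field
proof
  have "\<i> * \<i> = - 1 \<and> (\<forall>k. \<exists>a b. k = a *\<^sub>R 1 + b *\<^sub>R \<i>)"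
    by (auto simp: complex_eq_iff)
  then show "(\<forall>k::complex. \<exists>a. k = a *\<^sub>R 1) \<or>
      (\<exists>i::complex. i * i = - 1 \<and> (\<forall>k. \<exists>a b. k = a *\<^sub>R 1 + b *\<^sub>R i))"
    by blast
qed

section \<open>Normed spaces over the scalar field, duals and operators\<close>

text \<open>
  A normed space over \<open>'k\<close> is a real normed space with a scalar multiplication by \<open>'k\<close> that
  extends the real one and makes the norm homogeneous; completeness is the class \<^class>\<open>banach\<close>.
\<close>

definition K_space :: "('k::rc_field \<Rightarrow> 'a::real_normed_vector \<Rightarrow> 'a) \<Rightarrow> bool" where
  "K_space s \<longleftrightarrow> vector_space s \<and> (\<forall>c x. norm (s c x) = norm c * norm x) \<and>
     (\<forall>r x. s (of_real r) x = r *\<^sub>R x)"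

lemma K_space_real: "K_space (s :: real \<Rightarrow> 'a::real_normed_vector \<Rightarrow> 'a) \<longleftrightarrow> s = scaleR"
proof
  assume "K_space s"
  then show "s = scaleR" by (auto simp: K_space_def fun_eq_iff)
next
  assume "s = scaleR"
  then show "K_space s"
    by (simp add: K_space_def vector_space_def scaleR_right_distrib scaleR_left_distrib)
qed

text \<open>
  The dual space is the set of \<open>'k\<close>-linear elements of the type of bounded real-linear maps into
  \<open>'k\<close>, with the operator norm of that type. More generally, a space of operators
  into a space \<open>Z\<close> that is given as a subspace of a type is described by the carrier \<open>Z\<close> and its
  scalar multiplication.
\<close>

definition K_dual :: "('k::rc_field \<Rightarrow> 'a::real_normed_vector \<Rightarrow> 'a) \<Rightarrow> ('a \<Rightarrow>\<^sub>L 'k) set" where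
  "K_dual s = {f :: 'a \<Rightarrow>\<^sub>L 'k. \<forall>c x. f (s c x) = c * f x}"

definition dual_scale :: "'k::rc_field \<Rightarrow> ('a::real_normed_vector \<Rightarrow>\<^sub>L 'k) \<Rightarrow> ('a \<Rightarrow>\<^sub>L 'k)" where
  "dual_scale c f = blinfun_mult_right c o\<^sub>L f"

lemma dual_scale_apply: "dual_scale c f x = c * f x"
  by (simp add: dual_scale_def)

definition dual_ball :: "('k::rc_field \<Rightarrow> 'a::real_normed_vector \<Rightarrow> 'a) \<Rightarrow> ('a \<Rightarrow>\<^sub>L 'k) set" where
  "dual_ball s = {f \<in> K_dual s. norm f \<le> 1}"

definition operators ::
  "('k::rc_field \<Rightarrow> 'a::real_normed_vector \<Rightarrow> 'a) \<Rightarrow> 'z::real_normed_vector set \<Rightarrow>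
   ('k \<Rightarrow> 'z \<Rightarrow> 'z) \<Rightarrow> ('a \<Rightarrow>\<^sub>L 'z) set" where
  "operators sX Z sZ = {T :: 'a \<Rightarrow>\<^sub>L 'z. (\<forall>x. T x \<in> Z) \<and> (\<forall>c x. T (sX c x) = sZ c (T x))}"

section \<open>Scalar-valued Radon measures\<close>

definition borel_of :: "'p topology \<Rightarrow> 'p measure" where
  "borel_of \<T> = sigma (topspace \<T>) {U. openin \<T> U}"

text \<open>
  A \<open>'k\<close>-valued measure is a set function, of which only the values on Borel sets matter.
\<close>

definition scalar_measure :: "'p topology \<Rightarrow> ('p set \<Rightarrow> 'k::rc_field) \<Rightarrow> bool" where
  "scalar_measure \<T> \<mu> \<longleftrightarrow>
     (\<forall>A :: nat \<Rightarrow> 'p set. range A \<subseteq> sets (borel_of \<T>) \<longrightarrow> disjoint_family A \<longrightarrow>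
        (\<lambda>n. \<mu> (A n)) sums \<mu> (\<Union>n. A n))"

definition variation :: "'p topology \<Rightarrow> ('p set \<Rightarrow> 'k::rc_field) \<Rightarrow> 'p set \<Rightarrow> ennreal" where
  "variation \<T> \<mu> E =
     (SUP P \<in> {P. finite P \<and> disjoint P \<and> P \<subseteq> sets (borel_of \<T>) \<and> \<Union>P = E}.
        \<Sum>A\<in>P. ennreal (norm (\<mu> A)))"

definition radon_measure :: "'p topology \<Rightarrow> ('p set \<Rightarrow> 'k::rc_field) \<Rightarrow> bool" where
  "radon_measure \<T> \<mu> \<longleftrightarrow> scalar_measure \<T> \<mu> \<and>
     (\<forall>E \<in> sets (borel_of \<T>).
        variation \<T> \<mu> E = (INF U \<in> {U. openin \<T> U \<and> E \<subseteq> U}. variation \<T> \<mu> U) \<and>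
        variation \<T> \<mu> E = (SUP C \<in> {C. compactin \<T> C \<and> C \<in> sets (borel_of \<T>) \<and> C \<subseteq> E}.
           variation \<T> \<mu> C))"

definition tv_norm :: "'p topology \<Rightarrow> ('p set \<Rightarrow> 'k::rc_field) \<Rightarrow> real" where
  "tv_norm \<T> \<mu> = enn2real (variation \<T> \<mu> (topspace \<T>))"

text \<open>
  The integral against \<open>\<mu>\<close> is defined by the polar decomposition \<open>d\<mu> = h d|\<mu>|\<close> with \<open>|h| = 1\<close>.
  The density \<open>h\<close> exists by the Radon-Nikodym theorem and is unique up to \<open>|\<mu>|\<close>-null sets.
\<close>

definition variation_measure :: "'p topology \<Rightarrow> ('p set \<Rightarrow> 'k::rc_field) \<Rightarrow> 'p measure" where
  "variation_measure \<T> \<mu> = measure_of (topspace \<T>) (sets (borel_of \<T>)) (variation \<T> \<mu>)"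

definition polar_density :: "'p topology \<Rightarrow> ('p set \<Rightarrow> 'k::rc_field) \<Rightarrow> 'p \<Rightarrow> 'k" where
  "polar_density \<T> \<mu> = (SOME h. h \<in> borel_measurable (borel_of \<T>) \<and>
     (\<forall>p \<in> topspace \<T>. norm (h p) = 1) \<and>
     (\<forall>E \<in> sets (borel_of \<T>). \<mu> E = (LINT p|variation_measure \<T> \<mu>. indicator E p *\<^sub>R h p)))"

definition scalar_integral ::
  "'p topology \<Rightarrow> ('p set \<Rightarrow> 'k::rc_field) \<Rightarrow> ('p \<Rightarrow> 'k) \<Rightarrow> 'k" where
  "scalar_integral \<T> \<mu> f = (LINT p|variation_measure \<T> \<mu>. f p * polar_density \<T> \<mu> p)"

section \<open>Integral and nuclear operators\<close>

text \<open>
  \<^const>\<open>strong_operator_topology\<close> is the topology of pointwise convergence, so on the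
  dual space it is the weak* topology.
\<close>

definition dual_balls_topology ::
  "('k::rc_field \<Rightarrow> 'a::real_normed_vector \<Rightarrow> 'a) \<Rightarrow> ('k \<Rightarrow> 'b::real_normed_vector \<Rightarrow> 'b) \<Rightarrow>
   (('a \<Rightarrow>\<^sub>L 'k) \<times> ('b \<Rightarrow>\<^sub>L 'k)) topology" where
  "dual_balls_topology sX sY =
     prod_topology (subtopology strong_operator_topology (dual_ball sX))
                   (subtopology strong_operator_topology (dual_ball sY))"

definition represents ::
  "('k::rc_field \<Rightarrow> 'a::real_normed_vector \<Rightarrow> 'a) \<Rightarrow> ('k \<Rightarrow> 'b::real_normed_vector \<Rightarrow> 'b) \<Rightarrow>
   ((('a \<Rightarrow>\<^sub>L 'k) \<times> ('b \<Rightarrow>\<^sub>L 'k)) set \<Rightarrow> 'k) \<Rightarrow> ('a \<Rightarrow>\<^sub>L 'b \<Rightarrow>\<^sub>L 'k) \<Rightarrow> bool" where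
  "represents sX sY \<mu> T \<longleftrightarrow> radon_measure (dual_balls_topology sX sY) \<mu> \<and>
     (\<forall>x y. T x y = scalar_integral (dual_balls_topology sX sY) \<mu>
       (\<lambda>(f :: 'a \<Rightarrow>\<^sub>L 'k, g :: 'b \<Rightarrow>\<^sub>L 'k). f x * g y))"

definition integral_operators ::
  "('k::rc_field \<Rightarrow> 'a::real_normed_vector \<Rightarrow> 'a) \<Rightarrow> ('k \<Rightarrow> 'b::real_normed_vector \<Rightarrow> 'b) \<Rightarrow>
   ('a \<Rightarrow>\<^sub>L 'b \<Rightarrow>\<^sub>L 'k) set" where
  "integral_operators sX sY =
     {T \<in> operators sX (K_dual sY) dual_scale. \<exists>\<mu>. represents sX sY \<mu> T}"

definition integral_norm ::
  "('k::rc_field \<Rightarrow> 'a::real_normed_vector \<Rightarrow> 'a) \<Rightarrow> ('k \<Rightarrow> 'b::real_normed_vector \<Rightarrow> 'b) \<Rightarrow>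
   ('a \<Rightarrow>\<^sub>L 'b \<Rightarrow>\<^sub>L 'k) \<Rightarrow> real" where
  "integral_norm sX sY T =
     Inf {tv_norm (dual_balls_topology sX sY) \<mu> |\<mu>. represents sX sY \<mu> T}"

definition nuclear_representation ::
  "('k::rc_field \<Rightarrow> 'a::real_normed_vector \<Rightarrow> 'a) \<Rightarrow> 'z::real_normed_vector set \<Rightarrow>
   ('k \<Rightarrow> 'z \<Rightarrow> 'z) \<Rightarrow> (nat \<Rightarrow> 'a \<Rightarrow>\<^sub>L 'k) \<Rightarrow> (nat \<Rightarrow> 'z) \<Rightarrow> ('a \<Rightarrow>\<^sub>L 'z) \<Rightarrow> bool" where
  "nuclear_representation sX Z sZ f z T \<longleftrightarrow>
     (\<forall>i. f i \<in> K_dual sX) \<and> (\<forall>i. z i \<in> Z) \<and> summable (\<lambda>i. norm (f i) * norm (z i)) \<and>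
     (\<forall>x. (\<lambda>i. sZ (f i x) (z i)) sums T x)"

definition nuclear_operators ::
  "('k::rc_field \<Rightarrow> 'a::real_normed_vector \<Rightarrow> 'a) \<Rightarrow> 'z::real_normed_vector set \<Rightarrow>
   ('k \<Rightarrow> 'z \<Rightarrow> 'z) \<Rightarrow> ('a \<Rightarrow>\<^sub>L 'z) set" where
  "nuclear_operators sX Z sZ =
     {T \<in> operators sX Z sZ. \<exists>f z. nuclear_representation sX Z sZ f z T}"

definition nuclear_norm ::
  "('k::rc_field \<Rightarrow> 'a::real_normed_vector \<Rightarrow> 'a) \<Rightarrow> 'z::real_normed_vector set \<Rightarrow>
   ('k \<Rightarrow> 'z \<Rightarrow> 'z) \<Rightarrow> ('a \<Rightarrow>\<^sub>L 'z) \<Rightarrow> real" where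
  "nuclear_norm sX Z sZ T =
     Inf {(\<Sum>i. norm (f i) * norm (z i)) |f z. nuclear_representation sX Z sZ f z T}"

definition NA_nu ::
  "('k::rc_field \<Rightarrow> 'a::real_normed_vector \<Rightarrow> 'a) \<Rightarrow> 'z::real_normed_vector set \<Rightarrow>
   ('k \<Rightarrow> 'z \<Rightarrow> 'z) \<Rightarrow> ('a \<Rightarrow>\<^sub>L 'z) set" where
  "NA_nu sX Z sZ = {T \<in> nuclear_operators sX Z sZ.
     \<exists>f z. nuclear_representation sX Z sZ f z T \<and>
           nuclear_norm sX Z sZ T = (\<Sum>i. norm (f i) * norm (z i))}"

section \<open>The completed injective tensor product\<close>

text \<open>
  The tensor product of \<open>X\<close> and \<open>Y\<close> is realized as a space of scalar functions on the product of
  the dual balls, the sum of the \<open>x i \<otimes> y i\<close> being the function that maps \<open>(f, g)\<close> to the sum of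
  the \<open>f (x i) * g (y i)\<close>. This realization of the algebraic tensor
  product is injective because functionals separate points, and the injective
  norm is by its definition the supremum norm of that function (lemma \<open>norm_tensor_sum\<close>). The
  completion is therefore the closure in the Banach space of all bounded functions. The latter is
  the type of bounded continuous functions on a discrete space; functions are extended by zero
  from the product of the dual balls.
\<close>

type_synonym ('a, 'b, 'k) tensor_fun = "(('a \<Rightarrow>\<^sub>L 'k) \<times> ('b \<Rightarrow>\<^sub>L 'k)) discrete \<Rightarrow>\<^sub>C 'k"

definition tensor ::
  "('k::rc_field \<Rightarrow> 'a::real_normed_vector \<Rightarrow> 'a) \<Rightarrow> ('k \<Rightarrow> 'b::real_normed_vector \<Rightarrow> 'b) \<Rightarrow>
   'a \<Rightarrow> 'b \<Rightarrow> ('a, 'b, 'k) tensor_fun" where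
  "tensor sX sY x y = Bcontfun (\<lambda>p.
     case of_discrete p of (f :: 'a \<Rightarrow>\<^sub>L 'k, g :: 'b \<Rightarrow>\<^sub>L 'k) \<Rightarrow>
     if f \<in> dual_ball sX \<and> g \<in> dual_ball sY then f x * g y else 0)"

definition tensor_scale :: "'k::rc_field \<Rightarrow> ('p::topological_space \<Rightarrow>\<^sub>C 'k) \<Rightarrow> ('p \<Rightarrow>\<^sub>C 'k)" where
  "tensor_scale c u = Bcontfun (\<lambda>p. c * u p)"

definition alg_tensor ::
  "('k::rc_field \<Rightarrow> 'a::real_normed_vector \<Rightarrow> 'a) \<Rightarrow> ('k \<Rightarrow> 'b::real_normed_vector \<Rightarrow> 'b) \<Rightarrow>
   ('a, 'b, 'k) tensor_fun set" where
  "alg_tensor sX sY = {\<Sum>i<n. tensor sX sY (x i) (y i) |(n::nat) x y. True}"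

definition inj_tensor ::
  "('k::rc_field \<Rightarrow> 'a::real_normed_vector \<Rightarrow> 'a) \<Rightarrow> ('k \<Rightarrow> 'b::real_normed_vector \<Rightarrow> 'b) \<Rightarrow>
   ('a, 'b, 'k) tensor_fun set" where
  "inj_tensor sX sY = closure (alg_tensor sX sY)"

lemma apply_tensor_scale: "tensor_scale c u p = c * u p"
proof -
  have "(\<lambda>p. c * apply_bcontfun u p) \<in> bcontfun"
    by (rule bcontfun_normI[where b = "norm c * norm u"])
       (auto simp: norm_mult intro!: continuous_intros mult_left_mono norm_bounded)
  then show ?thesis by (simp add: tensor_scale_def Bcontfun_inverse)
qed

lemma apply_tensor:
  fixes f :: "'a::real_normed_vector \<Rightarrow>\<^sub>L 'k::rc_field" and g :: "'b::real_normed_vector \<Rightarrow>\<^sub>L 'k"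
  shows
  "tensor sX sY x y (discrete (f, g)) =
     (if f \<in> dual_ball sX \<and> g \<in> dual_ball sY then f x * g y else 0)"
proof -
  have *: "norm (f x * g y) \<le> norm x * norm y"
    if "f \<in> dual_ball sX" "g \<in> dual_ball sY" for f :: "'a \<Rightarrow>\<^sub>L 'k" and g :: "'b \<Rightarrow>\<^sub>L 'k"
  proof -
    have "norm (f x) \<le> norm x" "norm (g y) \<le> norm y"
      using that norm_blinfun[of f x] norm_blinfun[of g y]
        mult_right_mono[of "norm f" 1 "norm x"] mult_right_mono[of "norm g" 1 "norm y"]
      by (auto simp: dual_ball_def)
    then show ?thesis by (simp add: norm_mult mult_mono)
  qed
  have "(\<lambda>p. case of_discrete p of (f :: 'a \<Rightarrow>\<^sub>L 'k, g :: 'b \<Rightarrow>\<^sub>L 'k) \<Rightarrow>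
     if f \<in> dual_ball sX \<and> g \<in> dual_ball sY then f x * g y else 0) \<in> bcontfun"
  proof (rule bcontfun_normI[where b = "norm x * norm y"])
    show "continuous_on UNIV (\<lambda>p. case of_discrete p of (f :: 'a \<Rightarrow>\<^sub>L 'k, g :: 'b \<Rightarrow>\<^sub>L 'k) \<Rightarrow>
       if f \<in> dual_ball sX \<and> g \<in> dual_ball sY then f x * g y else 0)"
      by (simp add: continuous_on_open_vimage open_discrete)
  qed (auto split: prod.split intro: *)
  then show ?thesis
    by (simp add: tensor_def Bcontfun_inverse discrete_inverse)
qed

lemma norm_tensor_sum:
  fixes x :: "nat \<Rightarrow> 'a::real_normed_vector" and y :: "nat \<Rightarrow> 'b::real_normed_vector"
    and sX :: "'k::rc_field \<Rightarrow> 'a \<Rightarrow> 'a"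
  shows "norm (\<Sum>i<n. tensor sX sY (x i) (y i)) =
     (SUP (f :: 'a \<Rightarrow>\<^sub>L 'k, g :: 'b \<Rightarrow>\<^sub>L 'k) \<in> dual_ball sX \<times> dual_ball sY.
        norm (\<Sum>i<n. f (x i) * g (y i)))"
proof -
  define u where "u = (\<Sum>i<n. tensor sX sY (x i) (y i))"
  define S where "S = (\<lambda>(f :: 'a \<Rightarrow>\<^sub>L 'k, g :: 'b \<Rightarrow>\<^sub>L 'k). norm (\<Sum>i<n. f (x i) * g (y i))) ` (dual_ball sX \<times> dual_ball sY)"
  have sum_apply: "(\<Sum>i<m. v i) p = (\<Sum>i<m. v i p)"
    for m and v :: "nat \<Rightarrow> ('a, 'b, 'k) tensor_fun" and p
    by (induction m) (simp_all)
  have u: "u (discrete (f, g)) =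
      (if f \<in> dual_ball sX \<and> g \<in> dual_ball sY then \<Sum>i<n. f (x i) * g (y i) else 0)"
    for f :: "'a \<Rightarrow>\<^sub>L 'k" and g :: "'b \<Rightarrow>\<^sub>L 'k"
    by (auto simp: u_def sum_apply apply_tensor intro!: sum.neutral)
  have bdd: "bdd_above S"
  proof (rule bdd_aboveI)
    fix s assume "s \<in> S"
    then obtain f :: "'a \<Rightarrow>\<^sub>L 'k" and g :: "'b \<Rightarrow>\<^sub>L 'k" where "f \<in> dual_ball sX" "g \<in> dual_ball sY"
        "s = norm (\<Sum>i<n. f (x i) * g (y i))"
      by (auto simp: S_def)
    then show "s \<le> norm u" using norm_bounded[of u "discrete (f, g)"] by (simp add: u)
  qed
  have zero: "0 \<in> dual_ball sX" "0 \<in> dual_ball sY"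
    by (auto simp: dual_ball_def K_dual_def)
  have "norm (u p) \<le> Sup S" for p
  proof -
    obtain f g where p: "p = discrete (f, g)"
      by (metis of_discrete_inverse surj_pair)
    show ?thesis
    proof (cases "f \<in> dual_ball sX \<and> g \<in> dual_ball sY")
      case True
      then have "norm (u p) \<in> S" by (auto simp: p u S_def)
      then show ?thesis using bdd by (rule cSup_upper)
    next
      case False
      have "0 \<in> S" using zero by (force simp: S_def)
      then show ?thesis using False bdd by (auto simp: p u intro: cSup_upper)
    qed
  qed
  then have "norm u \<le> Sup S" by (rule norm_bound)
  moreover have "Sup S \<le> norm u"
  proof (rule cSup_least)
    show "S \<noteq> {}" using zero by (auto simp: S_def)
    fix s assume "s \<in> S"
    then obtain f :: "'a \<Rightarrow>\<^sub>L 'k" and g :: "'b \<Rightarrow>\<^sub>L 'k" where "f \<in> dual_ball sX" "g \<in> dual_ball sY"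
        "s = norm (\<Sum>i<n. f (x i) * g (y i))"
      by (auto simp: S_def)
    then show "s \<le> norm u" using norm_bounded[of u "discrete (f, g)"] by (simp add: u)
  qed
  ultimately show ?thesis by (simp add: u_def S_def)
qed

text \<open>
  Elements of the dual of the completed tensor product are represented by functions that are
  undefined outside of it, so that they are determined by their values on it.
\<close>

definition inj_tensor_dual ::
  "('k::rc_field \<Rightarrow> 'a::real_normed_vector \<Rightarrow> 'a) \<Rightarrow> ('k \<Rightarrow> 'b::real_normed_vector \<Rightarrow> 'b) \<Rightarrow>
   (('a, 'b, 'k) tensor_fun \<Rightarrow> 'k) set" where
  "inj_tensor_dual sX sY = {\<phi> \<in> extensional (inj_tensor sX sY).
     (\<forall>u \<in> inj_tensor sX sY. \<forall>v \<in> inj_tensor sX sY. \<phi> (u + v) = \<phi> u + \<phi> v) \<and>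
     (\<forall>c. \<forall>u \<in> inj_tensor sX sY. \<phi> (tensor_scale c u) = c * \<phi> u) \<and>
     (\<exists>B. \<forall>u \<in> inj_tensor sX sY. norm (\<phi> u) \<le> B * norm u)}"

text \<open>
  For an integral operator \<open>T\<close> the functional exists (it is given by integration against a
  representing measure) and it is unique because the algebraic tensor product is dense.
\<close>

definition tensor_functional ::
  "('k::rc_field \<Rightarrow> 'a::real_normed_vector \<Rightarrow> 'a) \<Rightarrow> ('k \<Rightarrow> 'b::real_normed_vector \<Rightarrow> 'b) \<Rightarrow>
   ('a \<Rightarrow>\<^sub>L 'b \<Rightarrow>\<^sub>L 'k) \<Rightarrow> ('a, 'b, 'k) tensor_fun \<Rightarrow> 'k" where
  "tensor_functional sX sY T =
     (THE \<phi>. \<phi> \<in> inj_tensor_dual sX sY \<and> (\<forall>x y. \<phi> (tensor sX sY x y) = T x y))"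

definition wstar_topology ::
  "('k::rc_field \<Rightarrow> 'a::real_normed_vector \<Rightarrow> 'a) \<Rightarrow> ('k \<Rightarrow> 'b::real_normed_vector \<Rightarrow> 'b) \<Rightarrow>
   ('a \<Rightarrow>\<^sub>L 'b \<Rightarrow>\<^sub>L 'k) topology" where
  "wstar_topology sX sY =
     pullback_topology (integral_operators sX sY) (tensor_functional sX sY)
       (product_topology (\<lambda>_. euclidean) (inj_tensor sX sY))"

section \<open>Density and copies of \<open>\<ell>\<^sub>1\<close>\<close>

definition wstar_dense ::
  "('k::rc_field \<Rightarrow> 'a::real_normed_vector \<Rightarrow> 'a) \<Rightarrow> ('k \<Rightarrow> 'b::real_normed_vector \<Rightarrow> 'b) \<Rightarrow>
   ('a \<Rightarrow>\<^sub>L 'b \<Rightarrow>\<^sub>L 'k) set \<Rightarrow> bool" where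
  "wstar_dense sX sY D \<longleftrightarrow> D \<subseteq> integral_operators sX sY \<and>
     wstar_topology sX sY closure_of D = integral_operators sX sY"

definition integral_norm_dense ::
  "('k::rc_field \<Rightarrow> 'a::real_normed_vector \<Rightarrow> 'a) \<Rightarrow> ('k \<Rightarrow> 'b::real_normed_vector \<Rightarrow> 'b) \<Rightarrow>
   ('a \<Rightarrow>\<^sub>L 'b \<Rightarrow>\<^sub>L 'k) set \<Rightarrow> bool" where
  "integral_norm_dense sX sY D \<longleftrightarrow> D \<subseteq> integral_operators sX sY \<and>
     (\<forall>T \<in> integral_operators sX sY. \<forall>e>0. \<exists>S\<in>D. integral_norm sX sY (T - S) < e)"

definition ell1 :: "(nat \<Rightarrow> 'k::rc_field) set" where
  "ell1 = {a. summable (\<lambda>n. norm (a n))}"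

definition contains_ell1 ::
  "('k::rc_field \<Rightarrow> 'e::real_normed_vector \<Rightarrow> 'e) \<Rightarrow> 'e set \<Rightarrow> bool" where
  "contains_ell1 sE E \<longleftrightarrow> (\<exists>J :: (nat \<Rightarrow> 'k) \<Rightarrow> 'e.
     (\<forall>a\<in>ell1. J a \<in> E) \<and>
     (\<forall>a\<in>ell1. \<forall>b\<in>ell1. J (\<lambda>n. a n + b n) = J a + J b) \<and>
     (\<forall>c. \<forall>a\<in>ell1. J (\<lambda>n. c * a n) = sE c (J a)) \<and>
     (\<exists>m>0. \<exists>M. \<forall>a\<in>ell1.
        m * (\<Sum>n. norm (a n)) \<le> norm (J a) \<and> norm (J a) \<le> M * (\<Sum>n. norm (a n))))"

end

theory Submission
  imports Defs
begin

text \<open>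
  Write \<open>E\<close> for the completed tensor product, realized as functions on the compact product \<open>K\<close>
  of the dual balls, so that the elementary tensors \<open>f \<otimes> g\<close> in the dual of \<open>E\<close> are the evaluations at
  the points of \<open>K\<close>. If \<open>S\<close> is \<open>r \<ge> 0\<close> times a convex combination of evaluations at points \<open>p\<close>
  with \<open>u(p) = norm u\<close> for a single \<open>u \<noteq> 0\<close> in \<open>E\<close>, then \<open>S(u) = r * norm u\<close> forces every
  nuclear representation of \<open>S\<close> to have total at least \<open>r\<close>, so \<open>S\<close> attains its nuclear norm.
  By a Bishop-Phelps argument every \<open>T\<close> of norm one in the dual of \<open>E\<close> lies, up to \<open>\<epsilon>\<close>, in
  the weak* closed convex hull of the evaluations at such points, for some \<open>u\<close> depending on \<open>\<epsilon>\<close>.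
  Finite-dimensional separation then gives (1).

  For (2), a theorem of Haydon says that without \<open>\<ell>\<^sub>1\<close> in \<open>E\<close> the weak* closed convex hull can be replaced by
  the norm closed one. It is proved directly: if \<open>T\<close>, represented by a finitely additive
  measure \<open>\<nu>\<close>, is far from all convex combinations of evaluations, then a cluster point \<open>\<xi>\<close> in
  the bidual separates \<open>\<nu>\<close> from the points. On a suitable part of \<open>\<nu>\<close>, the normalized values of \<open>\<xi>\<close> come
  close to two distinct scalars, once at points and once at averages, below every smaller part, and
  approximating \<open>\<xi>\<close> by elements of \<open>E\<close> along a binary tree yields a copy of \<open>\<ell>\<^sub>1\<close>. The same theorem, applied
  repeatedly to the difference \<open>T - S\<close>, writes it as a series of evaluations of total at most
  twice its norm, which bounds the integral norm by means of a discrete measure.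
\<close>

section \<open>The scalar field\<close>

text \<open>Norm attainment asks for one \<open>u\<close> normed by all points used in
  \<open>S\<close>; approximating \<open>T\<close> by arbitrary evaluations would not provide it.
  Hence the variational principle comes before any approximation, which then takes place inside the
  compact set of points norming \<open>u\<close>. Positive functionals on all bounded functions
  serve as measures: they arise from convex combinations by Tychonoff's theorem and can be
  restricted to arbitrary sets of points. The obstacle in the Haydon part is that an element of
  \<open>E\<close> separating \<nu> from the points depends on a finite set of points. The cluster
  point \<xi> separates from all points, but it is no element of \<open>E\<close>: each level of the
  tree can copy only finitely many of its values. This is why both scalars have to reappear below
  every smaller part, and why the estimates of one level must hold for all later choices. The
  integral norm is an infimum over representing measures, so smallness of \<open>T - S\<close> as a
  functional on \<open>E\<close> has to be converted into a measure of small variation.\<close>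

text \<open>The real part, read off from \<open>|k + 1|\<^sup>2 = |k|\<^sup>2 + 2 Re k + 1\<close>.\<close>

definition re_part :: "'k::rc_field \<Rightarrow> real" where
  "re_part k = ((norm (k + 1))\<^sup>2 - (norm k)\<^sup>2 - 1) / 2"

text \<open>Only \<open>i * i = - 1\<close> and the multiplicativity of the norm are available.
  \<open>Z\<close> embeds the complex numbers multiplicatively; a crude bound with factor 2, applied
  to the powers of \<open>z\<close>, loses its factor in the limit. As
  \<open>Z z * Z (cnj z)\<close> is the squared modulus, the inequality for \<open>cnj z\<close>
  gives the reverse one for \<open>z\<close>.\<close>

lemma norm_complex_form:
  fixes i :: "'k::rc_field"
  assumes i: "i * i = - 1"
  shows "norm (of_real a + of_real b * i) = sqrt (a\<^sup>2 + b\<^sup>2)"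
proof -
  define Z where "Z z = of_real (Re z) + of_real (Im z) * i" for z :: complex
  have mult: "Z (z * w) = Z z * Z w" for z w
  proof -
    have "of_real (Im z) * i * (of_real (Im w) * i) = - of_real (Im z * Im w)"
      using i by (metis (no_types, lifting) mult.assoc mult.commute mult_minus1_right of_real_mult)
    then show ?thesis by (simp add: Z_def algebra_simps)
  qed
  have one: "Z 1 = 1" by (simp add: Z_def)
  have pow: "Z (z ^ n) = Z z ^ n" for z n
    by (induction n) (simp_all add: one mult)
  have "norm i * norm i = 1" using i by (metis norm_minus_cancel norm_mult norm_one)
  then have ni: "norm i = 1"
    by (metis norm_ge_zero real_sqrt_abs2 real_sqrt_one abs_of_nonneg)
  have bd: "norm (Z z) \<le> 2 * cmod z" for z
  proof -
    have "norm (Z z) \<le> \<bar>Re z\<bar> + \<bar>Im z\<bar>"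
      unfolding Z_def by (rule order_trans[OF norm_triangle_ineq]) (simp add: norm_mult ni)
    then show ?thesis using abs_Re_le_cmod[of z] abs_Im_le_cmod[of z] by linarith
  qed
  have le: "norm (Z z) \<le> cmod z" for z
  proof (rule ccontr)
    assume "\<not> norm (Z z) \<le> cmod z"
    then have lt: "cmod z < norm (Z z)" by simp
    have "Z z \<noteq> 0" using lt by (metis norm_ge_zero norm_zero not_le)
    have "z \<noteq> 0"
    proof
      assume "z = 0" then have "Z z = 0" by (simp add: Z_def)
      then show False using \<open>Z z \<noteq> 0\<close> by simp
    qed
    then have "1 < norm (Z z) / cmod z" using lt by simp
    then obtain n where n: "2 < (norm (Z z) / cmod z) ^ n" using real_arch_pow by blast
    have "norm (Z z) ^ n \<le> 2 * cmod z ^ n"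
      using bd[of "z ^ n"] by (simp add: pow norm_power)
    then show False using n \<open>z \<noteq> 0\<close> by (simp add: power_divide field_simps)
  qed
  define z where "z = Complex a b"
  have "Z z * Z (cnj z) = of_real ((cmod z)\<^sup>2)"
    unfolding mult[symmetric] complex_norm_square[symmetric]
    by (simp add: Z_def complex_mult_cnj cmod_power2)
  then have *: "norm (Z z) * norm (Z (cnj z)) = (cmod z)\<^sup>2"
    by (metis norm_mult norm_of_real abs_of_nonneg zero_le_power2)
  have "norm (Z z) = cmod z"
  proof (rule antisym[OF le])
    show "cmod z \<le> norm (Z z)"
    proof (cases "z = 0")
      case False
      have "(cmod z)\<^sup>2 \<le> norm (Z z) * cmod z"
        using * mult_left_mono[OF le[of "cnj z"], of "norm (Z z)"] by simp
      then show ?thesis using False by (simp add: power2_eq_square)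
    qed simp
  qed
  then show ?thesis by (simp add: Z_def z_def cmod_def)
qed

lemma rc_field_cases:
  obtains (real) "\<And>k :: 'k::rc_field. \<exists>a. k = of_real a"
  | (complex) i :: "'k::rc_field" where "i * i = - 1" "\<And>k. \<exists>a b. k = of_real a + of_real b * i"
  using real_or_complex[where 'a = 'k] unfolding of_real_def
  by (metis mult_scaleR_left mult_1)

lemma re_part_of_real [simp]: "re_part (of_real a :: 'k::rc_field) = a"
proof -
  have "(norm (of_real a + 1 :: 'k))\<^sup>2 = (a + 1)\<^sup>2"
    by (metis norm_of_real of_real_1 of_real_add power2_abs)
  then show ?thesis by (simp add: re_part_def power2_sum)
qed

lemma re_part_complex_form:
  fixes i :: "'k::rc_field"
  assumes i: "i * i = - 1"
  shows "re_part (of_real a + of_real b * i) = a"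
proof -
  have "of_real a + of_real b * i + 1 = of_real (a + 1) + of_real b * i" by simp
  then have "(norm (of_real a + of_real b * i + 1))\<^sup>2 = (a + 1)\<^sup>2 + b\<^sup>2"
    by (simp only: norm_complex_form[OF i, of "a + 1" b]) simp
  then show ?thesis using norm_complex_form[OF i, of a b] by (simp add: re_part_def power2_sum)
qed

lemma re_part_add [simp]: "re_part (x + y) = re_part x + re_part y"
proof (cases rule: rc_field_cases[where 'k = 'a])
  case real
  then obtain a b where "x = of_real a" "y = of_real b" by metis
  then show ?thesis by (metis of_real_add re_part_of_real)
next
  case (complex i)
  then obtain a b c d where "x = of_real a + of_real b * i" "y = of_real c + of_real d * i" by metis
  moreover from this have "x + y = of_real (a + c) + of_real (b + d) * i" by (simp add: algebra_simps)
  ultimately show ?thesis by (simp only: re_part_complex_form[OF complex(1)])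
qed

lemma re_part_of_real_mult [simp]: "re_part (of_real r * x) = r * re_part x"
proof (cases rule: rc_field_cases[where 'k = 'a])
  case real
  then obtain a where "x = of_real a" by metis
  then show ?thesis by (metis of_real_mult re_part_of_real)
next
  case (complex i)
  then obtain a b where "x = of_real a + of_real b * i" by metis
  moreover from this have "of_real r * x = of_real (r * a) + of_real (r * b) * i"
    by (simp add: algebra_simps)
  ultimately show ?thesis by (simp only: re_part_complex_form[OF complex(1)])
qed

lemma re_part_scaleR [simp]: "re_part (r *\<^sub>R x) = r * re_part x"
  by (simp add: scaleR_conv_of_real)

lemma abs_re_part_le: "\<bar>re_part x\<bar> \<le> norm x"
proof (cases rule: rc_field_cases[where 'k = 'a])
  case real
  then obtain a where "x = of_real a" by metis
  then show ?thesis by simp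
next
  case (complex i)
  then obtain a b where "x = of_real a + of_real b * i" by metis
  then show ?thesis
    by (simp only: re_part_complex_form[OF complex(1)] norm_complex_form[OF complex(1)] real_sqrt_abs2 real_sqrt_ge_abs1)
qed

lemma re_part_le_norm: "re_part x \<le> norm x"
  using abs_re_part_le[of x] by linarith

lemma bounded_linear_re_part: "bounded_linear (re_part :: 'k::rc_field \<Rightarrow> real)"
  by (rule bounded_linear_intro[where K = 1]) (simp_all add: abs_re_part_le)

lemmas re_part_diff [simp] = bounded_linear.linear[OF bounded_linear_re_part, THEN linear_diff]
lemmas re_part_minus [simp] = bounded_linear.linear[OF bounded_linear_re_part, THEN linear_neg]
lemmas re_part_0 [simp] = bounded_linear.linear[OF bounded_linear_re_part, THEN linear_0]
lemmas re_part_sum = bounded_linear.linear[OF bounded_linear_re_part, THEN linear_sum]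
lemmas continuous_on_re_part [continuous_intros] =
  bounded_linear.continuous_on[OF bounded_linear_re_part]
text \<open>\<open>neg_i\<close> is \<open>- i\<close> in the complex case and \<open>0\<close> in the real case, so that \<open>re_part (neg_i * k)\<close> is the
  imaginary part of \<open>k\<close> in both cases.\<close>

definition neg_i :: "'k::rc_field" where
  "neg_i = (SOME j. norm j \<le> 1 \<and> (\<forall>k. k = of_real (re_part k) - j * of_real (re_part (j * k))))"

lemma neg_i_props: "norm (neg_i :: 'k::rc_field) \<le> 1 \<and>
  (\<forall>k :: 'k. k = of_real (re_part k) - neg_i * of_real (re_part (neg_i * k)))"
  unfolding neg_i_def
proof (rule someI_ex)
  show "\<exists>j :: 'k. norm j \<le> 1 \<and> (\<forall>k. k = of_real (re_part k) - j * of_real (re_part (j * k)))"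
  proof (cases rule: rc_field_cases[where 'k = 'k])
    case real
    then have "k = of_real (re_part k) - 0 * of_real (re_part (0 * k))" for k :: 'k
      by (metis diff_zero mult_zero_left re_part_of_real)
    then show ?thesis by (intro exI[of _ 0]) simp
  next
    case (complex i)
    have "norm (- i) = 1" using norm_complex_form[OF complex(1), of 0 1] by simp
    moreover have "k = of_real (re_part k) - (- i) * of_real (re_part (- i * k))" for k
    proof -
      obtain a b where k: "k = of_real a + of_real b * i" using complex(2) by metis
      have "- i * k = of_real b + of_real (- a) * i"
        using arg_cong[OF complex(1), of "\<lambda>t. t * of_real b"]
        by (simp add: k algebra_simps)
      then have "re_part (- i * k) = b" by (simp only: re_part_complex_form[OF complex(1)])
      moreover have "re_part k = a" unfolding k by (rule re_part_complex_form[OF complex(1)])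
      ultimately show ?thesis using k by (simp add: algebra_simps)
    qed
    ultimately show ?thesis by (intro exI[of _ "- i"]) auto
  qed
qed

lemma norm_neg_i: "norm (neg_i :: 'k::rc_field) \<le> 1"
  using neg_i_props by blast

lemma neg_i_decomp: "of_real (re_part k) - neg_i * of_real (re_part (neg_i * k)) = (k :: 'k::rc_field)"
  using neg_i_props by metis

text \<open>Decomposing 1 by \<open>neg_i_decomp\<close> leaves
  \<open>neg_i * of_real (re_part neg_i) = 0\<close>.\<close>

lemma re_part_neg_i [simp]: "re_part (neg_i :: 'k::rc_field) = 0"
proof (cases "neg_i = (0 :: 'k)")
  case False
  have "re_part (1 :: 'k) = 1" using re_part_of_real[where 'k = 'k, of 1] by simp
  then show ?thesis using neg_i_decomp[of "1 :: 'k"] False by simp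
qed simp

lemma norm_le_re_part: "norm (k :: 'k::rc_field) \<le> \<bar>re_part k\<bar> + \<bar>re_part (neg_i * k)\<bar>"
proof -
  have "norm k \<le> norm (of_real (re_part k) :: 'k) + norm (neg_i * of_real (re_part (neg_i * k)) :: 'k)"
    by (metis neg_i_decomp norm_triangle_ineq4)
  also have "\<dots> \<le> \<bar>re_part k\<bar> + 1 * \<bar>re_part (neg_i * k)\<bar>"
    unfolding norm_mult norm_of_real by (intro add_mono mult_right_mono norm_neg_i) auto
  finally show ?thesis by simp
qed

lemma ex_rotation: "\<exists>c. norm c = 1 \<and> c * (k :: 'k::rc_field) = of_real (norm k)"
proof (cases "k = 0")
  case False
  then show ?thesis by (intro exI[of _ "of_real (norm k) / k"]) (simp add: norm_divide)
qed (auto intro: exI[of _ 1])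

text \<open>The ball is a closed subset of the continuous image of a real square, with
  \<open>re_part k\<close> and \<open>re_part (neg_i * k)\<close> as coordinates.\<close>

lemma compact_cball_rc_field: "compact (cball (0 :: 'k::rc_field) r)"
proof -
  let ?h = "\<lambda>(a, b). of_real a - neg_i * of_real b :: 'k"
  have "compact (?h ` ({- r..r} \<times> {- r..r}))"
    by (intro compact_continuous_image compact_Times)
       (auto intro!: continuous_intros simp: case_prod_unfold)
  moreover have "cball 0 r \<subseteq> ?h ` ({- r..r} \<times> {- r..r})"
  proof
    fix k :: 'k assume "k \<in> cball 0 r"
    then have k: "norm k \<le> r" by simp
    have "norm (neg_i * k) \<le> norm k"
      unfolding norm_mult using mult_right_mono[OF norm_neg_i norm_ge_zero[of k]] by simp
    then have "\<bar>re_part k\<bar> \<le> r" "\<bar>re_part (neg_i * k)\<bar> \<le> r"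
      using abs_re_part_le[of k] abs_re_part_le[of "neg_i * k"] k by linarith+
    then show "k \<in> ?h ` ({- r..r} \<times> {- r..r})"
      by (intro image_eqI[where x = "(re_part k, re_part (neg_i * k))"]) (auto simp: neg_i_decomp)
  qed
  ultimately have "compact (?h ` ({- r..r} \<times> {- r..r}) \<inter> cball 0 r)"
    by (intro compact_Int_closed closed_cball)
  then show ?thesis using \<open>cball 0 r \<subseteq> _\<close> by (simp add: Int_absorb1)
qed

text \<open>One of the four quadrants carries a quarter of the absolute mass.\<close>

lemma ex_large_subset_sum:
  fixes a :: "'i \<Rightarrow> 'k::rc_field"
  assumes "finite A"
  shows "\<exists>B\<subseteq>A. (\<Sum>i\<in>A. norm (a i)) \<le> 4 * norm (sum a B)"
proof -
  \<comment> \<open>Splitting by the sign of the real part of \<open>c * a i\<close> costs a factor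
    2; choosing between \<open>c = 1\<close> and \<open>c = neg_i\<close> costs the other
    one.\<close>
  have real: "\<exists>B\<subseteq>A. (\<Sum>i\<in>A. \<bar>re_part (c * a i)\<bar>) \<le> 2 * norm (sum a B)" if c: "norm c \<le> 1" for c :: 'k
  proof -
    define P where "P = {i \<in> A. re_part (c * a i) \<ge> 0}"
    define N where "N = {i \<in> A. re_part (c * a i) < 0}"
    have *: "\<bar>\<Sum>i\<in>B. re_part (c * a i)\<bar> \<le> norm (sum a B)" for B
    proof -
      have "\<bar>\<Sum>i\<in>B. re_part (c * a i)\<bar> = \<bar>re_part (c * sum a B)\<bar>" by (simp add: re_part_sum sum_distrib_left)
      also have "\<dots> \<le> norm c * norm (sum a B)" using abs_re_part_le norm_mult by metis
      also have "\<dots> \<le> 1 * norm (sum a B)" using c by (intro mult_right_mono) auto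
      finally show ?thesis by simp
    qed
    have "(\<Sum>i\<in>A. \<bar>re_part (c * a i)\<bar>) = (\<Sum>i\<in>P. \<bar>re_part (c * a i)\<bar>) + (\<Sum>i\<in>N. \<bar>re_part (c * a i)\<bar>)"
      unfolding P_def N_def using assms
      by (subst sum.union_disjoint[symmetric]) (auto intro!: sum.cong)
    also have "\<dots> = (\<Sum>i\<in>P. re_part (c * a i)) + - (\<Sum>i\<in>N. re_part (c * a i))"
      unfolding sum_negf[symmetric] by (intro arg_cong2[of _ _ _ _ "(+)"] sum.cong) (auto simp: P_def N_def)
    also have "\<dots> \<le> norm (sum a P) + norm (sum a N)" using *[of P] *[of N] by linarith
    finally have le: "(\<Sum>i\<in>A. \<bar>re_part (c * a i)\<bar>) \<le> norm (sum a P) + norm (sum a N)" .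
    show ?thesis
    proof (cases "norm (sum a P) \<le> norm (sum a N)")
      case True then show ?thesis using le by (intro exI[of _ N]) (auto simp: N_def)
    next
      case False then show ?thesis using le by (intro exI[of _ P]) (auto simp: P_def)
    qed
  qed
  obtain B where B: "B \<subseteq> A" "(\<Sum>i\<in>A. \<bar>re_part (a i)\<bar>) \<le> 2 * norm (sum a B)"
    using real[of 1] by auto
  obtain C where C: "C \<subseteq> A" "(\<Sum>i\<in>A. \<bar>re_part (neg_i * a i)\<bar>) \<le> 2 * norm (sum a C)"
    using real[OF norm_neg_i] by auto
  have "(\<Sum>i\<in>A. norm (a i)) \<le> (\<Sum>i\<in>A. \<bar>re_part (a i)\<bar>) + (\<Sum>i\<in>A. \<bar>re_part (neg_i * a i)\<bar>)"
    unfolding sum.distrib[symmetric] by (intro sum_mono norm_le_re_part)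
  then have *: "(\<Sum>i\<in>A. norm (a i)) \<le> 2 * norm (sum a B) + 2 * norm (sum a C)"
    using B C by linarith
  show ?thesis
  proof (cases "norm (sum a B) \<le> norm (sum a C)")
    case True then show ?thesis using * C by (intro exI[of _ C]) auto
  next
    case False then show ?thesis using * B by (intro exI[of _ B]) auto
  qed
qed

section \<open>Minimax, cluster points and the Ekeland principle\<close>

text \<open>The potential \<open>\<Sum>i. (max 0 (d - v i))\<^sup>2\<close> can be decreased along the
  direction of a point of \<open>C\<close> that is good for the weights proportional to \<open>max 0 (d - v i)\<close>.\<close>

lemma finite_minimax:
  fixes C :: "('i \<Rightarrow> real) set"
  assumes fin: "finite I" and ne: "I \<noteq> {}"
    and conv: "\<And>v w t. v \<in> C \<Longrightarrow> w \<in> C \<Longrightarrow> 0 \<le> t \<Longrightarrow> t \<le> 1 \<Longrightarrow> (\<lambda>i. v i + t * (w i - v i)) \<in> C"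
    and bdd: "\<And>v i. v \<in> C \<Longrightarrow> i \<in> I \<Longrightarrow> \<bar>v i\<bar> \<le> B"
    and good: "\<And>l. (\<And>i. i \<in> I \<Longrightarrow> 0 \<le> l i) \<Longrightarrow> sum l I = 1 \<Longrightarrow> \<exists>v\<in>C. d \<le> (\<Sum>i\<in>I. l i * v i)"
    and less: "d' < d"
  shows "\<exists>v\<in>C. \<forall>i\<in>I. d' \<le> v i"
proof -
  define w where "w v i = max 0 (d - v i)" for v :: "'i \<Rightarrow> real" and i
  define p where "p v = (\<Sum>i\<in>I. (w v i)\<^sup>2)" for v
  have p0: "0 \<le> p v" for v by (simp add: p_def sum_nonneg)
  have "C \<noteq> {}" 
    using good[of "\<lambda>_. 1 / real (card I)"] fin ne by auto
  define m where "m = Inf (p ` C)"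
  have bb: "bdd_below (p ` C)" using p0 by (auto intro!: bdd_belowI)
  have m: "m \<le> p v" if "v \<in> C" for v unfolding m_def using that bb by (auto intro: cInf_lower)
  have m0: "0 \<le> m" unfolding m_def using \<open>C \<noteq> {}\<close> p0 by (auto intro: cInf_greatest)
  define N where "N = 4 * B\<^sup>2 * card I + 1"
  have N: "1 \<le> N" by (simp add: N_def)
  \<comment> \<open>To first order the move by \<open>t\<close> lowers \<open>p\<close> by at least
    \<open>2 * t * p v\<close>; \<open>N\<close> bounds the second-order coefficient.\<close>
  have step: "\<exists>v'\<in>C. p v' \<le> p v - t * p v * 2 + t\<^sup>2 * N" if v: "v \<in> C" and t: "0 \<le> t" "t \<le> 1" for v t
  proof (cases "p v = 0")
    case True then show ?thesis using v N by (auto intro!: bexI[of _ v])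
  next
    case False
    define W where "W = (\<Sum>i\<in>I. w v i)"
    have w0: "0 \<le> w v i" for i by (simp add: w_def)
    have "W \<noteq> 0"
      using False fin w0 unfolding W_def p_def by (auto simp: sum_nonneg_eq_0_iff)
    then have W: "0 < W" using w0 sum_nonneg[of I "w v"] by (auto simp: W_def)
    obtain v' where v': "v' \<in> C" "d \<le> (\<Sum>i\<in>I. w v i / W * v' i)"
      using good[of "\<lambda>i. w v i / W"] w0 W by (auto simp: W_def sum_divide_distrib[symmetric])
    have "(\<Sum>i\<in>I. w v i / W * v' i) = (\<Sum>i\<in>I. w v i * v' i) / W"
      by (simp add: sum_divide_distrib)
    then have 1: "d * W \<le> (\<Sum>i\<in>I. w v i * v' i)" using v'(2) W by (simp only: pos_le_divide_eq)
    have "w v i * v i = d * w v i - (w v i)\<^sup>2" for i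
      by (simp add: w_def max_def power2_eq_square algebra_simps)
    then have "(\<Sum>i\<in>I. w v i * v i) = d * W - p v"
      by (simp add: W_def p_def sum_subtractf sum_distrib_left)
    then have 2: "p v \<le> (\<Sum>i\<in>I. w v i * (v' i - v i))"
      using 1 by (simp add: right_diff_distrib sum_subtractf)
    define u where "u = (\<lambda>i. v i + t * (v' i - v i))"
    have u: "u \<in> C" unfolding u_def by (rule conv[OF v v'(1) t])
    have "\<bar>w u i\<bar> \<le> \<bar>w v i - t * (v' i - v i)\<bar>" for i
      by (auto simp: w_def u_def max_def abs_if)
    then have "(w u i)\<^sup>2 \<le> (w v i - t * (v' i - v i))\<^sup>2" for i
      by (simp add: abs_le_square_iff)
    then have "p u \<le> (\<Sum>i\<in>I. (w v i - t * (v' i - v i))\<^sup>2)"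
      unfolding p_def by (intro sum_mono)
    also have "\<dots> = p v - 2 * t * (\<Sum>i\<in>I. w v i * (v' i - v i)) + t\<^sup>2 * (\<Sum>i\<in>I. (v' i - v i)\<^sup>2)"
      unfolding p_def sum_distrib_left sum_subtractf[symmetric] sum.distrib[symmetric]
      by (intro sum.cong) (auto simp: power2_eq_square algebra_simps)
    also have "\<dots> \<le> p v - 2 * t * p v + t\<^sup>2 * N"
    proof -
      have "(v' i - v i)\<^sup>2 \<le> 4 * B\<^sup>2" if "i \<in> I" for i
      proof -
        have "\<bar>v' i - v i\<bar> \<le> \<bar>2 * B\<bar>" using bdd[OF v that] bdd[OF v'(1) that] by linarith
        then have "(v' i - v i)\<^sup>2 \<le> (2 * B)\<^sup>2" by (simp add: abs_le_square_iff)
        then show ?thesis by (simp add: power2_eq_square)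
      qed
      then have "(\<Sum>i\<in>I. (v' i - v i)\<^sup>2) \<le> (\<Sum>i\<in>I. 4 * B\<^sup>2)" by (intro sum_mono)
      then have "(\<Sum>i\<in>I. (v' i - v i)\<^sup>2) \<le> N" by (simp add: N_def mult.commute)
      then have "t\<^sup>2 * (\<Sum>i\<in>I. (v' i - v i)\<^sup>2) \<le> t\<^sup>2 * N" by (intro mult_left_mono) auto
      moreover have "2 * t * p v \<le> 2 * t * (\<Sum>i\<in>I. w v i * (v' i - v i))"
        using 2 t by (intro mult_left_mono) auto
      ultimately show ?thesis by linarith
    qed
    finally show ?thesis using u by (intro bexI[of _ u]) (auto simp: mult_ac)
  qed
  have "m = 0"
  proof (rule ccontr)
    assume "m \<noteq> 0"
    then have mp: "0 < m" using m0 by simp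
    \<comment> \<open>The second-order loss \<open>t\<^sup>2 * N\<close> is then at most
      \<open>t * m\<close>, half of the first-order gain, so a point within \<open>t * m\<close> of
      the infimum \<open>m\<close> moves below it.\<close>
    define t where "t = min 1 (m / N)"
    have t: "0 < t" "t \<le> 1" "t * N \<le> m" using mp N by (auto simp: t_def min_def field_simps)
    have "\<exists>x\<in>p ` C. x < m + t * m"
      using cInf_lessD[of "p ` C" "m + t * m"] \<open>C \<noteq> {}\<close> t mp by (auto simp: m_def)
    then obtain v where v: "v \<in> C" "p v < m + t * m" by auto
    obtain v' where v': "v' \<in> C" "p v' \<le> p v - t * p v * 2 + t\<^sup>2 * N"
      using step[OF v(1), of t] t by auto
    have "t\<^sup>2 * N \<le> t * m" using mult_left_mono[OF t(3), of t] t by (simp add: power2_eq_square mult_ac)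
    moreover have "t * m \<le> t * p v" using m[OF v(1)] t by (intro mult_left_mono) auto
    ultimately have "p v' < m" using v v'(2) by linarith
    then show False using m[OF v'(1)] by simp
  qed
  then have "\<exists>x\<in>p ` C. x < (d - d')\<^sup>2"
    using cInf_lessD[of "p ` C" "(d - d')\<^sup>2"] \<open>C \<noteq> {}\<close> less by (auto simp: m_def)
  then obtain v where v: "v \<in> C" "p v < (d - d')\<^sup>2" by auto
  have "d' \<le> v i" if i: "i \<in> I" for i
  proof (rule ccontr)
    assume "\<not> d' \<le> v i"
    then have "d - d' \<le> w v i" by (simp add: w_def)
    then have "(d - d')\<^sup>2 \<le> (w v i)\<^sup>2" using less by (intro power_mono) auto
    also have "\<dots> \<le> p v" unfolding p_def using i fin by (intro member_le_sum) auto
    finally show False using v by simp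
  qed
  then show ?thesis using v by blast
qed

text \<open>Tychonoff: \<xi> is a cluster point of the vectors of values of the \<open>h\<close>,
  along the finite sets \<open>A\<close> of requirements. The requirements \<open>R r h\<close> are
  kept apart from the values, so they hold exactly for each approximating \<open>h\<close> while
  only the values are approximated.\<close>

lemma ex_cluster_point:
  fixes ev :: "'i \<Rightarrow> 'h \<Rightarrow> 'v::metric_space"
  assumes comp: "\<And>i. i \<in> I \<Longrightarrow> compact (D i)"
    and ev: "\<And>i h. i \<in> I \<Longrightarrow> h \<in> H \<Longrightarrow> ev i h \<in> D i"
    and fip: "\<And>A. finite A \<Longrightarrow> A \<subseteq> Q \<Longrightarrow> \<exists>h\<in>H. \<forall>r\<in>A. R r h"
  shows "\<exists>\<xi>. \<forall>A I' e. finite A \<longrightarrow> A \<subseteq> Q \<longrightarrow> finite I' \<longrightarrow> I' \<subseteq> I \<longrightarrow> 0 < e \<longrightarrow>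
    (\<exists>h\<in>H. (\<forall>r\<in>A. R r h) \<and> (\<forall>i\<in>I'. dist (ev i h) (\<xi> i) < e))"
proof -
  let ?X = "product_topology (\<lambda>_. euclidean :: 'v topology) I"
  define P where "P = PiE I D"
  have cP: "compactin ?X P" unfolding P_def using comp by (simp add: compactin_PiE)
  define C where "C A = ?X closure_of ((\<lambda>h. \<lambda>i\<in>I. ev i h) ` {h \<in> H. \<forall>r\<in>A. R r h})" for A
  have Pin: "P \<subseteq> topspace ?X" unfolding P_def topspace_product_topology by (intro PiE_mono) simp
  have img: "(\<lambda>h. \<lambda>i\<in>I. ev i h) ` {h \<in> H. \<forall>r\<in>A. R r h} \<subseteq> P" for A
  proof (rule image_subsetI)
    fix h assume "h \<in> {h \<in> H. \<forall>r\<in>A. R r h}"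
    then show "(\<lambda>i\<in>I. ev i h) \<in> P" unfolding P_def by (intro restrict_PiE_iff[THEN iffD2] ballI ev) auto
  qed
  have "P \<inter> \<Inter>(C ` {A. finite A \<and> A \<subseteq> Q}) \<noteq> {}"
  proof (rule compactin_fip[THEN iffD1, THEN conjunct2, rule_format, OF cP], intro conjI allI impI)
    show "\<forall>C\<in>C ` {A. finite A \<and> A \<subseteq> Q}. closedin ?X C" by (auto simp: C_def)
    fix \<F> assume F: "finite \<F> \<and> \<F> \<subseteq> C ` {A. finite A \<and> A \<subseteq> Q}"
    then obtain \<A> where \<A>: "finite \<A>" "\<A> \<subseteq> {A. finite A \<and> A \<subseteq> Q}" "\<F> = C ` \<A>"
      by (meson finite_subset_image)
    have "finite (\<Union>\<A>)" "\<Union>\<A> \<subseteq> Q" using \<A> by auto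
    then obtain h where h: "h \<in> H" "\<forall>r\<in>\<Union>\<A>. R r h" using fip[of "\<Union>\<A>"] by metis
    have "(\<lambda>i\<in>I. ev i h) \<in> C A" if "A \<in> \<A>" for A
    proof -
      have "(\<lambda>i\<in>I. ev i h) \<in> (\<lambda>h. \<lambda>i\<in>I. ev i h) ` {h \<in> H. \<forall>r\<in>A. R r h}"
        by (rule imageI) (use h that in blast)
      then show ?thesis unfolding C_def
        by (rule closure_of_subset[OF order_trans[OF img Pin], THEN subsetD])
    qed
    moreover have "(\<lambda>i\<in>I. ev i h) \<in> P" using h ev by (simp add: P_def restrict_PiE_iff)
    ultimately show "P \<inter> \<Inter>\<F> \<noteq> {}" using \<A> by auto
  qed
  then obtain \<xi> where \<xi>: "\<xi> \<in> P" "\<And>A. finite A \<Longrightarrow> A \<subseteq> Q \<Longrightarrow> \<xi> \<in> C A" by auto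
  show ?thesis
  proof (intro exI[of _ \<xi>] allI impI)
    fix A I' and e :: real
    assume *: "finite A" "A \<subseteq> Q" "finite I'" "I' \<subseteq> I" "0 < e"
    define U where "U = PiE I (\<lambda>i. if i \<in> I' then ball (\<xi> i) e else UNIV)"
    have "openin ?X U" unfolding U_def
    proof (rule product_topology_basis)
      show "openin euclidean (if i \<in> I' then ball (\<xi> i) e else UNIV)" for i by simp
      show "finite {i. (if i \<in> I' then ball (\<xi> i) e else UNIV) \<noteq> topspace euclidean}"
        by (rule finite_subset[OF _ *(3)]) (auto split: if_splits)
    qed
    moreover have "\<xi> \<in> U" using \<xi>(1) *(5) by (auto simp: U_def P_def PiE_def Pi_def)
    ultimately have "\<exists>y. y \<in> (\<lambda>h. \<lambda>i\<in>I. ev i h) ` {h \<in> H. \<forall>r\<in>A. R r h} \<and> y \<in> U"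
      using \<xi>(2)[OF *(1,2)] unfolding C_def in_closure_of by blast
    then obtain h where h: "h \<in> H" "\<forall>r\<in>A. R r h" "(\<lambda>i\<in>I. ev i h) \<in> U" by auto
    have "dist (ev i h) (\<xi> i) < e" if i: "i \<in> I'" for i
    proof -
      have "i \<in> I" using i * by auto
      then have "(\<lambda>i\<in>I. ev i h) i \<in> (if i \<in> I' then ball (\<xi> i) e else UNIV)"
        using h(3) unfolding U_def by (rule PiE_mem[rotated])
      then show ?thesis using i \<open>i \<in> I\<close> by (simp add: dist_commute)
    qed
    then show "\<exists>h\<in>H. (\<forall>r\<in>A. R r h) \<and> (\<forall>i\<in>I'. dist (ev i h) (\<xi> i) < e)" using h by blast
  qed
qed

text \<open>\<open>S x\<close> is the set below \<open>x\<close> in the order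
  \<open>F v + e * dist v x \<le> F x\<close>. Near-minimisers of \<open>F\<close> in successive
  sets \<open>S\<close> make their diameters tend to 0, so completeness leaves one point
  \<open>u\<close>, which is minimal in this order.\<close>

lemma ekeland:
  fixes E :: "'e::complete_space set" and F :: "'e \<Rightarrow> real"
  assumes clE: "closed E" and cont: "continuous_on E F"
    and F0: "\<And>x. x \<in> E \<Longrightarrow> 0 \<le> F x" and x0: "x0 \<in> E" and e: "0 < e"
  shows "\<exists>u\<in>E. F u + e * dist u x0 \<le> F x0 \<and> (\<forall>v\<in>E. F u - e * dist v u \<le> F v)"
proof -
  define S where "S x = {v \<in> E. F v + e * dist v x \<le> F x}" for x
  have Sself: "x \<in> S x" if "x \<in> E" for x using that by (simp add: S_def)
  have Strans: "z \<in> S x" if "z \<in> S y" "y \<in> S x" for x y z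
  proof -
    have "e * dist z x \<le> e * dist z y + e * dist y x"
      using e mult_left_mono[OF dist_triangle[of z x y], of e] by (simp add: distrib_left)
    then show ?thesis using that by (auto simp: S_def)
  qed
  have bb: "bdd_below (F ` S x)" for x using F0 by (auto intro!: bdd_belowI simp: S_def)
  have nxt: "\<exists>y. y \<in> S x \<and> F y < Inf (F ` S x) + (1/2)^n" if "x \<in> E" for x n
  proof -
    have "F ` S x \<noteq> {}" using Sself[OF that] by auto
    then obtain s where "s \<in> F ` S x" "s < Inf (F ` S x) + (1/2)^n"
      using cInf_lessD[of "F ` S x" "Inf (F ` S x) + (1/2)^n"] by auto
    then show ?thesis by auto
  qed
  obtain x where x: "x 0 = x0" "\<And>n. x n \<in> E" "\<And>n. x (Suc n) \<in> S (x n)"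
    "\<And>n. F (x (Suc n)) < Inf (F ` S (x n)) + (1/2)^n"
  proof -
    have "\<exists>f. f 0 = x0 \<and> (\<forall>n. f n \<in> E \<and> (f (Suc n) \<in> S (f n) \<and> F (f (Suc n)) < Inf (F ` S (f n)) + (1/2)^n))"
    proof -
      have "\<exists>f. \<forall>n. (f n \<in> E \<and> (n = 0 \<longrightarrow> f n = x0)) \<and> (f (Suc n) \<in> S (f n) \<and> F (f (Suc n)) < Inf (F ` S (f n)) + (1/2)^n)"
      proof (rule dependent_nat_choice)
        show "\<exists>x. x \<in> E \<and> (0 = (0::nat) \<longrightarrow> x = x0)" using x0 by auto
        show "\<exists>y. (y \<in> E \<and> (Suc n = 0 \<longrightarrow> y = x0)) \<and> y \<in> S x \<and> F y < Inf (F ` S x) + (1/2)^n"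
          if "x \<in> E \<and> (n = 0 \<longrightarrow> x = x0)" for x n
          using nxt[of x n] that by (auto simp: S_def)
      qed
      then show ?thesis by metis
    qed
    then show ?thesis using that by blast
  qed
  have mem: "x m \<in> S (x n)" if "n \<le> m" for n m
    using that by (induction rule: dec_induct) (auto intro: Sself x Strans)
  \<comment> \<open>Such a \<open>v\<close> also lies in \<open>S (x n)\<close>, so
    \<open>F v\<close> is at least the infimum that \<open>F (x (Suc n))\<close> nearly attains, and
    their difference bounds the distance.\<close>
  have small: "e * dist v (x (Suc n)) \<le> (1/2)^n" if "v \<in> S (x (Suc n))" for v n
  proof -
    have "v \<in> S (x n)" using that x(3) Strans by blast
    then have "Inf (F ` S (x n)) \<le> F v" using bb by (auto intro: cInf_lower)
    then show ?thesis using that x(4)[of n] by (auto simp: S_def)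
  qed
  have "Cauchy x"
  proof (rule metric_CauchyI)
    fix r :: real assume r: "0 < r"
    obtain n where n: "(1/2)^n < e * r / 2"
      using real_arch_pow_inv[of "e * r / 2" "1/2"] e r by auto
    have "dist (x m) (x k) < r" if "Suc n \<le> m" "Suc n \<le> k" for m k
    proof -
      have "e * dist (x m) (x (Suc n)) < e * (r / 2)" "e * dist (x k) (x (Suc n)) < e * (r / 2)"
        using small[OF mem[OF that(1)]] small[OF mem[OF that(2)]] n by auto
      then have "dist (x m) (x (Suc n)) < r / 2" "dist (x k) (x (Suc n)) < r / 2" using e by auto
      then show ?thesis by (rule dist_triangle_half_l)
    qed
    then show "\<exists>M. \<forall>m\<ge>M. \<forall>n\<ge>M. dist (x m) (x n) < r" by blast
  qed
  then obtain u where u: "x \<longlonglongrightarrow> u" by (meson Cauchy_convergent convergent_def)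
  have uE: "u \<in> E" using clE x(2) u by (metis closed_sequentially)
  have "(\<lambda>n. F (x n)) \<longlonglongrightarrow> F u"
    using continuous_on_tendsto_compose[OF cont u uE] x(2) by simp
  have uS: "u \<in> S (x n)" for n
  proof -
    have "(\<lambda>m. F (x m) + e * dist (x m) (x n)) \<longlonglongrightarrow> F u + e * dist u (x n)"
      by (intro tendsto_intros u \<open>(\<lambda>n. F (x n)) \<longlonglongrightarrow> F u\<close>)
    then have "F u + e * dist u (x n) \<le> F (x n)"
      by (rule LIMSEQ_le_const2) (use mem in \<open>auto simp: S_def\<close>)
    then show ?thesis using uE by (simp add: S_def)
  qed
  \<comment> \<open>A violating \<open>v\<close> would lie below every \<open>x n\<close>, so the
    sequence would converge to \<open>v\<close> as well as to \<open>u\<close>.\<close>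
  have "F u - e * dist v u \<le> F v" if v: "v \<in> E" for v
  proof (rule ccontr)
    assume "\<not> ?thesis"
    then have "v \<in> S u" "v \<noteq> u" using v by (auto simp: S_def)
    then have "v \<in> S (x n)" for n using uS Strans by blast
    then have le: "e * dist v (x (Suc n)) \<le> (1/2)^n" for n using small by blast
    have "(\<lambda>n. e * dist v (x (Suc n))) \<longlonglongrightarrow> e * dist v u"
      by (intro tendsto_intros LIMSEQ_Suc u)
    moreover have "(\<lambda>n. (1/2::real)^n) \<longlonglongrightarrow> 0" by (simp add: LIMSEQ_realpow_zero)
    ultimately have "e * dist v u \<le> 0" using le by (intro LIMSEQ_le) auto
    then show False using \<open>v \<noteq> u\<close> e by (simp add: mult_le_0_iff)
  qed
  then show ?thesis using uE uS[of 0] x(1) by (intro bexI[of _ u]) (auto simp: S_def)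
qed

section \<open>Positive functionals on bounded functions\<close>

text \<open>Positivity in terms of \<open>re_part\<close>, since the scalars carry no order; this
  treats both fields uniformly.\<close>

definition nonneg :: "'k::rc_field \<Rightarrow> bool" where
  "nonneg z \<longleftrightarrow> z = of_real (re_part z) \<and> 0 \<le> re_part z"

lemma nonneg_of_real [simp]: "nonneg (of_real r) \<longleftrightarrow> 0 \<le> r"
  by (simp add: nonneg_def)

lemma nonneg_0 [simp]: "nonneg 0"
  by (simp add: nonneg_def)

lemma nonneg_1 [simp]: "nonneg 1"
  using nonneg_of_real[of 1] by simp

lemma nonneg_add: "nonneg x \<Longrightarrow> nonneg y \<Longrightarrow> nonneg (x + y)"
  unfolding nonneg_def by (metis add_nonneg_nonneg of_real_add re_part_add)

lemma nonneg_mult: "nonneg x \<Longrightarrow> nonneg y \<Longrightarrow> nonneg (x * y)"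
  unfolding nonneg_def by (metis mult_nonneg_nonneg of_real_mult re_part_of_real)

lemma closed_nonneg: "closed {z :: 'k::rc_field. nonneg z}"
  unfolding nonneg_def by (intro closed_Collect_conj closed_Collect_eq closed_Collect_le continuous_intros)

lemma re_part_1 [simp]: "re_part 1 = 1"
  using re_part_of_real[of 1] by simp

section \<open>Positive functionals: mass, restriction and order\<close>

definition bdd_on :: "'p set \<Rightarrow> ('p \<Rightarrow> 'k::rc_field) \<Rightarrow> bool" where
  "bdd_on L f \<longleftrightarrow> (\<exists>B. \<forall>p\<in>L. norm (f p) \<le> B)"

lemma bdd_onI: "(\<And>p. p \<in> L \<Longrightarrow> norm (f p) \<le> B) \<Longrightarrow> bdd_on L f"
  by (auto simp: bdd_on_def)

lemma bdd_on_const [simp]: "bdd_on L (\<lambda>_. c)"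
  by (auto simp: bdd_on_def)

lemma bdd_on_add: "bdd_on L f \<Longrightarrow> bdd_on L g \<Longrightarrow> bdd_on L (\<lambda>p. f p + g p)"
  unfolding bdd_on_def by (meson add_mono norm_triangle_le)

lemma bdd_on_diff: "bdd_on L f \<Longrightarrow> bdd_on L g \<Longrightarrow> bdd_on L (\<lambda>p. f p - g p)"
  unfolding bdd_on_def by (meson add_mono norm_triangle_le_diff)

lemma bdd_on_mult: "bdd_on L f \<Longrightarrow> bdd_on L g \<Longrightarrow> bdd_on L (\<lambda>p. f p * g p)"
  unfolding bdd_on_def norm_mult by (meson mult_mono' norm_ge_zero)

lemma bdd_on_of_real_re_part: "bdd_on L f \<Longrightarrow> bdd_on L (\<lambda>p. of_real (re_part (f p)))"
  unfolding bdd_on_def norm_of_real using abs_re_part_le order_trans by blast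

lemma bdd_on_of_bool [simp]: "bdd_on L (\<lambda>p. of_bool (P p))"
  by (rule bdd_onI[where B = 1]) auto

lemma bdd_on_sum: "(\<And>i. i \<in> I \<Longrightarrow> bdd_on L (f i)) \<Longrightarrow> bdd_on L (\<lambda>p. \<Sum>i\<in>I. f i p)"
  by (induction I rule: infinite_finite_induct) (auto intro: bdd_on_add)

text \<open>Equivalently, these are the finitely additive positive measures on all subsets of \<open>L\<close>.\<close>

definition pos_fun :: "'p set \<Rightarrow> (('p \<Rightarrow> 'k::rc_field) \<Rightarrow> 'k) set" where
  "pos_fun L = {\<nu>.
     (\<forall>f g. bdd_on L f \<longrightarrow> bdd_on L g \<longrightarrow> \<nu> (\<lambda>p. f p + g p) = \<nu> f + \<nu> g) \<and>
     (\<forall>c f. bdd_on L f \<longrightarrow> \<nu> (\<lambda>p. c * f p) = c * \<nu> f) \<and>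
     (\<forall>f. bdd_on L f \<longrightarrow> (\<forall>p\<in>L. nonneg (f p)) \<longrightarrow> nonneg (\<nu> f))}"

definition mass :: "(('p \<Rightarrow> 'k::rc_field) \<Rightarrow> 'k) \<Rightarrow> real" where
  "mass \<nu> = re_part (\<nu> (\<lambda>_. 1))"

definition restr :: "'p set \<Rightarrow> (('p \<Rightarrow> 'k::rc_field) \<Rightarrow> 'k) \<Rightarrow> ('p \<Rightarrow> 'k) \<Rightarrow> 'k" where
  "restr V \<nu> f = \<nu> (\<lambda>p. of_bool (p \<in> V) * f p)"

definition dom_by :: "'p set \<Rightarrow> (('p \<Rightarrow> 'k::rc_field) \<Rightarrow> 'k) \<Rightarrow> (('p \<Rightarrow> 'k) \<Rightarrow> 'k) \<Rightarrow> bool" where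
  "dom_by L \<nu>' \<nu> \<longleftrightarrow> (\<lambda>f. \<nu> f - \<nu>' f) \<in> pos_fun L"

lemma pos_funI:
  assumes "\<And>f g. bdd_on L f \<Longrightarrow> bdd_on L g \<Longrightarrow> \<nu> (\<lambda>p. f p + g p) = \<nu> f + \<nu> g"
    and "\<And>c f. bdd_on L f \<Longrightarrow> \<nu> (\<lambda>p. c * f p) = c * \<nu> f"
    and "\<And>f. bdd_on L f \<Longrightarrow> (\<And>p. p \<in> L \<Longrightarrow> nonneg (f p)) \<Longrightarrow> nonneg (\<nu> f)"
  shows "\<nu> \<in> pos_fun L"
  using assms by (simp add: pos_fun_def)

context
  fixes L :: "'p set" and \<nu> :: "('p \<Rightarrow> 'k::rc_field) \<Rightarrow> 'k"
  assumes \<nu>: "\<nu> \<in> pos_fun L"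
begin

lemma pos_fun_add: "bdd_on L f \<Longrightarrow> bdd_on L g \<Longrightarrow> \<nu> (\<lambda>p. f p + g p) = \<nu> f + \<nu> g"
  using \<nu> by (simp add: pos_fun_def)

lemma pos_fun_scale: "bdd_on L f \<Longrightarrow> \<nu> (\<lambda>p. c * f p) = c * \<nu> f"
  using \<nu> by (simp add: pos_fun_def)

lemma pos_fun_nonneg: "bdd_on L f \<Longrightarrow> (\<And>p. p \<in> L \<Longrightarrow> nonneg (f p)) \<Longrightarrow> nonneg (\<nu> f)"
  using \<nu> by (simp add: pos_fun_def)

lemma pos_fun_diff: "bdd_on L f \<Longrightarrow> bdd_on L g \<Longrightarrow> \<nu> (\<lambda>p. f p - g p) = \<nu> f - \<nu> g"
  using pos_fun_add[of f "\<lambda>p. - 1 * g p"] pos_fun_scale[of g "- 1"]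
    bdd_on_mult[of L "\<lambda>_. - 1" g] by simp

text \<open>A function vanishing on \<open>L\<close> is nonnegative there together with its
  negative, so positivity makes \<nu> blind to values off \<open>L\<close>.\<close>

lemma pos_fun_cong:
  assumes "bdd_on L f" and eq: "\<And>p. p \<in> L \<Longrightarrow> f p = g p"
  shows "\<nu> f = \<nu> g"
proof -
  have g: "bdd_on L g" using assms by (auto simp: bdd_on_def)
  have "nonneg (\<nu> (\<lambda>p. f p - g p))" "nonneg (\<nu> (\<lambda>p. g p - f p))"
    using assms g by (auto intro!: pos_fun_nonneg bdd_on_diff)
  then have *: "nonneg (\<nu> f - \<nu> g)" "nonneg (\<nu> g - \<nu> f)" using assms(1) g by (simp_all add: pos_fun_diff)
  then have "re_part (\<nu> f - \<nu> g) = 0" unfolding nonneg_def by simp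
  then show ?thesis using *(1) unfolding nonneg_def by (metis of_real_0 right_minus_eq)
qed

lemma pos_fun_sum:
  "(\<And>i. i \<in> I \<Longrightarrow> bdd_on L (f i)) \<Longrightarrow> \<nu> (\<lambda>p. \<Sum>i\<in>I. f i p) = (\<Sum>i\<in>I. \<nu> (f i))"
proof (induction I rule: infinite_finite_induct)
  case (insert i I)
  then show ?case by (simp add: pos_fun_add bdd_on_sum)
qed (use pos_fun_scale[of "\<lambda>_. 0" 0] in simp_all)

lemma mass_nonneg: "0 \<le> mass \<nu>"
  using pos_fun_nonneg[of "\<lambda>_. 1"] by (simp add: mass_def nonneg_def)

lemma pos_fun_const: "\<nu> (\<lambda>_. c) = c * of_real (mass \<nu>)"
  using pos_fun_nonneg[of "\<lambda>_. 1"] pos_fun_scale[of "\<lambda>_. 1" c] by (simp add: mass_def nonneg_def)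

text \<open>Positivity speaks of real functions only. Adding a constant shows that \<nu> is real on
  real functions; with \<open>neg_i_decomp\<close> the real part of \<open>\<nu> f\<close> is then
  the value of \<nu> at the real part of \<open>f\<close>.\<close>

lemma pos_fun_mono:
  assumes "bdd_on L f" "\<And>p. p \<in> L \<Longrightarrow> re_part (f p) \<le> B"
  shows "re_part (\<nu> f) \<le> B * mass \<nu>"
proof -
  have bj: "bdd_on L (\<lambda>p. neg_i * f p)" using assms by (intro bdd_on_mult) auto
  have pos: "\<exists>r. \<nu> (\<lambda>p. of_real (re_part (g p))) = of_real r" if bg: "bdd_on L g" for g
  proof -
    obtain C where C: "\<And>p. p \<in> L \<Longrightarrow> norm (g p) \<le> C" using bg by (auto simp: bdd_on_def)
    have "nonneg (\<nu> (\<lambda>p. of_real (re_part (g p)) + of_real C))"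
    proof (rule pos_fun_nonneg)
      show "bdd_on L (\<lambda>p. of_real (re_part (g p)) + of_real C)"
        using bg by (intro bdd_on_add bdd_on_of_real_re_part) auto
      show "nonneg (of_real (re_part (g p)) + of_real C)" if "p \<in> L" for p
        using C[OF that] abs_re_part_le[of "g p"] by (simp flip: of_real_add)
    qed
    then have "nonneg (\<nu> (\<lambda>p. of_real (re_part (g p))) + of_real (C * mass \<nu>))"
      using bg by (simp add: pos_fun_add bdd_on_of_real_re_part pos_fun_const)
    then show ?thesis unfolding nonneg_def by (metis add_diff_cancel_right' of_real_diff)
  qed
  obtain r s where rs: "\<nu> (\<lambda>p. of_real (re_part (f p))) = of_real r" "\<nu> (\<lambda>p. of_real (re_part (neg_i * f p))) = of_real s"
    using pos[OF assms(1)] pos[OF bj] by blast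
  have "\<nu> f = \<nu> (\<lambda>p. of_real (re_part (f p)) - neg_i * of_real (re_part (neg_i * f p)))" by (simp add: neg_i_decomp)
  also have "\<dots> = of_real r - neg_i * of_real s"
    using assms(1) bj by (simp add: pos_fun_diff pos_fun_scale bdd_on_of_real_re_part bdd_on_mult rs)
  finally have "re_part (\<nu> f) = r - re_part (of_real s * neg_i :: 'k)" by (simp add: mult.commute)
  then have r: "re_part (\<nu> f) = r" by (simp only: re_part_of_real_mult re_part_neg_i)
  have "nonneg (\<nu> (\<lambda>p. of_real B - of_real (re_part (f p))))"
    using assms by (intro pos_fun_nonneg bdd_on_diff bdd_on_of_real_re_part) (auto simp flip: of_real_diff)
  then have "nonneg (of_real (B * mass \<nu> - r) :: 'k)"
    using assms by (simp add: pos_fun_diff bdd_on_of_real_re_part pos_fun_const rs)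
  then show ?thesis using r by (simp only: nonneg_of_real)
qed

text \<open>Rotating the value onto the positive axis reduces the bound to
  \<open>pos_fun_mono\<close>.\<close>

lemma norm_pos_fun_le:
  assumes "\<And>p. p \<in> L \<Longrightarrow> norm (f p) \<le> B"
  shows "norm (\<nu> f) \<le> B * mass \<nu>"
proof -
  obtain c where c: "norm c = 1" "c * \<nu> f = of_real (norm (\<nu> f))" using ex_rotation by blast
  have bf: "bdd_on L f" using assms by (rule bdd_onI)
  have "re_part (\<nu> (\<lambda>p. c * f p)) \<le> B * mass \<nu>"
  proof (rule pos_fun_mono)
    show "re_part (c * f p) \<le> B" if "p \<in> L" for p
      using re_part_le_norm[of "c * f p"] assms[OF that] c by (simp add: norm_mult)
  qed (use bf in \<open>intro bdd_on_mult\<close>, auto)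
  then show ?thesis using bf c by (simp add: pos_fun_scale)
qed

lemma restr_pos_fun: "restr V \<nu> \<in> pos_fun L"
proof (rule pos_funI)
  fix f g :: "'p \<Rightarrow> 'k" assume "bdd_on L f" "bdd_on L g"
  then show "restr V \<nu> (\<lambda>p. f p + g p) = restr V \<nu> f + restr V \<nu> g"
    unfolding restr_def distrib_left by (intro pos_fun_add bdd_on_mult) auto
next
  fix c and f :: "'p \<Rightarrow> 'k" assume "bdd_on L f"
  then show "restr V \<nu> (\<lambda>p. c * f p) = c * restr V \<nu> f"
    unfolding restr_def mult.left_commute[of _ c] by (intro pos_fun_scale bdd_on_mult) auto
next
  fix f :: "'p \<Rightarrow> 'k" assume "bdd_on L f" "\<And>p. p \<in> L \<Longrightarrow> nonneg (f p)"
  then show "nonneg (restr V \<nu> f)"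
    unfolding restr_def by (intro pos_fun_nonneg bdd_on_mult nonneg_mult) auto
qed

lemma restr_compl: "bdd_on L f \<Longrightarrow> \<nu> f - restr V \<nu> f = restr (- V) \<nu> f"
proof -
  assume f: "bdd_on L f"
  have "\<nu> (\<lambda>p. f p - of_bool (p \<in> V) * f p) = \<nu> f - restr V \<nu> f"
    unfolding restr_def using f by (intro pos_fun_diff bdd_on_mult) auto
  moreover have "(\<lambda>p. f p - of_bool (p \<in> V) * f p) = (\<lambda>p. of_bool (p \<in> - V) * f p)" by auto
  ultimately show ?thesis by (simp add: restr_def)
qed

end

lemma pos_fun_eqI:
  assumes "\<nu> \<in> pos_fun L" and "\<And>f. bdd_on L f \<Longrightarrow> \<nu>' f = \<nu> f"
  shows "\<nu>' \<in> pos_fun L"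
  using assms by (auto simp: pos_fun_def bdd_on_add bdd_on_mult)

lemma dom_by_restr: "\<nu> \<in> pos_fun L \<Longrightarrow> dom_by L (restr V \<nu>) \<nu>"
  unfolding dom_by_def by (rule pos_fun_eqI[OF restr_pos_fun[of \<nu> L "- V"]]) (simp_all add: restr_compl)

lemma zero_pos_fun: "(\<lambda>_. 0) \<in> pos_fun L"
  by (rule pos_funI) auto

lemma plus_pos_fun: "\<nu> \<in> pos_fun L \<Longrightarrow> \<nu>' \<in> pos_fun L \<Longrightarrow> (\<lambda>f. \<nu> f + \<nu>' f) \<in> pos_fun L"
  by (rule pos_funI) (simp_all add: pos_fun_add pos_fun_scale pos_fun_nonneg nonneg_add algebra_simps)

lemma scale_pos_fun: "\<nu> \<in> pos_fun L \<Longrightarrow> 0 \<le> c \<Longrightarrow> (\<lambda>f. of_real c * \<nu> f) \<in> pos_fun L"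
  by (rule pos_funI) (simp_all add: pos_fun_add pos_fun_scale pos_fun_nonneg nonneg_mult algebra_simps)

lemma sum_pos_fun:
  "(\<And>i. i \<in> I \<Longrightarrow> \<nu> i \<in> pos_fun L) \<Longrightarrow> (\<lambda>f. \<Sum>i\<in>I. \<nu> i f) \<in> pos_fun L"
  by (induction I rule: infinite_finite_induct) (auto intro: zero_pos_fun plus_pos_fun)

lemma point_pos_fun: "k \<in> L \<Longrightarrow> (\<lambda>f. f k) \<in> pos_fun L"
  by (rule pos_funI) auto

lemma dom_by_refl: "dom_by L \<nu> \<nu>"
  unfolding dom_by_def by (simp add: zero_pos_fun)

lemma dom_by_trans: "dom_by L a b \<Longrightarrow> dom_by L b c \<Longrightarrow> dom_by L a c"
  unfolding dom_by_def using plus_pos_fun[of "\<lambda>f. b f - a f" L "\<lambda>f. c f - b f"] by simp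

lemma mass_diff: "mass (\<lambda>f. \<nu> f - \<nu>' f) = mass \<nu> - mass \<nu>'"
  by (simp add: mass_def)

lemma mass_mono: "dom_by L \<nu>' \<nu> \<Longrightarrow> mass \<nu>' \<le> mass \<nu>"
  unfolding dom_by_def using mass_nonneg[of "\<lambda>f. \<nu> f - \<nu>' f" L] mass_diff[of \<nu> \<nu>'] by simp

lemma mass_restr_mono:
  assumes "dom_by L \<nu>' \<nu>"
  shows "mass (restr V \<nu>') \<le> mass (restr V \<nu>)"
proof -
  have "(\<lambda>f. restr V \<nu> f - restr V \<nu>' f) = restr V (\<lambda>f. \<nu> f - \<nu>' f)" by (simp add: restr_def fun_eq_iff)
  then have "dom_by L (restr V \<nu>') (restr V \<nu>)"
    using assms restr_pos_fun unfolding dom_by_def by metis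
  then show ?thesis by (rule mass_mono)
qed

lemma mass_restr_mono_set:
  assumes "\<nu> \<in> pos_fun L" "\<And>p. p \<in> L \<Longrightarrow> p \<in> V \<Longrightarrow> p \<in> W"
  shows "mass (restr V \<nu>) \<le> mass (restr W \<nu>)"
proof -
  have "nonneg (\<nu> (\<lambda>p. of_bool (p \<in> W) - of_bool (p \<in> V)))"
  proof (rule pos_fun_nonneg[OF assms(1)])
    show "nonneg (of_bool (p \<in> W) - of_bool (p \<in> V) :: 'b)" if "p \<in> L" for p
      using assms(2)[OF that] by auto
  qed (intro bdd_on_diff bdd_on_of_bool)
  then have "0 \<le> re_part (\<nu> (\<lambda>p. of_bool (p \<in> W) - of_bool (p \<in> V)))" by (simp add: nonneg_def)
  then show ?thesis by (simp add: pos_fun_diff[OF assms(1)] mass_def restr_def)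
qed

lemma mass_restr_Union:
  assumes \<nu>: "\<nu> \<in> pos_fun L" and fin: "finite I" and cov: "L \<subseteq> (\<Union>i\<in>I. V i)"
  shows "mass \<nu> \<le> (\<Sum>i\<in>I. mass (restr (V i) \<nu>))"
proof -
  have "nonneg (\<nu> (\<lambda>p. (\<Sum>i\<in>I. of_bool (p \<in> V i)) - 1))"
  proof (rule pos_fun_nonneg[OF \<nu>])
    show "bdd_on L (\<lambda>p. (\<Sum>i\<in>I. of_bool (p \<in> V i)) - 1)"
      by (intro bdd_on_diff bdd_on_sum) auto
    show "nonneg ((\<Sum>i\<in>I. of_bool (p \<in> V i)) - 1 :: 'b)" if pL: "p \<in> L" for p
    proof -
      obtain j where j: "j \<in> I" "p \<in> V j" using cov pL by auto
      have "(\<Sum>i\<in>I. of_bool (p \<in> V i)) - 1 = (of_real (\<Sum>i\<in>I - {j}. of_bool (p \<in> V i)) :: 'b)"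
        using j fin by (subst sum.remove[of _ j]) auto
      then show ?thesis by (simp add: sum_nonneg del: of_real_sum)
    qed
  qed
  then have "0 \<le> re_part (\<nu> (\<lambda>p. (\<Sum>i\<in>I. of_bool (p \<in> V i)) - 1))" by (simp add: nonneg_def)
  also have "\<dots> = re_part ((\<Sum>i\<in>I. \<nu> (\<lambda>p. of_bool (p \<in> V i))) - \<nu> (\<lambda>p. 1))"
    by (simp add: pos_fun_diff[OF \<nu>] pos_fun_sum[OF \<nu>] bdd_on_sum)
  finally show ?thesis by (simp add: mass_def restr_def re_part_sum)
qed

text \<open>With no mass off \<open>V\<close>, the functional sees \<open>f - c\<close> only where
  it is at most \<open>r\<close>.\<close>

lemma concentrated_approx:
  assumes \<nu>: "\<nu> \<in> pos_fun L" and conc: "mass (restr (- V) \<nu>) = 0" and f: "bdd_on L f"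
    and near: "\<And>p. p \<in> L \<Longrightarrow> p \<in> V \<Longrightarrow> norm (f p - c) \<le> r"
  shows "norm (\<nu> f - c * of_real (mass \<nu>)) \<le> r * mass \<nu>"
proof -
  define g where "g = (\<lambda>p. f p - c)"
  have g: "bdd_on L g" unfolding g_def using f by (intro bdd_on_diff) auto
  then obtain B where B: "\<And>p. p \<in> L \<Longrightarrow> norm (g p) \<le> B" by (auto simp: bdd_on_def)
  have "norm (restr (- V) \<nu> g) \<le> B * mass (restr (- V) \<nu>)"
    using B by (intro norm_pos_fun_le[OF restr_pos_fun[OF \<nu>]])
  then have "\<nu> g = restr V \<nu> g" using restr_compl[OF \<nu> g, of V] conc by simp
  have "norm (restr V \<nu> g) \<le> r * mass \<nu>"
  proof (cases "L \<inter> V = {}")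
    \<comment> \<open>Here \<open>near\<close> says nothing about the sign of \<open>r\<close>; but
      \<nu> has mass 0 and both sides vanish.\<close>
    case True
    have "restr V \<nu> g = \<nu> (\<lambda>_. 0)" unfolding restr_def
      by (rule pos_fun_cong[OF \<nu>]) (use g True in \<open>auto intro!: bdd_on_mult\<close>)
    moreover have "mass \<nu> = 0"
    proof -
      have "\<nu> (\<lambda>_. 1) = restr (- V) \<nu> (\<lambda>_. 1)" unfolding restr_def
        by (rule pos_fun_cong[OF \<nu>]) (use True in auto)
      then show ?thesis using conc by (simp add: mass_def)
    qed
    ultimately show ?thesis by (simp add: pos_fun_const[OF \<nu>])
  next
    case False
    then have "0 \<le> r" using near by (meson IntE all_not_in_conv norm_ge_zero order_trans)
    then show ?thesis unfolding restr_def
      by (intro norm_pos_fun_le[OF \<nu>]) (auto simp: g_def near)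
  qed
  moreover have "\<nu> g = \<nu> f - c * of_real (mass \<nu>)"
    unfolding g_def using f by (simp add: pos_fun_diff[OF \<nu>] pos_fun_const[OF \<nu>])
  ultimately show ?thesis using \<open>\<nu> g = restr V \<nu> g\<close> by simp
qed

lemma pos_fun_limit:
  assumes "\<And>n. r n \<in> pos_fun L" and lim: "\<And>f. bdd_on L f \<Longrightarrow> (\<lambda>n. r n f) \<longlonglongrightarrow> r' f"
  shows "r' \<in> pos_fun L"
proof (rule pos_funI)
  fix f g :: "'a \<Rightarrow> 'b" assume fg: "bdd_on L f" "bdd_on L g"
  have "(\<lambda>n. r n (\<lambda>p. f p + g p)) \<longlonglongrightarrow> r' f + r' g"
    using tendsto_add[OF lim[OF fg(1)] lim[OF fg(2)]] fg by (simp add: pos_fun_add[OF assms(1)])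
  then show "r' (\<lambda>p. f p + g p) = r' f + r' g" using lim[OF bdd_on_add[OF fg]] LIMSEQ_unique by blast
next
  fix c and f :: "'a \<Rightarrow> 'b" assume f: "bdd_on L f"
  have "(\<lambda>n. r n (\<lambda>p. c * f p)) \<longlonglongrightarrow> c * r' f"
    using tendsto_mult_left[OF lim[OF f], of c] f by (simp add: pos_fun_scale[OF assms(1)])
  moreover have "bdd_on L (\<lambda>p. c * f p)" using f by (intro bdd_on_mult) auto
  ultimately show "r' (\<lambda>p. c * f p) = c * r' f" using lim LIMSEQ_unique by blast
next
  fix f :: "'a \<Rightarrow> 'b" assume f: "bdd_on L f" "\<And>p. p \<in> L \<Longrightarrow> nonneg (f p)"
  have "r n f \<in> {z. nonneg z}" for n using pos_fun_nonneg[OF assms(1)] f by simp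
  then have "r' f \<in> {z. nonneg z}" using closed_sequentially[OF closed_nonneg _ lim[OF f(1)]] by blast
  then show "nonneg (r' f)" by simp
qed

section \<open>Independent sequences\<close>

text \<open>The situation to be refuted in Haydon's theorem: \<open>G\<close> is meant to be the
  unit ball of \<open>E\<close> as functions on \<open>L\<close>, and \<nu>0 a probability that
  stays away from all convex combinations of points. By \<open>sep\<close>, the separating function
  may depend on the finite set \<open>A\<close>, the gap \<delta> may not.\<close>

locale separated_functional =
  fixes \<tau> :: "'p topology" and L :: "'p set" and G :: "('p \<Rightarrow> 'k::rc_field) set"
    and \<delta> :: real and \<nu>0 :: "('p \<Rightarrow> 'k) \<Rightarrow> 'k"
  assumes compactL: "compactin \<tau> L"
    and contG: "\<And>e. e \<in> G \<Longrightarrow> continuous_map (subtopology \<tau> L) euclidean e"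
    and bddG: "\<And>e p. e \<in> G \<Longrightarrow> p \<in> L \<Longrightarrow> norm (e p) \<le> 1"
    and \<nu>0: "\<nu>0 \<in> pos_fun L" and mass\<nu>0: "mass \<nu>0 = 1"
    and \<delta>: "0 < \<delta>"
    and sep: "\<And>A. finite A \<Longrightarrow> A \<subseteq> L \<Longrightarrow> \<exists>e\<in>G. \<forall>k\<in>A. re_part (e k) + \<delta> \<le> re_part (\<nu>0 e)"
begin

lemma bdd_G: "e \<in> G \<Longrightarrow> bdd_on L e"
  using bddG by (auto intro: bdd_onI)

text \<open>An element of the bidual, given by its values on positive functionals. In contrast to
  the functions in \<open>sep\<close>, which depend on a finite set, it separates \<nu>0 from all
  points at once (\<open>\<xi>_point\<close>).\<close>

definition \<xi> :: "(('p \<Rightarrow> 'k) \<Rightarrow> 'k) \<Rightarrow> 'k" where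
  "\<xi> = (SOME \<xi>. \<forall>A I e. finite A \<longrightarrow> A \<subseteq> L \<longrightarrow> finite I \<longrightarrow> I \<subseteq> pos_fun L \<longrightarrow> 0 < e \<longrightarrow>
    (\<exists>h\<in>G. (\<forall>k\<in>A. re_part (h k) + \<delta> \<le> re_part (\<nu>0 h)) \<and> (\<forall>\<nu>\<in>I. dist (\<nu> h) (\<xi> \<nu>) < e)))"

lemma \<xi>_approx:
  assumes "finite A" "A \<subseteq> L" "finite I" "I \<subseteq> pos_fun L" "0 < e"
  shows "\<exists>h\<in>G. (\<forall>k\<in>A. re_part (h k) + \<delta> \<le> re_part (\<nu>0 h)) \<and> (\<forall>\<nu>\<in>I. norm (\<nu> h - \<xi> \<nu>) < e)"
proof -
  have "\<exists>\<xi>. \<forall>A I e. finite A \<longrightarrow> A \<subseteq> L \<longrightarrow> finite I \<longrightarrow> I \<subseteq> pos_fun L \<longrightarrow> 0 < e \<longrightarrow>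
    (\<exists>h\<in>G. (\<forall>k\<in>A. re_part (h k) + \<delta> \<le> re_part (\<nu>0 h)) \<and> (\<forall>\<nu>\<in>I. dist (\<nu> h) (\<xi> \<nu>) < e))"
  proof (rule ex_cluster_point[where D = "\<lambda>\<nu>. cball 0 (mass \<nu>)" and ev = "\<lambda>\<nu> h. \<nu> h"])
    show "\<nu> h \<in> cball 0 (mass \<nu>)" if "\<nu> \<in> pos_fun L" "h \<in> G" for \<nu> h
      using norm_pos_fun_le[OF that(1), of h 1] bddG[OF that(2)] by simp
  qed (use sep compact_cball_rc_field in auto)
  from someI_ex[OF this, folded \<xi>_def] show ?thesis
    using assms unfolding dist_norm by simp
qed

lemma \<xi>_approx3:
  assumes "a \<in> pos_fun L" "b \<in> pos_fun L" "c \<in> pos_fun L" "0 < e"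
  obtains h where "h \<in> G" "norm (a h - \<xi> a) < e" "norm (b h - \<xi> b) < e" "norm (c h - \<xi> c) < e"
proof -
  have "{a, b, c} \<subseteq> pos_fun L" using assms by simp
  from \<xi>_approx[OF _ _ _ this assms(4), of "{}"] show ?thesis using that by auto
qed

text \<open>Each \<open>h\<close> acts additively on functionals; one \<open>h\<close> approximating
  \<xi> at all three functionals transfers this to \<xi>.\<close>

lemma \<xi>_diff:
  assumes a: "a \<in> pos_fun L" and b: "b \<in> pos_fun L" and c: "(\<lambda>f. a f - b f) \<in> pos_fun L"
  shows "\<xi> (\<lambda>f. a f - b f) = \<xi> a - \<xi> b"
proof (rule ccontr)
  assume "\<not> ?thesis"
  then have "0 < norm (\<xi> (\<lambda>f. a f - b f) - (\<xi> a - \<xi> b)) / 3" by simp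
  then obtain h where h: "h \<in> G" "norm (a h - \<xi> a) < norm (\<xi> (\<lambda>f. a f - b f) - (\<xi> a - \<xi> b)) / 3"
     "norm (b h - \<xi> b) < norm (\<xi> (\<lambda>f. a f - b f) - (\<xi> a - \<xi> b)) / 3"
     "norm ((a h - b h) - \<xi> (\<lambda>f. a f - b f)) < norm (\<xi> (\<lambda>f. a f - b f) - (\<xi> a - \<xi> b)) / 3"
    by (rule \<xi>_approx3[OF a b c])
  have "\<xi> (\<lambda>f. a f - b f) - (\<xi> a - \<xi> b) =
    (a h - \<xi> a) - (b h - \<xi> b) - ((a h - b h) - \<xi> (\<lambda>f. a f - b f))" by simp
  then have "norm (\<xi> (\<lambda>f. a f - b f) - (\<xi> a - \<xi> b)) =
    norm ((a h - \<xi> a) - (b h - \<xi> b) - ((a h - b h) - \<xi> (\<lambda>f. a f - b f)))" by (rule arg_cong)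
  also have "\<dots> \<le>
    norm (a h - \<xi> a) + norm (b h - \<xi> b) + norm ((a h - b h) - \<xi> (\<lambda>f. a f - b f))"
    using norm_triangle_ineq4[of "(a h - \<xi> a) - (b h - \<xi> b)" "(a h - b h) - \<xi> (\<lambda>f. a f - b f)"]
      norm_triangle_ineq4[of "a h - \<xi> a" "b h - \<xi> b"] by linarith
  finally show False using h by linarith
qed

lemma norm_\<xi>_le:
  assumes a: "a \<in> pos_fun L"
  shows "norm (\<xi> a) \<le> mass a"
proof (rule field_le_epsilon)
  fix e :: real assume "0 < e"
  then obtain h where h: "h \<in> G" "norm (a h - \<xi> a) < e" using \<xi>_approx3[OF a a a] by blast
  have "norm (a h) \<le> mass a" using norm_pos_fun_le[OF a, of h 1] bddG[OF h(1)] by simp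
  moreover have "norm (\<xi> a) \<le> norm (a h) + norm (a h - \<xi> a)"
    using norm_triangle_ineq4[of "a h" "a h - \<xi> a"] by simp
  ultimately show "norm (\<xi> a) \<le> mass a + e" using h(2) by linarith
qed

lemma \<xi>_point:
  assumes k: "k \<in> L"
  shows "re_part (\<xi> (\<lambda>f. f k)) + \<delta> \<le> re_part (\<xi> \<nu>0)"
proof (rule field_le_epsilon)
  fix e :: real assume "0 < e"
  then obtain h where h: "re_part (h k) + \<delta> \<le> re_part (\<nu>0 h)" "norm (h k - \<xi> (\<lambda>f. f k)) < e/2" "norm (\<nu>0 h - \<xi> \<nu>0) < e/2"
    using \<xi>_approx[of "{k}" "{\<lambda>f. f k, \<nu>0}" "e/2"] k \<nu>0 point_pos_fun[OF k] by auto
  have "\<bar>re_part (h k - \<xi> (\<lambda>f. f k))\<bar> < e/2" "\<bar>re_part (\<nu>0 h - \<xi> \<nu>0)\<bar> < e/2"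
    using h abs_re_part_le le_less_trans by blast+
  then show "re_part (\<xi> (\<lambda>f. f k)) + \<delta> \<le> re_part (\<xi> \<nu>0) + e" using h(1) unfolding re_part_diff by linarith
qed

section \<open>A part of \<nu>0 that stays above the threshold\<close>

text \<open>The middle of the gap: points have real value at most \<open>s - \<delta> / 2\<close> by
  \<open>\<xi>_point\<close>, while \<nu>0, of mass 1, has \<open>s + \<delta> / 2\<close>.
  Accordingly \<eta> is the excess of \<xi> over \<open>s\<close> per unit of mass, with
  \<open>\<eta> \<nu>0 = \<delta> / 2\<close>.\<close>

definition s where "s = re_part (\<xi> \<nu>0) - \<delta> / 2"

definition \<eta> where "\<eta> \<nu> = re_part (\<xi> \<nu>) - s * mass \<nu>"

definition pos1 :: "(('p \<Rightarrow> 'k) \<Rightarrow> 'k) set" where "pos1 = {\<nu> \<in> pos_fun L. 0 < mass \<nu>}"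

lemma \<eta>_diff:
  "a \<in> pos_fun L \<Longrightarrow> b \<in> pos_fun L \<Longrightarrow> dom_by L b a \<Longrightarrow> \<eta> (\<lambda>f. a f - b f) = \<eta> a - \<eta> b"
  unfolding dom_by_def \<eta>_def by (simp add: \<xi>_diff mass_diff algebra_simps)

lemma abs_\<eta>_le: "a \<in> pos_fun L \<Longrightarrow> \<bar>\<eta> a\<bar> \<le> (1 + \<bar>s\<bar>) * mass a"
  using norm_\<xi>_le[of a] abs_re_part_le[of "\<xi> a"] mass_nonneg[of a L] abs_triangle_ineq4[of "re_part (\<xi> a)" "s * mass a"]
  unfolding \<eta>_def by (simp add: abs_mult distrib_right)

text \<open>A minimiser of the mass among the functionals below \<open>\<nu>0\<close> with \<open>\<eta> \<nu> \<ge> \<delta> / 2\<close>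
  has no part on which \<open>\<eta>\<close> is negative: removing that part would decrease the mass.\<close>

lemma ex_hereditary:
  "\<exists>\<nu>1\<in>pos1. \<forall>\<nu>\<in>pos_fun L. dom_by L \<nu> \<nu>1 \<longrightarrow> 0 \<le> \<eta> \<nu>"
proof -
  define Z where "Z = {\<nu> \<in> pos_fun L. \<delta> / 2 \<le> \<eta> \<nu>}"
  have Z0: "\<nu>0 \<in> Z" using \<nu>0 mass\<nu>0 by (simp add: Z_def \<eta>_def s_def)
  define Y where "Y a = mass ` {\<nu> \<in> Z. dom_by L \<nu> a}" for a
  have bb: "bdd_below (Y a)" for a
    using mass_nonneg by (auto intro!: bdd_belowI[where m = 0] simp: Y_def Z_def)
  have nxt: "\<exists>b. b \<in> Z \<and> dom_by L b a \<and> mass b < Inf (Y a) + (1/2)^n" if "a \<in> Z" for a n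
  proof -
    have "Y a \<noteq> {}" using that dom_by_refl by (auto simp: Y_def)
    then obtain t where "t \<in> Y a" "t < Inf (Y a) + (1/2)^n"
      using cInf_lessD[of "Y a" "Inf (Y a) + (1/2)^n"] by auto
    then show ?thesis by (auto simp: Y_def)
  qed
  \<comment> \<open>Greedy descent: the next mass is within \<open>(1/2)^n\<close> of the infimum of
    the masses of members of \<open>Z\<close> below the current functional.\<close>
  have "\<exists>r. \<forall>n. r n \<in> Z \<and> (dom_by L (r (Suc n)) (r n) \<and> mass (r (Suc n)) < Inf (Y (r n)) + (1/2)^n)"
  proof (rule dependent_nat_choice)
    show "\<exists>x. x \<in> Z" using Z0 by blast
    show "\<exists>y. y \<in> Z \<and> dom_by L y x \<and> mass y < Inf (Y x) + (1/2)^n" if "x \<in> Z" for x n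
      using nxt[OF that] by blast
  qed
  then obtain r where r: "\<And>n. r n \<in> Z" "\<And>n. dom_by L (r (Suc n)) (r n)"
    "\<And>n. mass (r (Suc n)) < Inf (Y (r n)) + (1/2)^n" by blast
  have rpos: "r n \<in> pos_fun L" for n using r(1) by (simp add: Z_def)
  have dom: "dom_by L (r m) (r n)" if "n \<le> m" for n m
    using that by (induction rule: dec_induct) (auto intro: dom_by_refl dom_by_trans r(2))
  have "decseq (\<lambda>n. mass (r n))" by (rule decseq_SucI) (rule mass_mono[OF r(2)])
  then have "convergent (\<lambda>n. mass (r n))"
    by (rule decseq_convergent[where B = 0]) (auto intro: mass_nonneg[OF rpos] simp: convergent_def)
  then have Cm: "Cauchy (\<lambda>n. mass (r n))" by (rule convergent_Cauchy)
  have conv: "convergent (\<lambda>n. r n f)" if f: "bdd_on L f" for f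
  proof -
    obtain B where B: "0 \<le> B" "\<And>p. p \<in> L \<Longrightarrow> norm (f p) \<le> B"
      using f unfolding bdd_on_def by (metis abs_ge_zero abs_ge_self order_trans)
    \<comment> \<open>Domination bounds differences of values by differences of masses, so the
      monotone masses force a limit at every bounded \<open>f\<close>.\<close>
    have le: "norm (r n f - r m f) \<le> B * \<bar>mass (r n) - mass (r m)\<bar>" if "n \<le> m" for n m
      using norm_pos_fun_le[OF dom[OF that, unfolded dom_by_def] B(2)] mass_mono[OF dom[OF that]]
      by (simp add: mass_diff)
    have le': "norm (r n f - r m f) \<le> B * \<bar>mass (r n) - mass (r m)\<bar>" for n m
      using le[of n m] le[of m n] by (cases "n \<le> m") (auto simp: norm_minus_commute abs_minus_commute)
    have "Cauchy (\<lambda>n. r n f)"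
    proof (rule metric_CauchyI)
      fix t :: real assume t: "0 < t"
      then have "0 < t / (B + 1)" using B by simp
      then obtain M where M: "\<And>m n. M \<le> m \<Longrightarrow> M \<le> n \<Longrightarrow> dist (mass (r m)) (mass (r n)) < t / (B + 1)"
        using metric_CauchyD[OF Cm] by blast
      have "dist (r m f) (r n f) < t" if "M \<le> m" "M \<le> n" for m n
      proof -
        have "B * \<bar>mass (r m) - mass (r n)\<bar> \<le> (B + 1) * \<bar>mass (r m) - mass (r n)\<bar>"
          by (intro mult_right_mono) auto
        also have "\<dots> < t" using M[OF that] B by (simp add: dist_real_def field_simps)
        finally show ?thesis using le'[of m n] by (simp add: dist_norm)
      qed
      then show "\<exists>M. \<forall>m\<ge>M. \<forall>n\<ge>M. dist (r m f) (r n f) < t" by blast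
    qed
    then show ?thesis by (rule Cauchy_convergent)
  qed
  define r' where "r' f = lim (\<lambda>n. r n f)" for f
  have lim: "(\<lambda>n. r n f) \<longlonglongrightarrow> r' f" if "bdd_on L f" for f
    using conv[OF that] by (simp add: r'_def convergent_LIMSEQ_iff)
  have r'pos: "r' \<in> pos_fun L" by (rule pos_fun_limit[OF rpos lim])
  have r'dom: "dom_by L r' (r n)" for n unfolding dom_by_def
  proof (rule pos_fun_limit)
    show "(\<lambda>f. r n f - r (m + n) f) \<in> pos_fun L" for m using dom[of n "m + n"] by (simp add: dom_by_def)
    show "(\<lambda>m. r n f - r (m + n) f) \<longlonglongrightarrow> r n f - r' f" if "bdd_on L f" for f
      by (intro tendsto_intros LIMSEQ_ignore_initial_segment lim that)
  qed
  have mlim: "(\<lambda>n. mass (r n)) \<longlonglongrightarrow> mass r'"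
    unfolding mass_def by (intro bounded_linear.tendsto[OF bounded_linear_re_part] lim) simp
  have "\<delta> / 2 \<le> \<eta> r'"
  proof -
    have "\<delta> / 2 - (1 + \<bar>s\<bar>) * (mass (r n) - mass r') \<le> \<eta> r'" for n
    proof -
      have "\<bar>\<eta> (r n) - \<eta> r'\<bar> \<le> (1 + \<bar>s\<bar>) * (mass (r n) - mass r')"
        using abs_\<eta>_le[OF r'dom[of n, unfolded dom_by_def]] \<eta>_diff[OF rpos r'pos r'dom, of n]
        by (simp add: mass_diff)
      moreover have "\<delta> / 2 \<le> \<eta> (r n)" using r(1)[of n] by (simp add: Z_def)
      ultimately show ?thesis by linarith
    qed
    moreover have "(\<lambda>n. \<delta> / 2 - (1 + \<bar>s\<bar>) * (mass (r n) - mass r')) \<longlonglongrightarrow>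
        \<delta> / 2 - (1 + \<bar>s\<bar>) * (mass r' - mass r')"
      by (intro tendsto_intros mlim)
    ultimately have "\<delta> / 2 - (1 + \<bar>s\<bar>) * (mass r' - mass r') \<le> \<eta> r'"
      by (intro LIMSEQ_le_const2) auto
    then show ?thesis by simp
  qed
  have "0 \<le> \<eta> d" if d: "d \<in> pos_fun L" "dom_by L d r'" for d
  proof (rule ccontr)
    assume neg: "\<not> 0 \<le> \<eta> d"
    \<comment> \<open>Removing \<open>d\<close> raises \<eta>, so the rest \<open>c\<close> competes
      in \<open>Z\<close>. Near-minimality along the sequence then leaves \<open>d\<close> no mass,
      which makes \<open>\<eta> d\<close> vanish.\<close>
    define c where "c = (\<lambda>f. r' f - d f)"
    have c: "c \<in> pos_fun L" using d(2) by (simp add: c_def dom_by_def)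
    have "dom_by L c r'" unfolding dom_by_def c_def using d(1) by simp
    then have cdom: "dom_by L c (r n)" for n using r'dom dom_by_trans by blast
    have "\<eta> c = \<eta> r' - \<eta> d" unfolding c_def using d r'pos by (rule_tac \<eta>_diff)
    then have "c \<in> Z" using c neg \<open>\<delta> / 2 \<le> \<eta> r'\<close> by (simp add: Z_def)
    then have "mass c \<in> Y (r n)" for n using cdom by (auto simp: Y_def)
    then have "Inf (Y (r n)) \<le> mass c" for n using bb by (intro cInf_lower)
    then have le: "mass (r (Suc n)) \<le> mass c + (1/2)^n" for n
      using r(3)[of n] by (meson add_right_mono less_imp_le order_trans)
    have "(\<lambda>n. mass c + (1/2)^n) \<longlonglongrightarrow> mass c + 0"
      by (intro tendsto_intros LIMSEQ_realpow_zero) auto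
    then have "mass r' \<le> mass c" using LIMSEQ_le[OF LIMSEQ_Suc[OF mlim]] le by auto
    then have "mass d \<le> 0" by (simp add: c_def mass_diff)
    then have "\<bar>\<eta> d\<bar> \<le> 0"
      using order_trans[OF abs_\<eta>_le[OF d(1)] mult_nonneg_nonpos[of "1 + \<bar>s\<bar>" "mass d"]] by simp
    then show False using neg by simp
  qed
  moreover have "0 < mass r'"
  proof (rule ccontr)
    assume "\<not> 0 < mass r'"
    then have "mass r' = 0" using mass_nonneg[OF r'pos] by simp
    then show False using abs_\<eta>_le[OF r'pos] \<open>\<delta> / 2 \<le> \<eta> r'\<close> \<delta> by simp
  qed
  ultimately show ?thesis using r'pos by (auto simp: pos1_def)
qed

section \<open>Supports and the two colours\<close>

text \<open>If \<open>z\<close> fails at some part \<nu>' of \<nu>1, it fails at every part of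
  \<nu>', because goodness passes to larger functionals. Below \<nu>' one colour less is left, and
  induction on \<open>Z\<close> applies.\<close>

lemma pigeonhole:
  assumes "finite Z" "\<nu>1 \<in> pos1"
    and "\<And>z \<nu> \<nu>'. good z \<nu>' \<Longrightarrow> \<nu> \<in> pos1 \<Longrightarrow> \<nu>' \<in> pos1 \<Longrightarrow> dom_by L \<nu>' \<nu> \<Longrightarrow> good z \<nu>"
    and "\<And>\<nu>. \<nu> \<in> pos1 \<Longrightarrow> dom_by L \<nu> \<nu>1 \<Longrightarrow> \<exists>z\<in>Z. good z \<nu>"
  shows "\<exists>z\<in>Z. \<exists>\<nu>2\<in>pos1. dom_by L \<nu>2 \<nu>1 \<and> (\<forall>\<nu>\<in>pos1. dom_by L \<nu> \<nu>2 \<longrightarrow> good z \<nu>)"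
  using assms(1,2,4)
proof (induction Z arbitrary: \<nu>1 rule: finite_induct)
  case empty
  then show ?case using dom_by_refl by blast
next
  case (insert z Z)
  show ?case
  proof (cases "\<forall>\<nu>\<in>pos1. dom_by L \<nu> \<nu>1 \<longrightarrow> good z \<nu>")
    case True
    then show ?thesis using insert.prems(1) dom_by_refl by blast
  next
    case False
    then obtain \<nu>' where \<nu>': "\<nu>' \<in> pos1" "dom_by L \<nu>' \<nu>1" "\<not> good z \<nu>'" by blast
    have "\<exists>z\<in>Z. good z \<nu>" if "\<nu> \<in> pos1" "dom_by L \<nu> \<nu>'" for \<nu>
      using insert.prems(2)[OF that(1) dom_by_trans[OF that(2) \<nu>'(2)]] assms(3)[OF _ \<nu>'(1) that] \<nu>'(3) by blast
    from insert.IH[OF \<nu>'(1) this] show ?thesis using \<nu>'(2) dom_by_trans by blast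
  qed
qed

text \<open>A support that tests only neighbourhoods cut out by a single function of
  \<open>G\<close>: a tree step works with one function \<open>e\<close> and the neighbourhood where
  \<open>e\<close> is close to \<open>e k\<close>.\<close>

definition supp :: "(('p \<Rightarrow> 'k) \<Rightarrow> 'k) \<Rightarrow> 'p set" where
  "supp \<nu> = {k \<in> L. \<forall>e\<in>G. \<forall>r>0. 0 < mass (restr {p. norm (e p - e k) < r} \<nu>)}"

lemma supp_mono: "dom_by L \<nu>' \<nu> \<Longrightarrow> supp \<nu>' \<subseteq> supp \<nu>"
  unfolding supp_def using mass_restr_mono less_le_trans by blast

text \<open>Otherwise every point has a null neighbourhood, open by \<open>contG\<close>, and
  compactness covers \<open>L\<close> by finitely many of them, against the positive mass.\<close>

lemma supp_nonempty:
  assumes \<nu>: "\<nu> \<in> pos1"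
  shows "supp \<nu> \<noteq> {}"
proof
  assume "supp \<nu> = {}"
  then have "\<forall>k\<in>L. \<exists>e r. e \<in> G \<and> 0 < r \<and> \<not> 0 < mass (restr {p. norm (e p - e k) < r} \<nu>)"
    unfolding supp_def by blast
  then obtain e r where er: "\<And>k. k \<in> L \<Longrightarrow> e k \<in> G \<and> 0 < r k \<and> \<not> 0 < mass (restr {p. norm (e k p - e k k) < r k} \<nu>)"
    by metis
  define U where "U k = {p \<in> L. norm (e k p - e k k) < r k}" for k
  have Lsub: "L \<subseteq> topspace \<tau>" using compactL by (rule compactin_subset_topspace)
  have opn: "openin (subtopology \<tau> L) (U k)" if "k \<in> L" for k
  proof -
    have "openin (subtopology \<tau> L) {p \<in> topspace (subtopology \<tau> L). e k p \<in> ball (e k k) (r k)}"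
      by (rule openin_continuous_map_preimage[OF contG]) (use er[OF that] in auto)
    moreover have "{p \<in> topspace (subtopology \<tau> L). e k p \<in> ball (e k k) (r k)} = U k"
      using Lsub by (auto simp: U_def dist_norm norm_minus_commute)
    ultimately show ?thesis by simp
  qed
  have "compact_space (subtopology \<tau> L)" using compactL by (simp add: compact_space_subtopology)
  moreover have "L \<subseteq> \<Union>(U ` L)" using er by (force simp: U_def)
  ultimately obtain \<F> where \<F>: "finite \<F>" "\<F> \<subseteq> U ` L" "L \<subseteq> \<Union>\<F>"
    using compact_space_alt[of "subtopology \<tau> L"] opn Lsub
    by (metis (no_types, lifting) imageE inf.absorb_iff2 topspace_subtopology)
  then obtain K where K: "finite K" "K \<subseteq> L" "\<F> = U ` K" by (meson finite_subset_image)
  have pos: "\<nu> \<in> pos_fun L" using \<nu> by (simp add: pos1_def)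
  have "mass \<nu> \<le> (\<Sum>k\<in>K. mass (restr (U k) \<nu>))"
    by (rule mass_restr_Union[OF pos K(1)]) (use \<F>(3) K(3) in simp)
  also have "\<dots> \<le> 0"
  proof (rule sum_nonpos)
    fix k assume "k \<in> K"
    then have "\<not> 0 < mass (restr {p. norm (e k p - e k k) < r k} \<nu>)" using er K by blast
    moreover have "mass (restr (U k) \<nu>) \<le> mass (restr {p. norm (e k p - e k k) < r k} \<nu>)"
      by (rule mass_restr_mono_set[OF pos]) (simp add: U_def)
    ultimately show "mass (restr (U k) \<nu>) \<le> 0" by simp
  qed
  finally show False using \<nu> by (simp add: pos1_def)
qed

text \<open>Chosen so that the distance \<delta>/4 of the two colours equals 64 \<epsilon>, well
  beyond the errors of size 4 \<epsilon> in the tree.\<close>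

definition \<epsilon> where "\<epsilon> = \<delta> / 256"

lemma \<epsilon>_pos: "0 < \<epsilon>"
  using \<delta> by (simp add: \<epsilon>_def)

lemma ex_net: "\<exists>Z. finite Z \<and> (\<forall>x :: 'k. norm x \<le> 1 \<longrightarrow> (\<exists>z\<in>Z. norm (x - z) < \<epsilon>))"
proof -
  obtain Z where "finite Z" "cball (0 :: 'k) 1 \<subseteq> (\<Union>z\<in>Z. ball z \<epsilon>)"
    using compact_eq_totally_bounded[THEN iffD1, OF compact_cball_rc_field[of 1]] \<epsilon>_pos by blast
  moreover have "\<exists>z\<in>Z. norm (x - z) < \<epsilon>" if x: "norm x \<le> 1" for x
  proof -
    have "x \<in> cball 0 1" using x by simp
    then obtain z where "z \<in> Z" "x \<in> ball z \<epsilon>" using calculation(2) by blast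
    then show ?thesis by (auto simp: dist_norm norm_minus_commute)
  qed
  ultimately show ?thesis by blast
qed

text \<open>Rounding to a finite net turns the values of \<xi> into colours, and
  \<open>pigeonhole\<close> is applied twice: to averages, giving \<open>w\<close>, and then to
  support points, giving \<open>z\<close>. Below \<nu>1 the excess \<eta> is nonnegative, so the
  real part of \<open>w\<close> is at least s - \<epsilon>; points stay below the threshold, so that
  of \<open>z\<close> is at most s - \<delta>/2 + \<epsilon>.\<close>

lemma ex_colours:
  "\<exists>\<nu>3\<in>pos1. \<exists>w z. \<delta> / 4 \<le> norm (w - z) \<and> (\<forall>\<nu>\<in>pos1. dom_by L \<nu> \<nu>3 \<longrightarrow>
     (\<exists>\<nu>'\<in>pos1. dom_by L \<nu>' \<nu> \<and> norm (\<xi> \<nu>' - w * of_real (mass \<nu>')) \<le> \<epsilon> * mass \<nu>') \<and>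
     (\<exists>k\<in>supp \<nu>. norm (\<xi> (\<lambda>f. f k) - z) \<le> \<epsilon>))"
proof -
  obtain Z where Z: "finite Z" "\<And>x :: 'k. norm x \<le> 1 \<Longrightarrow> \<exists>z\<in>Z. norm (x - z) < \<epsilon>" using ex_net by blast
  obtain \<nu>1 where \<nu>1: "\<nu>1 \<in> pos1" "\<And>\<nu>. \<nu> \<in> pos_fun L \<Longrightarrow> dom_by L \<nu> \<nu>1 \<Longrightarrow> 0 \<le> \<eta> \<nu>"
    using ex_hereditary by blast
  \<comment> \<open>\<open>pigeonhole\<close> requires goodness to pass to larger functionals. This
    is why \<open>good1\<close> speaks of some part \<nu>' and not of \<nu> itself; for
    \<open>good2\<close> it is the monotonicity of the support.\<close>
  define good1 where "good1 w \<nu> \<longleftrightarrow>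
    (\<exists>\<nu>'\<in>pos1. dom_by L \<nu>' \<nu> \<and> norm (\<xi> \<nu>' - w * of_real (mass \<nu>')) \<le> \<epsilon> * mass \<nu>')" for w \<nu>
  define good2 where "good2 z \<nu> \<longleftrightarrow> (\<exists>k\<in>supp \<nu>. norm (\<xi> (\<lambda>f. f k) - z) \<le> \<epsilon>)" for z \<nu>
  have "\<exists>w\<in>Z. \<exists>\<nu>2\<in>pos1. dom_by L \<nu>2 \<nu>1 \<and> (\<forall>\<nu>\<in>pos1. dom_by L \<nu> \<nu>2 \<longrightarrow> good1 w \<nu>)"
  proof (rule pigeonhole[OF Z(1) \<nu>1(1)])
    show "good1 z \<nu>" if "good1 z \<nu>'" "\<nu> \<in> pos1" "\<nu>' \<in> pos1" "dom_by L \<nu>' \<nu>" for z \<nu> \<nu>'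
      using that dom_by_trans unfolding good1_def by blast
    show "\<exists>z\<in>Z. good1 z \<nu>" if \<nu>: "\<nu> \<in> pos1" for \<nu>
    proof -
      have m: "0 < mass \<nu>" "\<nu> \<in> pos_fun L" using \<nu> by (auto simp: pos1_def)
      have "norm (\<xi> \<nu> / of_real (mass \<nu>)) \<le> 1"
        using norm_\<xi>_le[OF m(2)] m(1) by (simp add: norm_divide)
      then obtain z where z: "z \<in> Z" "norm (\<xi> \<nu> / of_real (mass \<nu>) - z) < \<epsilon>" using Z(2) by blast
      have "norm (\<xi> \<nu> - z * of_real (mass \<nu>)) = norm (\<xi> \<nu> / of_real (mass \<nu>) - z) * mass \<nu>"
      proof -
        have "\<xi> \<nu> - z * of_real (mass \<nu>) = (\<xi> \<nu> / of_real (mass \<nu>) - z) * of_real (mass \<nu>)"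
          using m(1) by (simp add: left_diff_distrib)
        then show ?thesis using m(1) by (simp add: norm_mult)
      qed
      also have "\<dots> \<le> \<epsilon> * mass \<nu>" using z(2) m(1) by (intro mult_right_mono) auto
      finally show ?thesis using z(1) \<nu> dom_by_refl unfolding good1_def by blast
    qed
  qed
  then obtain w \<nu>2 where w: "\<nu>2 \<in> pos1" "dom_by L \<nu>2 \<nu>1" "\<And>\<nu>. \<nu> \<in> pos1 \<Longrightarrow> dom_by L \<nu> \<nu>2 \<Longrightarrow> good1 w \<nu>"
    by blast
  have "\<exists>z\<in>Z. \<exists>\<nu>3\<in>pos1. dom_by L \<nu>3 \<nu>2 \<and> (\<forall>\<nu>\<in>pos1. dom_by L \<nu> \<nu>3 \<longrightarrow> good2 z \<nu>)"
  proof (rule pigeonhole[OF Z(1) w(1)])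
    show "good2 z \<nu>" if "good2 z \<nu>'" "\<nu> \<in> pos1" "\<nu>' \<in> pos1" "dom_by L \<nu>' \<nu>" for z \<nu> \<nu>'
      using that supp_mono unfolding good2_def by blast
    show "\<exists>z\<in>Z. good2 z \<nu>" if \<nu>: "\<nu> \<in> pos1" for \<nu>
    proof -
      obtain k where k: "k \<in> supp \<nu>" using supp_nonempty[OF \<nu>] by blast
      then have "k \<in> L" by (simp add: supp_def)
      then have "norm (\<xi> (\<lambda>f. f k)) \<le> 1" using norm_\<xi>_le[OF point_pos_fun] by (simp add: mass_def)
      then show ?thesis using Z(2) k unfolding good2_def by (meson less_imp_le)
    qed
  qed
  then obtain z \<nu>3 where z: "\<nu>3 \<in> pos1" "dom_by L \<nu>3 \<nu>2" "\<And>\<nu>. \<nu> \<in> pos1 \<Longrightarrow> dom_by L \<nu> \<nu>3 \<Longrightarrow> good2 z \<nu>"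
    by blast
  have "\<delta> / 4 \<le> norm (w - z)"
  proof -
    obtain \<nu>' where \<nu>': "\<nu>' \<in> pos1" "dom_by L \<nu>' \<nu>2" "norm (\<xi> \<nu>' - w * of_real (mass \<nu>')) \<le> \<epsilon> * mass \<nu>'"
      using w(3)[OF w(1) dom_by_refl] unfolding good1_def by blast
    have m: "0 < mass \<nu>'" using \<nu>' by (simp add: pos1_def)
    have "0 \<le> \<eta> \<nu>'" using \<nu>1(2) \<nu>'(1,2) w(2) dom_by_trans unfolding pos1_def by blast
    moreover have "re_part (\<xi> \<nu>' - w * of_real (mass \<nu>')) \<le> \<epsilon> * mass \<nu>'" using \<nu>'(3) re_part_le_norm order_trans by blast
    moreover have "re_part (w * of_real (mass \<nu>')) = mass \<nu>' * re_part w" by (metis mult.commute re_part_of_real_mult)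
    ultimately have "s * mass \<nu>' \<le> (re_part w + \<epsilon>) * mass \<nu>'"
      by (simp add: \<eta>_def algebra_simps)
    then have 1: "s \<le> re_part w + \<epsilon>" using m by simp
    obtain k where k: "k \<in> supp \<nu>3" "norm (\<xi> (\<lambda>f. f k) - z) \<le> \<epsilon>"
      using z(3)[OF z(1) dom_by_refl] unfolding good2_def by blast
    have "re_part (z - \<xi> (\<lambda>f. f k)) \<le> \<epsilon>" using k(2) re_part_le_norm order_trans norm_minus_commute by metis
    moreover have "re_part (\<xi> (\<lambda>f. f k)) + \<delta> \<le> re_part (\<xi> \<nu>0)" using k by (intro \<xi>_point) (simp add: supp_def)
    ultimately have "\<delta> / 4 \<le> re_part (w - z)" using 1 \<delta> by (simp add: s_def \<epsilon>_def)
    then show ?thesis using re_part_le_norm order_trans by blast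
  qed
  then show ?thesis using z w(3) dom_by_trans[OF _ z(2)] unfolding good1_def good2_def by blast
qed


section \<open>The tree and its patterns\<close>

text \<open>The probabilities with bounded density with respect to \<nu>. They include the
  normalised \<nu> and are stable under mixing over parts of \<nu>, and they charge only sets
  charged by \<nu>.\<close>

definition prob_below :: "(('p \<Rightarrow> 'k) \<Rightarrow> 'k) \<Rightarrow> (('p \<Rightarrow> 'k) \<Rightarrow> 'k) set" where
  "prob_below \<nu> = {\<phi> \<in> pos_fun L. mass \<phi> = 1 \<and> (\<exists>C\<ge>0. dom_by L \<phi> (\<lambda>f. of_real C * \<nu> f))}"

lemma prob_below_nonempty:
  assumes "\<nu> \<in> pos1"
  shows "(\<lambda>f. of_real (1 / mass \<nu>) * \<nu> f) \<in> prob_below \<nu>"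
proof -
  have "(\<lambda>f. of_real (1 / mass \<nu>) * \<nu> f) \<in> pos_fun L"
    using assms by (intro scale_pos_fun) (auto simp: pos1_def)
  moreover have "mass (\<lambda>f. of_real (1 / mass \<nu>) * \<nu> f) = 1"
    unfolding mass_def re_part_of_real_mult using assms by (simp add: pos1_def mass_def)
  ultimately show ?thesis
    using assms dom_by_refl unfolding prob_below_def pos1_def
    by (auto intro!: exI[of _ "1 / mass \<nu>"])
qed

lemma prob_below_convex:
  assumes fin: "finite I" and c: "\<And>i. i \<in> I \<Longrightarrow> 0 \<le> c i" "sum c I = 1"
    and dom: "\<And>i. i \<in> I \<Longrightarrow> dom_by L (a i) \<nu>" and \<phi>: "\<And>i. i \<in> I \<Longrightarrow> \<phi> i \<in> prob_below (a i)"
  shows "(\<lambda>f. \<Sum>i\<in>I. of_real (c i) * \<phi> i f) \<in> prob_below \<nu>"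
proof -
  have "\<forall>i\<in>I. \<exists>C\<ge>0. dom_by L (\<phi> i) (\<lambda>f. of_real C * a i f)" using \<phi> by (auto simp: prob_below_def)
  then obtain C where C: "\<And>i. i \<in> I \<Longrightarrow> 0 \<le> C i" "\<And>i. i \<in> I \<Longrightarrow> dom_by L (\<phi> i) (\<lambda>f. of_real (C i) * a i f)"
    by metis
  have 1: "(\<lambda>f. of_real (C i) * \<nu> f - \<phi> i f) \<in> pos_fun L" if i: "i \<in> I" for i
  proof -
    have "(\<lambda>f. of_real (C i) * (\<nu> f - a i f)) \<in> pos_fun L"
      using dom[OF i] C(1)[OF i] unfolding dom_by_def by (rule scale_pos_fun)
    from plus_pos_fun[OF this C(2)[OF i, unfolded dom_by_def]] show ?thesis
      by (simp add: right_diff_distrib)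
  qed
  have "(\<lambda>f. \<Sum>i\<in>I. of_real (c i) * (of_real (C i) * \<nu> f - \<phi> i f)) \<in> pos_fun L"
    by (intro sum_pos_fun scale_pos_fun 1 c)
  moreover have "(\<Sum>i\<in>I. of_real (c i) * (of_real (C i) * \<nu> f - \<phi> i f)) =
      of_real (\<Sum>i\<in>I. c i * C i) * \<nu> f - (\<Sum>i\<in>I. of_real (c i) * \<phi> i f)" for f
    by (simp add: right_diff_distrib sum_subtractf sum_distrib_right mult.assoc)
  ultimately have "dom_by L (\<lambda>f. \<Sum>i\<in>I. of_real (c i) * \<phi> i f) (\<lambda>f. of_real (\<Sum>i\<in>I. c i * C i) * \<nu> f)"
    unfolding dom_by_def by simp
  moreover have "0 \<le> (\<Sum>i\<in>I. c i * C i)" using C c by (intro sum_nonneg) auto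
  moreover have "(\<lambda>f. \<Sum>i\<in>I. of_real (c i) * \<phi> i f) \<in> pos_fun L"
    using \<phi> by (intro sum_pos_fun scale_pos_fun c) (auto simp: prob_below_def)
  moreover have "mass (\<lambda>f. \<Sum>i\<in>I. of_real (c i) * \<phi> i f) = 1"
  proof -
    have "mass (\<lambda>f. \<Sum>i\<in>I. of_real (c i) * \<phi> i f) = (\<Sum>i\<in>I. c i * mass (\<phi> i))"
      unfolding mass_def re_part_sum re_part_of_real_mult ..
    also have "\<dots> = sum c I" using \<phi> by (intro sum.cong) (auto simp: prob_below_def)
    finally show ?thesis using c by simp
  qed
  ultimately show ?thesis unfolding prob_below_def by blast
qed

text \<open>Domination by a multiple of \<open>restr V \<nu>\<close> leaves no mass off
  \<open>V\<close>, so a later choice of functional cannot spoil a value secured on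
  \<open>V\<close>.\<close>

lemma prob_below_approx:
  assumes \<phi>: "\<phi> \<in> prob_below (restr V \<nu>)" and \<nu>: "\<nu> \<in> pos_fun L" and f: "bdd_on L f"
    and near: "\<And>p. p \<in> L \<Longrightarrow> p \<in> V \<Longrightarrow> norm (f p - c) \<le> r"
  shows "norm (\<phi> f - c) \<le> r"
proof -
  obtain C where C: "0 \<le> C" "dom_by L \<phi> (\<lambda>f. of_real C * restr V \<nu> f)" and p: "\<phi> \<in> pos_fun L" "mass \<phi> = 1"
    using \<phi> by (auto simp: prob_below_def)
  have "restr (- V) (\<lambda>f. of_real C * restr V \<nu> f) (\<lambda>_. 1) = of_real C * \<nu> (\<lambda>p. 0)"
    by (auto simp: restr_def intro!: arg_cong[where f = \<nu>])
  also have "\<dots> = 0" by (simp add: pos_fun_const[OF \<nu>])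
  finally have "mass (restr (- V) (\<lambda>f. of_real C * restr V \<nu> f)) = 0" by (simp add: mass_def)
  then have "mass (restr (- V) \<phi>) = 0"
    using mass_restr_mono[OF C(2), of "- V"] mass_nonneg[OF restr_pos_fun[OF p(1)], of "- V"] by simp
  from concentrated_approx[OF p(1) this f near] show ?thesis using p(2) by simp
qed

text \<open>On each member of \<open>W'\<close> the function \<open>e\<close> is nearly constant. Therefore the inequality holds for
  all choices of functionals below the members used, and it is not destroyed by the later steps.\<close>

definition tree_step ::
  "(('p \<Rightarrow> 'k) \<Rightarrow> 'k) set \<Rightarrow> (bool \<Rightarrow> 'k) \<Rightarrow> ('p \<Rightarrow> 'k) \<Rightarrow>
    (('p \<Rightarrow> 'k) \<Rightarrow> 'k) set \<Rightarrow> bool" where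
  "tree_step W v e W' \<longleftrightarrow> (\<forall>\<nu>\<in>W. \<forall>b. \<exists>(I :: 'k set) a c. finite I \<and>
     (\<forall>i\<in>I. a i \<in> W' \<and> dom_by L (a i) \<nu> \<and> 0 \<le> c i) \<and> sum c I = 1 \<and>
     (\<forall>\<phi>. (\<forall>i\<in>I. \<phi> i \<in> prob_below (a i)) \<longrightarrow>
        norm ((\<Sum>i\<in>I. of_real (c i) * \<phi> i e) - v b) \<le> 4 * \<epsilon>))"

text \<open>One \<open>e\<close> copies \<xi> on a part \<open>a \<nu>\<close> and at a support
  point \<open>k \<nu>\<close> for every \<nu> in \<open>W\<close>. Colour \<open>z\<close> is
  realised near \<open>k \<nu>\<close>, where \<open>e\<close> varies by less than \<epsilon>.
  Colour \<open>w\<close> is realised only on average, by mixing cells of \<open>a \<nu>\<close> in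
  proportion to their masses: 2 \<epsilon> are lost in the cells, \<epsilon> in copying \<xi> and
  \<epsilon> in the colour.\<close>

lemma ex_tree_step:
  assumes Wfin: "finite W" and W: "\<And>\<nu>. \<nu> \<in> W \<Longrightarrow> \<nu> \<in> pos1 \<and> dom_by L \<nu> \<nu>3"
    and col: "\<And>\<nu>. \<nu> \<in> pos1 \<Longrightarrow> dom_by L \<nu> \<nu>3 \<Longrightarrow>
     (\<exists>\<nu>'\<in>pos1. dom_by L \<nu>' \<nu> \<and> norm (\<xi> \<nu>' - w * of_real (mass \<nu>')) \<le> \<epsilon> * mass \<nu>') \<and>
     (\<exists>k\<in>supp \<nu>. norm (\<xi> (\<lambda>f. f k) - z) \<le> \<epsilon>)"
  shows "\<exists>e\<in>G. \<exists>W'. finite W' \<and> (\<forall>\<nu>\<in>W'. \<nu> \<in> pos1 \<and> dom_by L \<nu> \<nu>3) \<and>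
    tree_step W (\<lambda>b. if b then w else z) e W'"
proof -
  have "\<forall>\<nu>\<in>W. \<exists>\<nu>'. \<nu>' \<in> pos1 \<and> dom_by L \<nu>' \<nu> \<and> norm (\<xi> \<nu>' - w * of_real (mass \<nu>')) \<le> \<epsilon> * mass \<nu>'"
    using col W by blast
  then obtain a where a: "\<And>\<nu>. \<nu> \<in> W \<Longrightarrow> a \<nu> \<in> pos1" "\<And>\<nu>. \<nu> \<in> W \<Longrightarrow> dom_by L (a \<nu>) \<nu>"
    "\<And>\<nu>. \<nu> \<in> W \<Longrightarrow> norm (\<xi> (a \<nu>) - w * of_real (mass (a \<nu>))) \<le> \<epsilon> * mass (a \<nu>)" by metis
  have "\<forall>\<nu>\<in>W. \<exists>k. k \<in> supp \<nu> \<and> norm (\<xi> (\<lambda>f. f k) - z) \<le> \<epsilon>" using col W by blast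
  then obtain k where k: "\<And>\<nu>. \<nu> \<in> W \<Longrightarrow> k \<nu> \<in> supp \<nu>"
    "\<And>\<nu>. \<nu> \<in> W \<Longrightarrow> norm (\<xi> (\<lambda>f. f (k \<nu>)) - z) \<le> \<epsilon>" by metis
  have kL: "k \<nu> \<in> L" if "\<nu> \<in> W" for \<nu> using k(1)[OF that] by (simp add: supp_def)
  have apos: "a \<nu> \<in> pos_fun L" "0 < mass (a \<nu>)" if "\<nu> \<in> W" for \<nu> using a(1)[OF that] by (auto simp: pos1_def)
  \<comment> \<open>Errors at \<open>a \<nu>\<close> are later divided by
    \<open>mass (a \<nu>)\<close>, so the accuracy is \<epsilon> times the least of these masses;
    the inserted 1 serves the point evaluations.\<close>
  define t where "t = \<epsilon> * Min (insert 1 ((\<lambda>\<nu>. mass (a \<nu>)) ` W))"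
  have t0: "0 < t" unfolding t_def using \<epsilon>_pos Wfin apos by (auto intro!: mult_pos_pos)
  have t1: "t \<le> \<epsilon>"
  proof -
    have "Min (insert 1 ((\<lambda>\<nu>. mass (a \<nu>)) ` W)) \<le> 1" using Wfin by (intro Min_le) auto
    then show ?thesis using \<epsilon>_pos by (simp add: t_def)
  qed
  have t2: "t \<le> \<epsilon> * mass (a \<nu>)" if "\<nu> \<in> W" for \<nu>
  proof -
    have "Min (insert 1 ((\<lambda>\<nu>. mass (a \<nu>)) ` W)) \<le> mass (a \<nu>)" using Wfin that by (intro Min_le) auto
    then show ?thesis using \<epsilon>_pos by (simp add: t_def)
  qed
  have "\<exists>h\<in>G. (\<forall>x\<in>{}. re_part (h x) + \<delta> \<le> re_part (\<nu>0 h)) \<and>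
      (\<forall>\<nu>\<in>a ` W \<union> (\<lambda>\<nu> f. f (k \<nu>)) ` W. norm (\<nu> h - \<xi> \<nu>) < t)"
    by (rule \<xi>_approx) (use Wfin apos point_pos_fun[OF kL] t0 in auto)
  then obtain e where eG: "e \<in> G"
    and e_near: "\<forall>\<nu>\<in>a ` W \<union> (\<lambda>\<nu> f. f (k \<nu>)) ` W. norm (\<nu> e - \<xi> \<nu>) < t" by blast
  have e: "e \<in> G" "\<And>\<nu>. \<nu> \<in> W \<Longrightarrow> norm (a \<nu> e - \<xi> (a \<nu>)) < t"
    "\<And>\<nu>. \<nu> \<in> W \<Longrightarrow> norm (e (k \<nu>) - \<xi> (\<lambda>f. f (k \<nu>))) < t"
    using eG bspec[OF e_near] by blast+
  have be: "bdd_on L e" using bdd_G[OF e(1)] .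
  obtain Z where Z: "finite Z" "\<forall>x :: 'k. norm x \<le> 1 \<longrightarrow> (\<exists>z\<in>Z. norm (x - z) < \<epsilon>)" using ex_net by blast
  then obtain q where q: "\<And>x :: 'k. norm x \<le> 1 \<Longrightarrow> q x \<in> Z \<and> norm (x - q x) < \<epsilon>" by metis
  \<comment> \<open>Level sets of the rounded values of \<open>e\<close>: on the cell of
    \<open>c\<close>, the function stays within \<epsilon> of \<open>c\<close>.\<close>
  define cell where "cell c = {p. q (e p) = c}" for c
  define V where "V \<nu> = {p. norm (e p - e (k \<nu>)) < \<epsilon>}" for \<nu>
  define W' where "W' = (\<lambda>\<nu>. restr (V \<nu>) \<nu>) ` W \<union>
    {\<mu> \<in> (\<lambda>(\<nu>, c). restr (cell c) (a \<nu>)) ` (W \<times> Z). \<mu> \<in> pos1}"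
  have Wpos: "\<nu> \<in> pos_fun L" if "\<nu> \<in> W" for \<nu> using W[OF that] by (simp add: pos1_def)
  have V: "restr (V \<nu>) \<nu> \<in> pos1" if "\<nu> \<in> W" for \<nu>
    using k(1)[OF that] e(1) \<epsilon>_pos restr_pos_fun[OF Wpos[OF that]]
    unfolding pos1_def supp_def V_def by blast
  have "tree_step W (\<lambda>b. if b then w else z) e W'"
    unfolding tree_step_def
  proof (intro ballI allI)
    fix \<nu> b assume \<nu>: "\<nu> \<in> W"
    show "\<exists>(I :: 'k set) a c. finite I \<and>
     (\<forall>i\<in>I. a i \<in> W' \<and> dom_by L (a i) \<nu> \<and> 0 \<le> c i) \<and> sum c I = 1 \<and>
     (\<forall>\<phi>. (\<forall>i\<in>I. \<phi> i \<in> prob_below (a i)) \<longrightarrow>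
        norm ((\<Sum>i\<in>I. of_real (c i) * \<phi> i e) - (if b then w else z)) \<le> 4 * \<epsilon>)"
    proof (cases b)
      case False
      have "norm (\<phi> e - z) \<le> 4 * \<epsilon>" if "\<phi> \<in> prob_below (restr (V \<nu>) \<nu>)" for \<phi>
      proof -
        have "norm (\<phi> e - e (k \<nu>)) \<le> \<epsilon>"
          by (rule prob_below_approx[OF that Wpos[OF \<nu>] be]) (simp add: V_def)
        moreover have "norm (e (k \<nu>) - \<xi> (\<lambda>f. f (k \<nu>))) \<le> \<epsilon>" using e(3)[OF \<nu>] t1 by simp
        moreover note k(2)[OF \<nu>]
        moreover have "norm (\<phi> e - z) \<le> norm (\<phi> e - e (k \<nu>)) + norm (e (k \<nu>) - \<xi> (\<lambda>f. f (k \<nu>))) +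
            norm (\<xi> (\<lambda>f. f (k \<nu>)) - z)"
          using norm_triangle_ineq[of "\<phi> e - e (k \<nu>)" "e (k \<nu>) - \<xi> (\<lambda>f. f (k \<nu>))"]
            norm_triangle_ineq[of "\<phi> e - \<xi> (\<lambda>f. f (k \<nu>))" "\<xi> (\<lambda>f. f (k \<nu>)) - z"] by simp
        ultimately show ?thesis using \<epsilon>_pos by linarith
      qed
      then show ?thesis using False \<nu> dom_by_restr[OF Wpos[OF \<nu>]]
        by (intro exI[of _ "{0}"] exI[of _ "\<lambda>_. restr (V \<nu>) \<nu>"] exI[of _ "\<lambda>_. 1"]) (auto simp: W'_def)
    next
      case True
      note ap = apos[OF \<nu>]
      define m where "m c = mass (restr (cell c) (a \<nu>))" for c
      have rpos: "restr (cell c) (a \<nu>) \<in> pos_fun L" for c by (rule restr_pos_fun[OF ap(1)])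
      have m0: "0 \<le> m c" for c unfolding m_def by (rule mass_nonneg[OF rpos])
      define I where "I = {c \<in> Z. 0 < m c}"
      have decomp: "(\<Sum>c\<in>Z. restr (cell c) (a \<nu>) f) = a \<nu> f" if f: "bdd_on L f" for f
      proof -
        have "(\<Sum>c\<in>Z. restr (cell c) (a \<nu>) f) = a \<nu> (\<lambda>p. \<Sum>c\<in>Z. of_bool (p \<in> cell c) * f p)"
          unfolding restr_def using f by (intro pos_fun_sum[OF ap(1), symmetric] bdd_on_mult) auto
        also have "\<dots> = a \<nu> f"
        proof (rule pos_fun_cong[OF ap(1)])
          show "bdd_on L (\<lambda>p. \<Sum>c\<in>Z. of_bool (p \<in> cell c) * f p)"
            using f by (intro bdd_on_sum bdd_on_mult) auto
          show "(\<Sum>c\<in>Z. of_bool (p \<in> cell c) * f p) = f p" if p: "p \<in> L" for p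
          proof -
            have "(\<Sum>c\<in>Z. of_bool (p \<in> cell c) * f p) = (\<Sum>c\<in>Z. if c = q (e p) then f p else 0)"
              by (intro sum.cong) (auto simp: cell_def)
            then show ?thesis using q[OF bddG[OF e(1) p]] Z(1) by simp
          qed
        qed
        finally show ?thesis .
      qed
      have summ: "sum m Z = mass (a \<nu>)"
        using arg_cong[OF decomp[of "\<lambda>_. 1"], of re_part] by (simp add: m_def mass_def re_part_sum)
      have sumI: "sum g I = sum g Z" if "\<And>c. c \<in> Z \<Longrightarrow> \<not> 0 < m c \<Longrightarrow> g c = 0" for g :: "'k \<Rightarrow> 'z::comm_monoid_add"
        unfolding I_def using that Z(1) by (intro sum.mono_neutral_left) auto
      have conc: "mass (restr (- cell c) (restr (cell c) (a \<nu>))) = 0" for c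
      proof -
        have "(\<lambda>p. of_bool (p \<in> cell c) * (of_bool (p \<in> - cell c) * 1)) = (\<lambda>p. 0 :: 'k)"
          by (rule ext) simp
        then have "restr (- cell c) (restr (cell c) (a \<nu>)) (\<lambda>_. 1) = a \<nu> (\<lambda>p. 0)"
          by (simp only: restr_def)
        then show ?thesis using pos_fun_const[OF ap(1), of 0] by (simp add: mass_def)
      qed
      have near: "norm (e p - c) \<le> \<epsilon>" if "p \<in> L" "p \<in> cell c" for p c
        using q[OF bddG[OF e(1) that(1)]] that(2) by (auto simp: cell_def)
      have cellapprox: "norm (restr (cell c) (a \<nu>) e - c * of_real (m c)) \<le> \<epsilon> * m c" for c
        unfolding m_def by (rule concentrated_approx[OF rpos conc be near])
      have "norm ((\<Sum>c\<in>I. of_real (m c / mass (a \<nu>)) * \<phi> c e) - w) \<le> 4 * \<epsilon>"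
        if \<phi>: "\<And>c. c \<in> I \<Longrightarrow> \<phi> c \<in> prob_below (restr (cell c) (a \<nu>))" for \<phi>
      proof -
        \<comment> \<open>One \<epsilon> for \<open>\<phi> c\<close>, which lives on the cell, and
          one for the share of the cell in \<open>a \<nu>\<close>.\<close>
        have 1: "norm (of_real (m c) * \<phi> c e - restr (cell c) (a \<nu>) e) \<le> 2 * \<epsilon> * m c" if "c \<in> I" for c
        proof -
          have "norm (\<phi> c e - c) \<le> \<epsilon>" by (rule prob_below_approx[OF \<phi>[OF that] ap(1) be near])
          then have "norm (of_real (m c) * (\<phi> c e - c)) \<le> m c * \<epsilon>"
            using m0[of c] by (simp add: norm_mult mult_left_mono)
          moreover have "of_real (m c) * \<phi> c e - restr (cell c) (a \<nu>) e =
            of_real (m c) * (\<phi> c e - c) - (restr (cell c) (a \<nu>) e - c * of_real (m c))"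
            by (simp add: algebra_simps)
          ultimately show ?thesis using cellapprox[of c]
            norm_triangle_ineq4[of "of_real (m c) * (\<phi> c e - c)" "restr (cell c) (a \<nu>) e - c * of_real (m c)"]
            by (simp add: algebra_simps)
        qed
        have "(\<Sum>c\<in>I. restr (cell c) (a \<nu>) e) = (\<Sum>c\<in>Z. restr (cell c) (a \<nu>) e)"
        proof (rule sumI)
          fix c assume "\<not> 0 < m c"
          then have "m c = 0" using m0[of c] by simp
          then show "restr (cell c) (a \<nu>) e = 0" using cellapprox[of c] by simp
        qed
        then have 2: "(\<Sum>c\<in>I. restr (cell c) (a \<nu>) e) = a \<nu> e" using decomp[OF be] by simp
        have "norm ((\<Sum>c\<in>I. of_real (m c) * \<phi> c e) - a \<nu> e) \<le> (\<Sum>c\<in>I. 2 * \<epsilon> * m c)"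
          unfolding 2[symmetric] sum_subtractf[symmetric] using 1 by (rule sum_norm_le)
        also have "\<dots> = 2 * \<epsilon> * mass (a \<nu>)"
          using sumI[of m] m0 summ by (simp add: sum_distrib_left[symmetric] antisym not_less)
        finally have 3: "norm ((\<Sum>c\<in>I. of_real (m c) * \<phi> c e) - a \<nu> e) \<le> 2 * \<epsilon> * mass (a \<nu>)" .
        define S where "S = (\<Sum>c\<in>I. of_real (m c) * \<phi> c e)"
        have "norm (S - w * of_real (mass (a \<nu>))) \<le>
          norm (S - a \<nu> e) + norm (a \<nu> e - \<xi> (a \<nu>)) + norm (\<xi> (a \<nu>) - w * of_real (mass (a \<nu>)))"
          using norm_triangle_ineq[of "S - a \<nu> e" "a \<nu> e - \<xi> (a \<nu>)"]
            norm_triangle_ineq[of "S - \<xi> (a \<nu>)" "\<xi> (a \<nu>) - w * of_real (mass (a \<nu>))"] by simp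
        then have 4: "norm (S - w * of_real (mass (a \<nu>))) \<le> 4 * \<epsilon> * mass (a \<nu>)"
          using 3 e(2)[OF \<nu>] t2[OF \<nu>] a(3)[OF \<nu>] unfolding S_def by linarith
        have "(\<Sum>c\<in>I. of_real (m c / mass (a \<nu>)) * \<phi> c e) = S / of_real (mass (a \<nu>))"
          by (simp add: S_def sum_divide_distrib)
        then have "(\<Sum>c\<in>I. of_real (m c / mass (a \<nu>)) * \<phi> c e) - w =
            (S - w * of_real (mass (a \<nu>))) / of_real (mass (a \<nu>))"
          using ap(2) by (simp add: diff_divide_distrib)
        then have "norm ((\<Sum>c\<in>I. of_real (m c / mass (a \<nu>)) * \<phi> c e) - w) =
            norm (S - w * of_real (mass (a \<nu>))) / mass (a \<nu>)"
          using ap(2) by (simp add: norm_divide)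
        also have "\<dots> \<le> 4 * \<epsilon>" using 4 ap(2) by (simp add: pos_divide_le_eq)
        finally show ?thesis .
      qed
      moreover have "sum (\<lambda>c. m c / mass (a \<nu>)) I = 1"
        using sumI[of m] m0 summ ap(2) by (simp add: sum_divide_distrib[symmetric] antisym not_less)
      moreover have "\<forall>i\<in>I. restr (cell i) (a \<nu>) \<in> W' \<and> dom_by L (restr (cell i) (a \<nu>)) \<nu> \<and> 0 \<le> m i / mass (a \<nu>)"
      proof
        fix c assume "c \<in> I"
        then have "c \<in> Z" "restr (cell c) (a \<nu>) \<in> pos1" using rpos by (auto simp: I_def pos1_def m_def)
        then show "restr (cell c) (a \<nu>) \<in> W' \<and> dom_by L (restr (cell c) (a \<nu>)) \<nu> \<and> 0 \<le> m c / mass (a \<nu>)"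
          using \<nu> dom_by_trans[OF dom_by_restr[OF ap(1)] a(2)[OF \<nu>]] m0 ap(2)
          unfolding W'_def by (auto intro!: image_eqI[where x = "(\<nu>, c)"])
      qed
      moreover have "finite I" using Z(1) by (simp add: I_def)
      ultimately show ?thesis using True
        by (intro exI[of _ I] exI[of _ "\<lambda>c. restr (cell c) (a \<nu>)"] exI[of _ "\<lambda>c. m c / mass (a \<nu>)"]) auto
    qed
  qed
  moreover have "finite W'" using Wfin Z(1) by (simp add: W'_def)
  moreover have "\<nu> \<in> pos1 \<and> dom_by L \<nu> \<nu>3" if "\<nu> \<in> W'" for \<nu>
  proof -
    have "dom_by L (restr (V \<nu>) \<nu>) \<nu>3" if "\<nu> \<in> W" for \<nu>
      using dom_by_trans[OF dom_by_restr[OF Wpos[OF that]]] W[OF that] by blast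
    moreover have "dom_by L (restr U (a \<nu>)) \<nu>3" if "\<nu> \<in> W" for \<nu> U
      using dom_by_trans[OF dom_by_trans[OF dom_by_restr[OF apos(1)[OF that]] a(2)[OF that]]] W[OF that] by blast
    ultimately show ?thesis using that V unfolding W'_def by auto
  qed
  ultimately show ?thesis using e(1) by blast
qed

text \<open>Every pattern of the two colours on finitely many \<open>e n\<close> is realised, up to
  4 \<epsilon>, by a probability below \<nu>3. Comparing the pattern of a set \<open>S\<close> with
  the constant colour \<open>z\<close> isolates \<open>(w - z) * sum a S\<close>, and a suitable
  \<open>S\<close> makes this a fixed share of the sum of the \<open>norm (a n)\<close>.\<close>

theorem ex_ell1_sequence:
  "\<exists>e :: nat \<Rightarrow> 'p \<Rightarrow> 'k. (\<forall>n. e n \<in> G) \<and> (\<exists>m>0. \<forall>N a B.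
     (\<forall>p\<in>L. norm (\<Sum>n<N. a n * e n p) \<le> B) \<longrightarrow> m * (\<Sum>n<N. norm (a n)) \<le> B)"
proof -
  obtain \<nu>3 w z where \<nu>3: "\<nu>3 \<in> pos1" and wz: "\<delta> / 4 \<le> norm (w - z)"
    and col: "\<And>\<nu>. \<nu> \<in> pos1 \<Longrightarrow> dom_by L \<nu> \<nu>3 \<Longrightarrow>
     (\<exists>\<nu>'\<in>pos1. dom_by L \<nu>' \<nu> \<and> norm (\<xi> \<nu>' - w * of_real (mass \<nu>')) \<le> \<epsilon> * mass \<nu>') \<and>
     (\<exists>k\<in>supp \<nu>. norm (\<xi> (\<lambda>f. f k) - z) \<le> \<epsilon>)"
    using ex_colours by blast
  define v where "v b = (if b then w else z)" for b
  define ok where "ok W \<longleftrightarrow> finite W \<and> (\<forall>\<nu>\<in>W. \<nu> \<in> pos1 \<and> dom_by L \<nu> \<nu>3)" for W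
  have "\<exists>W. \<forall>n. (ok (W n) \<and> (n = 0 \<longrightarrow> W n = {\<nu>3})) \<and> (\<exists>e\<in>G. tree_step (W n) v e (W (Suc n)))"
  proof (rule dependent_nat_choice)
    show "\<exists>W. ok W \<and> (0 = (0::nat) \<longrightarrow> W = {\<nu>3})" using \<nu>3 dom_by_refl by (auto simp: ok_def)
    show "\<exists>W'. (ok W' \<and> (Suc n = 0 \<longrightarrow> W' = {\<nu>3})) \<and> (\<exists>e\<in>G. tree_step W v e W')"
      if "ok W \<and> (n = 0 \<longrightarrow> W = {\<nu>3})" for W n
      using ex_tree_step[of W \<nu>3 w z] that col unfolding ok_def v_def[abs_def] by blast
  qed
  then obtain W where W: "W 0 = {\<nu>3}" "\<And>n. ok (W n)" "\<And>n. \<exists>e\<in>G. tree_step (W n) v e (W (Suc n))"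
    by metis
  from W(3) obtain e where e: "\<And>n. e n \<in> G" "\<And>n. tree_step (W n) v (e n) (W (Suc n))" by metis
  \<comment> \<open>At level \<open>n\<close> the parts \<open>a i\<close> realise the colour of
    \<open>\<sigma> n\<close> on average, whatever is chosen inside them. The induction hypothesis
    fixes the later values inside each part, and mixing preserves these, since all parts aim at the
    same colours.\<close>
  have pattern: "\<exists>\<phi>\<in>prob_below \<nu>. \<forall>j<l. norm (\<phi> (e (n + j)) - v (\<sigma> (n + j))) \<le> 4 * \<epsilon>"
    if "\<nu> \<in> W n" for l n \<nu> and \<sigma> :: "nat \<Rightarrow> bool"
    using that
  proof (induction l arbitrary: n \<nu>)
    case 0
    then have "\<nu> \<in> pos1" using W(2) by (auto simp: ok_def)
    then show ?case using prob_below_nonempty by auto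
  next
    case (Suc l)
    obtain I :: "'k set" and a c where I: "finite I" "\<And>i. i \<in> I \<Longrightarrow> a i \<in> W (Suc n)"
      "\<And>i. i \<in> I \<Longrightarrow> dom_by L (a i) \<nu>" "\<And>i. i \<in> I \<Longrightarrow> 0 \<le> c i" "sum c I = 1"
      "\<And>\<phi>. (\<And>i. i \<in> I \<Longrightarrow> \<phi> i \<in> prob_below (a i)) \<Longrightarrow>
        norm ((\<Sum>i\<in>I. of_real (c i) * \<phi> i (e n)) - v (\<sigma> n)) \<le> 4 * \<epsilon>"
      using e(2)[of n, unfolded tree_step_def, THEN bspec, OF Suc.prems, THEN spec, of "\<sigma> n"]
      by (elim exE conjE) (rule that, auto)
    have "\<forall>i\<in>I. \<exists>\<phi>. \<phi> \<in> prob_below (a i) \<and> (\<forall>j<l. norm (\<phi> (e (Suc n + j)) - v (\<sigma> (Suc n + j))) \<le> 4 * \<epsilon>)"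
      using Suc.IH I(2) by blast
    then obtain \<phi> where \<phi>: "\<And>i. i \<in> I \<Longrightarrow> \<phi> i \<in> prob_below (a i)"
      "\<And>i j. i \<in> I \<Longrightarrow> j < l \<Longrightarrow> norm (\<phi> i (e (Suc n + j)) - v (\<sigma> (Suc n + j))) \<le> 4 * \<epsilon>" by metis
    define \<Phi> where "\<Phi> = (\<lambda>f. \<Sum>i\<in>I. of_real (c i) * \<phi> i f)"
    have "\<Phi> \<in> prob_below \<nu>" unfolding \<Phi>_def by (rule prob_below_convex[OF I(1,4,5,3) \<phi>(1)])
    moreover have "norm (\<Phi> (e (n + j)) - v (\<sigma> (n + j))) \<le> 4 * \<epsilon>" if j: "j < Suc l" for j
    proof (cases j)
      case 0
      then show ?thesis using I(6)[OF \<phi>(1)] by (simp add: \<Phi>_def)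
    next
      case (Suc i')
      define x where "x = v (\<sigma> (n + j))"
      have le: "norm (\<phi> i (e (n + j)) - x) \<le> 4 * \<epsilon>" if "i \<in> I" for i
        using \<phi>(2)[OF that, of i'] j Suc by (simp add: x_def)
      have "\<Phi> (e (n + j)) - x = (\<Sum>i\<in>I. of_real (c i) * (\<phi> i (e (n + j)) - x))"
        using I(5) by (simp add: \<Phi>_def right_diff_distrib sum_subtractf sum_distrib_right[symmetric] flip: of_real_sum)
      also have "norm \<dots> \<le> (\<Sum>i\<in>I. c i * (4 * \<epsilon>))"
        using le I(4) by (intro sum_norm_le) (auto simp: norm_mult intro!: mult_left_mono)
      also have "\<dots> = 4 * \<epsilon>" using I(5) by (simp add: sum_distrib_right[symmetric])
      finally show ?thesis by (simp add: x_def)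
    qed
    ultimately show ?case by blast
  qed
  have "4 * \<epsilon> * (\<Sum>n<N. norm (a n)) \<le> B" if B: "\<forall>p\<in>L. norm (\<Sum>n<N. a n * e n p) \<le> B" for N a B
  proof -
    obtain S where S: "S \<subseteq> {..<N}" "(\<Sum>n<N. norm (a n)) \<le> 4 * norm (sum a S)"
      using ex_large_subset_sum[of "{..<N}" a] by auto
    have \<nu>W: "\<nu>3 \<in> W 0" using W(1) by simp
    obtain \<phi> where \<phi>: "\<phi> \<in> prob_below \<nu>3" "\<And>j. j < N \<Longrightarrow> norm (\<phi> (e j) - v (j \<in> S)) \<le> 4 * \<epsilon>"
      using pattern[OF \<nu>W, of N "\<lambda>j. j \<in> S"] by auto
    obtain \<psi> where \<psi>: "\<psi> \<in> prob_below \<nu>3" "\<And>j. j < N \<Longrightarrow> norm (\<psi> (e j) - v False) \<le> 4 * \<epsilon>"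
      using pattern[OF \<nu>W, of N "\<lambda>j. False"] by auto
    have val: "\<phi> (\<lambda>p. \<Sum>n<N. a n * e n p) = (\<Sum>n<N. a n * \<phi> (e n))"
      and le: "norm (\<phi> (\<lambda>p. \<Sum>n<N. a n * e n p)) \<le> B" if "\<phi> \<in> prob_below \<nu>3" for \<phi>
    proof -
      have p: "\<phi> \<in> pos_fun L" "mass \<phi> = 1" using that by (auto simp: prob_below_def)
      show "\<phi> (\<lambda>p. \<Sum>n<N. a n * e n p) = (\<Sum>n<N. a n * \<phi> (e n))"
        using bdd_G[OF e(1)] by (subst pos_fun_sum[OF p(1)]) (auto simp: pos_fun_scale[OF p(1)] intro!: bdd_on_mult)
      show "norm (\<phi> (\<lambda>p. \<Sum>n<N. a n * e n p)) \<le> B"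
        using norm_pos_fun_le[OF p(1), of "\<lambda>p. \<Sum>n<N. a n * e n p" B] B p(2) by simp
    qed
    have "norm ((\<Sum>n<N. a n * \<phi> (e n)) - (\<Sum>n<N. a n * \<psi> (e n))) \<le> 2 * B"
      using norm_triangle_ineq4[of "\<Sum>n<N. a n * \<phi> (e n)" "\<Sum>n<N. a n * \<psi> (e n)"] le[OF \<phi>(1)] le[OF \<psi>(1)]
      by (simp add: val[OF \<phi>(1)] val[OF \<psi>(1)])
    moreover have "(\<Sum>n<N. a n * \<phi> (e n)) - (\<Sum>n<N. a n * \<psi> (e n)) =
      (w - z) * sum a S + (\<Sum>n<N. a n * ((\<phi> (e n) - v (n \<in> S)) - (\<psi> (e n) - v False)))"
    proof -
      have "(w - z) * sum a S = (\<Sum>n\<in>S. a n * (v True - v False))"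
        by (simp add: v_def sum_distrib_left mult.commute)
      also have "\<dots> = (\<Sum>n<N. a n * (v (n \<in> S) - v False))"
        using S(1) by (intro sum.mono_neutral_cong_left) auto
      finally show ?thesis by (simp add: sum_subtractf[symmetric] sum.distrib[symmetric] algebra_simps)
    qed
    moreover have "norm (\<Sum>n<N. a n * ((\<phi> (e n) - v (n \<in> S)) - (\<psi> (e n) - v False))) \<le>
        (\<Sum>n<N. norm (a n) * (8 * \<epsilon>))"
    proof (rule sum_norm_le)
      fix n assume "n \<in> {..<N}"
      then have "norm ((\<phi> (e n) - v (n \<in> S)) - (\<psi> (e n) - v False)) \<le> 8 * \<epsilon>"
        using norm_triangle_ineq4[of "\<phi> (e n) - v (n \<in> S)" "\<psi> (e n) - v False"] \<phi>(2)[of n] \<psi>(2)[of n] by simp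
      then show "norm (a n * ((\<phi> (e n) - v (n \<in> S)) - (\<psi> (e n) - v False))) \<le> norm (a n) * (8 * \<epsilon>)"
        unfolding norm_mult by (intro mult_left_mono) auto
    qed
    ultimately have "norm ((w - z) * sum a S) \<le> 2 * B + (\<Sum>n<N. norm (a n) * (8 * \<epsilon>))"
      by (smt (verit) norm_diff_ineq norm_triangle_ineq2 add.commute norm_minus_commute)
    \<comment> \<open>The colour distance is 64 \<epsilon>. After the factor 4 of
      \<open>ex_large_subset_sum\<close> there remain 16 \<epsilon>, minus 8 \<epsilon> for the
      errors, against \<open>2 * B\<close>; this gives the constant 4 \<epsilon>.\<close>
    moreover have "(64 * \<epsilon>) * norm (sum a S) \<le> norm ((w - z) * sum a S)"
      unfolding norm_mult using wz by (intro mult_right_mono) (auto simp: \<epsilon>_def)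
    moreover have "(16 * \<epsilon>) * (\<Sum>n<N. norm (a n)) \<le> (16 * \<epsilon>) * (4 * norm (sum a S))"
      using S(2) \<epsilon>_pos by (intro mult_left_mono) auto
    moreover have "(\<Sum>n<N. norm (a n) * (8 * \<epsilon>)) = 8 * (\<epsilon> * (\<Sum>n<N. norm (a n)))"
      by (simp add: sum_distrib_right[symmetric])
    ultimately show ?thesis by (simp add: mult.assoc)
  qed
  then show ?thesis using e(1) \<epsilon>_pos by (intro exI[of _ e] conjI allI exI[of _ "4 * \<epsilon>"]) auto
qed

end

section \<open>Convex combinations of evaluations\<close>

text \<open>Weights are total functions of finite support, so segments between two of them are
  formed pointwise, without a common index set.\<close>

definition conv_weights :: "'p set \<Rightarrow> ('p \<Rightarrow> real) set" where
  "conv_weights L = {c. finite {p. c p \<noteq> 0} \<and> {p. c p \<noteq> 0} \<subseteq> L \<and> (\<forall>p. 0 \<le> c p) \<and> sum c {p. c p \<noteq> 0} = 1}"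

definition comb :: "('p \<Rightarrow> real) \<Rightarrow> ('p \<Rightarrow> 'k::rc_field) \<Rightarrow> 'k" where
  "comb c f = (\<Sum>p | c p \<noteq> 0. of_real (c p) * f p)"

lemma comb_superset:
  "finite A \<Longrightarrow> {p. c p \<noteq> 0} \<subseteq> A \<Longrightarrow> comb c f = (\<Sum>p\<in>A. of_real (c p) * f p)"
  unfolding comb_def by (intro sum.mono_neutral_left) auto

lemma conv_weightsI:
  assumes "finite A" "A \<subseteq> L" "\<And>p. 0 \<le> c p" "\<And>p. p \<notin> A \<Longrightarrow> c p = 0" "sum c A = 1"
  shows "c \<in> conv_weights L"
proof -
  have sub: "{p. c p \<noteq> 0} \<subseteq> A" using assms(4) by auto
  have "sum c {p. c p \<noteq> 0} = sum c A" using sub assms(1) by (intro sum.mono_neutral_left) auto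
  then show ?thesis using assms sub by (auto simp: conv_weights_def intro: finite_subset)
qed

lemma conv_weights_point: "p \<in> L \<Longrightarrow> (\<lambda>q. of_bool (q = p)) \<in> conv_weights L"
  by (rule conv_weightsI[of "{p}"]) auto

lemma comb_point: "comb (\<lambda>q. of_bool (q = p)) f = f p"
  by (subst comb_superset[of "{p}"]) auto

lemma conv_weights_convex:
  assumes c: "c \<in> conv_weights L" and d: "d \<in> conv_weights L" and t: "0 \<le> t" "t \<le> 1"
  shows "(\<lambda>p. c p + t * (d p - c p)) \<in> conv_weights L"
    and "comb (\<lambda>p. c p + t * (d p - c p)) f = comb c f + of_real t * (comb d f - comb c f)"
proof -
  define A where "A = {p. c p \<noteq> 0} \<union> {p. d p \<noteq> 0}"
  have A: "finite A" "A \<subseteq> L" using c d by (auto simp: A_def conv_weights_def)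
  have sums: "sum c A = 1" "sum d A = 1"
  proof -
    have "sum c {p. c p \<noteq> 0} = sum c A" "sum d {p. d p \<noteq> 0} = sum d A"
      using A(1) by (auto simp: A_def intro!: sum.mono_neutral_left)
    then show "sum c A = 1" "sum d A = 1" using c d by (auto simp: conv_weights_def)
  qed
  show "(\<lambda>p. c p + t * (d p - c p)) \<in> conv_weights L"
  proof (rule conv_weightsI[OF A])
    show "0 \<le> c p + t * (d p - c p)" for p
    proof -
      have "c p + t * (d p - c p) = (1 - t) * c p + t * d p" by (simp add: algebra_simps)
      then show ?thesis using c d t by (simp add: conv_weights_def)
    qed
    show "(\<Sum>p\<in>A. c p + t * (d p - c p)) = 1"
      by (simp add: sum.distrib sum_distrib_left[symmetric] sum_subtractf sums)
  qed (auto simp: A_def)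
  have "comb (\<lambda>p. c p + t * (d p - c p)) f = (\<Sum>p\<in>A. of_real (c p + t * (d p - c p)) * f p)"
    by (rule comb_superset[OF A(1)]) (auto simp: A_def)
  also have "\<dots> = (\<Sum>p\<in>A. of_real (c p) * f p) +
      of_real t * ((\<Sum>p\<in>A. of_real (d p) * f p) - (\<Sum>p\<in>A. of_real (c p) * f p))"
    by (simp add: sum_distrib_left sum_subtractf[symmetric] sum.distrib[symmetric] algebra_simps)
  also have "\<dots> = comb c f + of_real t * (comb d f - comb c f)"
    using comb_superset[OF A(1), of c f] comb_superset[OF A(1), of d f] by (simp add: A_def)
  finally show "comb (\<lambda>p. c p + t * (d p - c p)) f = comb c f + of_real t * (comb d f - comb c f)" .
qed

lemma comb_pos_fun:
  assumes "c \<in> conv_weights L"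
  shows "(comb c :: ('p \<Rightarrow> 'k::rc_field) \<Rightarrow> 'k) \<in> pos_fun L"
proof -
  have "(\<lambda>f :: 'p \<Rightarrow> 'k. \<Sum>p | c p \<noteq> 0. of_real (c p) * f p) \<in> pos_fun L"
    using assms by (intro sum_pos_fun scale_pos_fun point_pos_fun) (auto simp: conv_weights_def)
  then show ?thesis by (simp add: comb_def[abs_def])
qed

lemma comb_mass:
  assumes "c \<in> conv_weights L"
  shows "comb c (\<lambda>_. 1) = (1 :: 'k::rc_field)"
proof -
  have "comb c (\<lambda>_. 1) = (of_real (sum c {p. c p \<noteq> 0}) :: 'k)" by (simp add: comb_def)
  then show ?thesis using assms by (simp only: conv_weights_def mem_Collect_eq of_real_1)
qed

lemma norm_comb_le:
  fixes f :: "'p \<Rightarrow> 'k::rc_field"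
  assumes "c \<in> conv_weights L" "\<And>p. p \<in> L \<Longrightarrow> norm (f p) \<le> B"
  shows "norm (comb c f) \<le> B"
  using norm_pos_fun_le[OF comb_pos_fun[OF assms(1)] assms(2)] comb_mass[OF assms(1), where 'k = 'k]
  by (simp add: mass_def)

text \<open>Every axiom of \<open>pos_fun\<close> is a closed condition on the values at no more
  than three functions, so it survives a limit along a sequence adapted to these functions
  alone.\<close>

lemma pos_fun_of_approx:
  fixes \<nu> :: "('p \<Rightarrow> 'k::rc_field) \<Rightarrow> 'k"
  assumes appr: "\<And>I e. finite I \<Longrightarrow> (\<And>f. f \<in> I \<Longrightarrow> bdd_on L f) \<Longrightarrow> 0 < e \<Longrightarrow>
    \<exists>\<phi>\<in>pos_fun L. \<forall>f\<in>I. dist (\<phi> f) (\<nu> f) < e"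
  shows "\<nu> \<in> pos_fun L"
proof -
  have closed: "P (\<nu> f) (\<nu> g) (\<nu> h)"
    if "bdd_on L f" "bdd_on L g" "bdd_on L h" "\<And>\<phi>. \<phi> \<in> pos_fun L \<Longrightarrow> P (\<phi> f) (\<phi> g) (\<phi> h)"
      "closed {(x, y, z). P x y z}" for P and f g h :: "'p \<Rightarrow> 'k"
  proof -
    have "\<exists>\<phi>. \<phi> \<in> pos_fun L \<and> (\<forall>k\<in>{f, g, h}. dist (\<phi> k) (\<nu> k) < inverse (real (Suc n)))" for n
      using appr[of "{f, g, h}" "inverse (real (Suc n))"] that(1-3) by auto
    then obtain \<phi> where \<phi>: "\<And>n. \<phi> n \<in> pos_fun L"
      "\<And>n k. k \<in> {f, g, h} \<Longrightarrow> dist (\<phi> n k) (\<nu> k) < inverse (real (Suc n))" by metis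
    have lim: "(\<lambda>n. \<phi> n k) \<longlonglongrightarrow> \<nu> k" if "k \<in> {f, g, h}" for k
    proof (rule metric_tendsto_imp_tendsto[OF LIMSEQ_inverse_real_of_nat])
      show "\<forall>\<^sub>F n in sequentially. dist (\<phi> n k) (\<nu> k) \<le> dist (inverse (real (Suc n))) 0"
        using \<phi>(2)[OF that] by (intro always_eventually allI) (simp add: less_imp_le del: of_nat_Suc)
    qed
    have "(\<nu> f, \<nu> g, \<nu> h) \<in> {(x, y, z). P x y z}"
    proof (rule closed_sequentially[OF that(5)])
      show "(\<phi> n f, \<phi> n g, \<phi> n h) \<in> {(x, y, z). P x y z}" for n using \<phi>(1) that(4) by auto
      show "(\<lambda>n. (\<phi> n f, \<phi> n g, \<phi> n h)) \<longlonglongrightarrow> (\<nu> f, \<nu> g, \<nu> h)"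
        by (intro tendsto_Pair lim) auto
    qed
    then show ?thesis by simp
  qed
  show ?thesis
  proof (rule pos_funI)
    fix f g :: "'p \<Rightarrow> 'k" assume fg: "bdd_on L f" "bdd_on L g"
    show "\<nu> (\<lambda>p. f p + g p) = \<nu> f + \<nu> g"
      by (rule closed[OF bdd_on_add[OF fg] fg, of "\<lambda>x y z. x = y + z"])
         (auto simp: pos_fun_add fg case_prod_unfold intro!: closed_Collect_eq continuous_intros)
  next
    fix c and f :: "'p \<Rightarrow> 'k" assume f: "bdd_on L f"
    then have cf: "bdd_on L (\<lambda>p. c * f p)" by (intro bdd_on_mult) auto
    show "\<nu> (\<lambda>p. c * f p) = c * \<nu> f"
      by (rule closed[OF cf f f, of "\<lambda>x y z. x = c * y"])
         (auto simp: pos_fun_scale f case_prod_unfold intro!: closed_Collect_eq continuous_intros)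
  next
    fix f :: "'p \<Rightarrow> 'k" assume f: "bdd_on L f" "\<And>p. p \<in> L \<Longrightarrow> nonneg (f p)"
    show "nonneg (\<nu> f)"
    proof (rule closed[OF f(1) f(1) f(1), of "\<lambda>x y z. nonneg x"])
      have "{(x :: 'k, y :: 'k, z :: 'k). nonneg x} = {z. nonneg z} \<times> UNIV" by auto
      then show "closed {(x :: 'k, y :: 'k, z :: 'k). nonneg x}"
        by (simp add: closed_Times closed_nonneg)
    qed (rule pos_fun_nonneg[OF _ f])
  qed
qed

section \<open>Closed spaces of continuous functions on a compact space\<close>

text \<open>\<open>E\<close> is a carrier in a larger type, which suits a closure such as
  \<open>inj_tensor\<close>. The axiom \<open>norming\<close> asks for the value
  \<open>norm u\<close> itself, not only for its modulus; the dual balls allow this because they are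
  stable under rotation.\<close>

locale function_space =
  fixes \<tau> :: "'p topology" and E :: "'e::banach set" and sc :: "'k::rc_field \<Rightarrow> 'e \<Rightarrow> 'e"
    and ev :: "'p \<Rightarrow> 'e \<Rightarrow> 'k"
  assumes compact_space: "compact_space \<tau>"
    and closed_E: "closed E" and zero_mem: "0 \<in> E"
    and add_mem: "u \<in> E \<Longrightarrow> v \<in> E \<Longrightarrow> u + v \<in> E"
    and sc_mem: "u \<in> E \<Longrightarrow> sc c u \<in> E"
    and ev_add: "p \<in> topspace \<tau> \<Longrightarrow> u \<in> E \<Longrightarrow> v \<in> E \<Longrightarrow> ev p (u + v) = ev p u + ev p v"
    and ev_sc: "p \<in> topspace \<tau> \<Longrightarrow> u \<in> E \<Longrightarrow> ev p (sc c u) = c * ev p u"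
    and sc_of_real: "u \<in> E \<Longrightarrow> sc (of_real r) u = r *\<^sub>R u"
    and sc_add: "u \<in> E \<Longrightarrow> sc (a + b) u = sc a u + sc b u"
    and sc_sc: "u \<in> E \<Longrightarrow> sc a (sc b u) = sc (a * b) u"
    and sc_bounded_linear: "bounded_linear (sc c)"
    and norm_sc: "u \<in> E \<Longrightarrow> norm (sc c u) = norm c * norm u"
    and ev_continuous: "u \<in> E \<Longrightarrow> continuous_map \<tau> euclidean (\<lambda>p. ev p u)"
    and norm_ev_le: "p \<in> topspace \<tau> \<Longrightarrow> u \<in> E \<Longrightarrow> norm (ev p u) \<le> norm u"
    and norming: "u \<in> E \<Longrightarrow> \<exists>p\<in>topspace \<tau>. ev p u = of_real (norm u)"
begin

lemma scaleR_mem: "u \<in> E \<Longrightarrow> r *\<^sub>R u \<in> E"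
  using sc_mem[of u "of_real r"] by (simp add: sc_of_real)

lemma ev_scaleR: "p \<in> topspace \<tau> \<Longrightarrow> u \<in> E \<Longrightarrow> ev p (r *\<^sub>R u) = of_real r * ev p u"
  using ev_sc[of p u "of_real r"] by (simp add: sc_of_real)

lemma diff_mem: "u \<in> E \<Longrightarrow> v \<in> E \<Longrightarrow> u - v \<in> E"
  using add_mem[of u "(-1) *\<^sub>R v"] scaleR_mem[of v "-1"] by simp

lemma sum_mem: "(\<And>i. i \<in> I \<Longrightarrow> f i \<in> E) \<Longrightarrow> sum f I \<in> E"
  by (induction I rule: infinite_finite_induct) (auto intro: zero_mem add_mem)

definition functional :: "('e \<Rightarrow> 'k) \<Rightarrow> bool" where
  "functional T \<longleftrightarrow> (\<forall>u\<in>E. \<forall>v\<in>E. T (u + v) = T u + T v) \<and> (\<forall>c. \<forall>u\<in>E. T (sc c u) = c * T u)"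

lemma functional_add: "functional T \<Longrightarrow> u \<in> E \<Longrightarrow> v \<in> E \<Longrightarrow> T (u + v) = T u + T v"
  by (simp add: functional_def)

lemma functional_sc: "functional T \<Longrightarrow> u \<in> E \<Longrightarrow> T (sc c u) = c * T u"
  by (simp add: functional_def)

lemma functional_scaleR: "functional T \<Longrightarrow> u \<in> E \<Longrightarrow> T (r *\<^sub>R u) = of_real r * T u"
  using functional_sc[of T u "of_real r"] by (simp add: sc_of_real)

lemma functional_0: "functional T \<Longrightarrow> T 0 = 0"
  using functional_scaleR[of T 0 0] zero_mem by simp

lemma functional_diff: "functional T \<Longrightarrow> u \<in> E \<Longrightarrow> v \<in> E \<Longrightarrow> T (u - v) = T u - T v"
  using functional_add[of T u "(-1) *\<^sub>R v"] functional_scaleR[of T v "-1"] scaleR_mem[of v "-1"] by simp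

lemma functional_sum:
  "functional T \<Longrightarrow> (\<And>i. i \<in> I \<Longrightarrow> f i \<in> E) \<Longrightarrow> T (sum f I) = (\<Sum>i\<in>I. T (f i))"
  by (induction I rule: infinite_finite_induct) (auto simp: functional_0 functional_add sum_mem)

lemma functional_ev: "p \<in> topspace \<tau> \<Longrightarrow> functional (ev p)"
  by (simp add: functional_def ev_add ev_sc)

lemma bdd_ev: "L \<subseteq> topspace \<tau> \<Longrightarrow> u \<in> E \<Longrightarrow> bdd_on L (\<lambda>p. ev p u)"
  by (rule bdd_onI[where B = "norm u"]) (auto intro: norm_ev_le)

lemma functional_comp_ev:
  assumes L: "L \<subseteq> topspace \<tau>" and \<nu>: "\<nu> \<in> pos_fun L"
  shows "functional (\<lambda>u. \<nu> (\<lambda>p. ev p u))"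
proof -
  have "\<nu> (\<lambda>p. ev p (u + v)) = \<nu> (\<lambda>p. ev p u + ev p v)" if "u \<in> E" "v \<in> E" for u v
    by (rule pos_fun_cong[OF \<nu> bdd_ev[OF L]]) (use that L ev_add add_mem in auto)
  moreover have "\<nu> (\<lambda>p. ev p (sc c u)) = \<nu> (\<lambda>p. c * ev p u)" if "u \<in> E" for c u
    by (rule pos_fun_cong[OF \<nu> bdd_ev[OF L]]) (use that L ev_sc sc_mem in auto)
  ultimately show ?thesis using bdd_ev[OF L]
    by (simp add: functional_def pos_fun_add[OF \<nu>] pos_fun_scale[OF \<nu>])
qed

section \<open>From support inequalities to approximation by evaluations\<close>

text \<open>The inequality of support functions saying that \<open>T\<close> lies within \<epsilon>
  of the weak* closed convex hull of the evaluations at \<open>L\<close>, in the form that the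
  variational principle delivers.\<close>

definition almost_below :: "('e \<Rightarrow> 'k) \<Rightarrow> real \<Rightarrow> 'p set \<Rightarrow> bool" where
  "almost_below T \<epsilon> L \<longleftrightarrow> (\<forall>h\<in>E. \<exists>p\<in>L. re_part (T h) - \<epsilon> * norm h \<le> re_part (ev p h))"

text \<open>Separation in finite dimension by \<open>finite_minimax\<close>. The coordinates are
  pairs of an element of \<open>F\<close> and one of four directions \<open>d\<close>; opposite
  directions bound a real part from both sides, and \<open>norm_le_re_part\<close> adds the two real
  parts, whence the factor 2.\<close>

lemma finite_approx:
  assumes T: "functional T" and L: "L \<subseteq> topspace \<tau>" and H: "almost_below T \<epsilon> L" and \<epsilon>: "0 \<le> \<epsilon>"
    and F: "finite F" "F \<subseteq> E" and \<eta>: "0 < \<eta>"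
  shows "\<exists>c\<in>conv_weights L. \<forall>u\<in>F. norm (comb c (\<lambda>p. ev p u) - T u) \<le> 2 * (\<epsilon> * norm u + \<eta>)"
proof -
  define D where "D = {1, - 1, neg_i, - neg_i :: 'k}"
  have D: "norm d \<le> 1" if "d \<in> D" for d using that norm_neg_i by (auto simp: D_def)
  \<comment> \<open>Adding 0 makes the set of coordinates nonempty.\<close>
  define F' where "F' = insert 0 F"
  have F': "finite F'" "F' \<subseteq> E" using F zero_mem by (auto simp: F'_def)
  define v where "v c = (\<lambda>(u, d). re_part (d * (comb c (\<lambda>p. ev p u) - T u)) + \<epsilon> * norm u)" for c
  define B where "B = (\<Sum>u\<in>F'. norm u + norm (T u) + \<epsilon> * norm u)"
  have evF: "functional (\<lambda>u. comb c (\<lambda>p. ev p u) :: 'k)" if "c \<in> conv_weights L" for c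
    by (rule functional_comp_ev[OF L comb_pos_fun[OF that]])
  have "\<exists>w\<in>v ` conv_weights L. \<forall>i\<in>F' \<times> D. - \<eta> \<le> w i"
  proof (rule finite_minimax[where d = 0 and B = B])
    show "finite (F' \<times> D)" "F' \<times> D \<noteq> {}" using F' by (auto simp: D_def F'_def)
    show "(\<lambda>i. a i + t * (b i - a i)) \<in> v ` conv_weights L"
      if ab: "a \<in> v ` conv_weights L" "b \<in> v ` conv_weights L" and t: "0 \<le> t" "t \<le> 1" for a b t
    proof -
      obtain c c' where c: "c \<in> conv_weights L" "a = v c" "c' \<in> conv_weights L" "b = v c'" using ab by auto
      note cc = conv_weights_convex[OF c(1,3) t]
      have "v c (u, d) + t * (v c' (u, d) - v c (u, d)) = v (\<lambda>p. c p + t * (c' p - c p)) (u, d)" for u d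
      proof -
        define x where "x = comb c (\<lambda>p. ev p u)"
        define y where "y = comb c' (\<lambda>p. ev p u)"
        have "d * (x + of_real t * (y - x) - T u) = d * (x - T u) + of_real t * (d * (y - T u) - d * (x - T u))"
          by (simp add: algebra_simps)
        then have "re_part (d * (x + of_real t * (y - x) - T u)) =
            re_part (d * (x - T u)) + t * (re_part (d * (y - T u)) - re_part (d * (x - T u)))"
          by (simp only: re_part_add re_part_of_real_mult re_part_diff)
        then show ?thesis unfolding v_def cc(2) by (simp add: x_def y_def)
      qed
      then have "(\<lambda>i. a i + t * (b i - a i)) = v (\<lambda>p. c p + t * (c' p - c p))" using c by auto
      then show ?thesis using cc(1) by blast
    qed
    show "\<bar>a i\<bar> \<le> B" if ai: "a \<in> v ` conv_weights L" "i \<in> F' \<times> D" for a i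
    proof -
      obtain c u d where c: "c \<in> conv_weights L" "a = v c" "i = (u, d)" "u \<in> F'" "d \<in> D" using ai by auto
      have u: "u \<in> E" using c F' by auto
      have "norm (comb c (\<lambda>p. ev p u)) \<le> norm u"
        by (rule norm_comb_le[OF c(1)]) (use L u norm_ev_le in auto)
      then have "norm (comb c (\<lambda>p. ev p u) - T u) \<le> norm u + norm (T u)"
        using norm_triangle_ineq4[of "comb c (\<lambda>p. ev p u)" "T u"] by linarith
      moreover have "norm (d * (comb c (\<lambda>p. ev p u) - T u)) \<le> 1 * norm (comb c (\<lambda>p. ev p u) - T u)"
        unfolding norm_mult using D[OF c(5)] by (intro mult_right_mono) auto
      moreover have "a i = re_part (d * (comb c (\<lambda>p. ev p u) - T u)) + \<epsilon> * norm u" using c by (simp add: v_def)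
      moreover have "0 \<le> \<epsilon> * norm u" using \<epsilon> by simp
      ultimately have "\<bar>a i\<bar> \<le> norm u + norm (T u) + \<epsilon> * norm u"
        using abs_re_part_le[of "d * (comb c (\<lambda>p. ev p u) - T u)"] by linarith
      also have "\<dots> \<le> B" unfolding B_def
        by (rule member_le_sum[OF c(4) _ F'(1)]) (use \<epsilon> in auto)
      finally show ?thesis .
    qed
    show "\<exists>a\<in>v ` conv_weights L. 0 \<le> (\<Sum>i\<in>F' \<times> D. l i * a i)"
      if l: "\<And>i. i \<in> F' \<times> D \<Longrightarrow> 0 \<le> l i" "sum l (F' \<times> D) = 1" for l
    proof -
      \<comment> \<open>The weights \<open>l\<close> combine all coordinates into one test element
        \<open>h\<close>; the point that \<open>H\<close> provides for \<open>h\<close> is, as a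
        point weight, good for \<open>l\<close>.\<close>
      define h where "h = (\<Sum>i\<in>F' \<times> D. sc (of_real (l i) * snd i) (fst i))"
      have mem: "sc (of_real (l i) * snd i) (fst i) \<in> E" if "i \<in> F' \<times> D" for i
        using that F' by (intro sc_mem) auto
      have h: "h \<in> E" unfolding h_def using mem by (rule sum_mem)
      obtain p where p: "p \<in> L" "re_part (T h) - \<epsilon> * norm h \<le> re_part (ev p h)"
        using H h unfolding almost_below_def by blast
      have pK: "p \<in> topspace \<tau>" using p L by auto
      have val: "S h = (\<Sum>i\<in>F' \<times> D. of_real (l i) * (snd i * S (fst i)))" if S: "functional S" for S
      proof -
        have "S h = (\<Sum>i\<in>F' \<times> D. S (sc (of_real (l i) * snd i) (fst i)))"
          unfolding h_def by (rule functional_sum[OF S]) (rule mem)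
        also have "\<dots> = (\<Sum>i\<in>F' \<times> D. of_real (l i) * (snd i * S (fst i)))"
          by (intro sum.cong refl) (use F' in \<open>auto simp: functional_sc[OF S] mult.assoc\<close>)
        finally show ?thesis .
      qed
      have "norm h \<le> (\<Sum>i\<in>F' \<times> D. l i * norm (fst i))"
        unfolding h_def
      proof (rule sum_norm_le)
        fix i assume i: "i \<in> F' \<times> D"
        then have "norm (sc (of_real (l i) * snd i) (fst i)) = l i * norm (snd i) * norm (fst i)"
          using F' l(1)[OF i] by (subst norm_sc) (auto simp: norm_mult)
        also have "\<dots> \<le> l i * 1 * norm (fst i)"
          using i D l(1)[OF i] by (intro mult_right_mono mult_left_mono) auto
        finally show "norm (sc (of_real (l i) * snd i) (fst i)) \<le> l i * norm (fst i)" by simp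
      qed
      then have "\<epsilon> * norm h \<le> \<epsilon> * (\<Sum>i\<in>F' \<times> D. l i * norm (fst i))" using \<epsilon> by (rule mult_left_mono)
      then have "0 \<le> re_part (ev p h - T h) + \<epsilon> * (\<Sum>i\<in>F' \<times> D. l i * norm (fst i))" using p(2) by simp
      also have "re_part (ev p h - T h) = (\<Sum>i\<in>F' \<times> D. l i * re_part (snd i * (ev p (fst i) - T (fst i))))"
        unfolding val[OF T] val[OF functional_ev[OF pK]]
        by (simp add: re_part_sum right_diff_distrib sum_subtractf)
      finally have "0 \<le> (\<Sum>i\<in>F' \<times> D. l i * v (\<lambda>q. of_bool (q = p)) i)"
        by (simp add: v_def comb_point case_prod_unfold sum_distrib_left sum.distrib sum_subtractf algebra_simps)
      then show ?thesis using conv_weights_point[OF p(1)] by blast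
    qed
    show "- \<eta> < 0" using \<eta> by simp
  qed
  then obtain c where c: "c \<in> conv_weights L" "\<And>u d. u \<in> F' \<Longrightarrow> d \<in> D \<Longrightarrow> - \<eta> \<le> v c (u, d)" by auto
  have "norm (comb c (\<lambda>p. ev p u) - T u) \<le> 2 * (\<epsilon> * norm u + \<eta>)" if "u \<in> F" for u
  proof -
    define x where "x = comb c (\<lambda>p. ev p u) - T u"
    have "- \<eta> \<le> re_part (d * x) + \<epsilon> * norm u" if "d \<in> D" for d
      using c(2)[of u d] that \<open>u \<in> F\<close> by (auto simp: v_def F'_def x_def)
    from this[of 1] this[of "- 1"] this[of neg_i] this[of "- neg_i"]
    have "\<bar>re_part x\<bar> \<le> \<epsilon> * norm u + \<eta>" "\<bar>re_part (neg_i * x)\<bar> \<le> \<epsilon> * norm u + \<eta>" by (auto simp: D_def)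
    then show ?thesis using norm_le_re_part[of x] by (simp add: x_def)
  qed
  then show ?thesis using c(1) by blast
qed

text \<open>Tychonoff applied to the weights of \<open>finite_approx\<close>. A requirement is an
  element of \<open>E\<close> with a slack, and the slack disappears at the cluster point. The
  result takes the place of a representing measure on \<open>L\<close>.\<close>

lemma ex_pos_fun_approx:
  assumes T: "functional T" and L: "L \<subseteq> topspace \<tau>" and H: "almost_below T \<epsilon> L" and \<epsilon>: "0 \<le> \<epsilon>"
  shows "\<exists>\<nu>\<in>pos_fun L. mass \<nu> = 1 \<and> (\<forall>u\<in>E. norm (\<nu> (\<lambda>p. ev p u) - T u) \<le> 2 * \<epsilon> * norm u)"
proof -
  \<comment> \<open>Any bound of \<open>f\<close> on \<open>L\<close> will do; it fixes a compact
    disc for the values at \<open>f\<close>.\<close>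
  define bd where "bd f = (SOME B. \<forall>p\<in>L. norm (f p) \<le> B)" for f :: "'p \<Rightarrow> 'k"
  have bd: "norm (f p) \<le> bd f" if "bdd_on L f" "p \<in> L" for f p
    using someI_ex[OF that(1)[unfolded bdd_on_def]] that(2) unfolding bd_def by blast
  have "\<exists>\<nu>. \<forall>A I e. finite A \<longrightarrow> A \<subseteq> E \<times> {0<..} \<longrightarrow> finite I \<longrightarrow> I \<subseteq> {f :: 'p \<Rightarrow> 'k. bdd_on L f} \<longrightarrow> 0 < e \<longrightarrow>
    (\<exists>c\<in>conv_weights L. (\<forall>r\<in>A. norm (comb c (\<lambda>p. ev p (fst r)) - T (fst r)) \<le> 2 * (\<epsilon> * norm (fst r) + snd r)) \<and>
      (\<forall>f\<in>I. dist (comb c f) (\<nu> f) < e))"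
  proof (rule ex_cluster_point[where D = "\<lambda>f. cball 0 (bd f)" and ev = "\<lambda>f c. comb c f"])
    show "comb c f \<in> cball 0 (bd f)" if "f \<in> {f. bdd_on L f}" "c \<in> conv_weights L" for f and c :: "'p \<Rightarrow> real"
      using norm_comb_le[OF that(2), of f "bd f"] that(1) bd by simp
    show "\<exists>c\<in>conv_weights L. \<forall>r\<in>A. norm (comb c (\<lambda>p. ev p (fst r)) - T (fst r)) \<le> 2 * (\<epsilon> * norm (fst r) + snd r)"
      if A: "finite A" "A \<subseteq> E \<times> {0<..}" for A
    proof -
      define \<eta> where "\<eta> = Min (insert 1 (snd ` A))"
      have \<eta>: "0 < \<eta>" "\<And>r. r \<in> A \<Longrightarrow> \<eta> \<le> snd r" unfolding \<eta>_def using A by (auto intro: Min_le)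
      obtain c where c: "c \<in> conv_weights L"
        "\<forall>u\<in>fst ` A. norm (comb c (\<lambda>p. ev p u) - T u) \<le> 2 * (\<epsilon> * norm u + \<eta>)"
        using finite_approx[OF T L H \<epsilon> _ _ \<eta>(1), of "fst ` A"] A by fastforce
      have "norm (comb c (\<lambda>p. ev p (fst r)) - T (fst r)) \<le> 2 * (\<epsilon> * norm (fst r) + snd r)" if "r \<in> A" for r
        using c(2) \<eta>(2)[OF that] that by fastforce
      then show ?thesis using c(1) by blast
    qed
  qed (rule compact_cball_rc_field)
  then obtain \<nu> where \<nu>: "\<And>A I e. finite A \<Longrightarrow> A \<subseteq> E \<times> {0<..} \<Longrightarrow> finite I \<Longrightarrow> I \<subseteq> {f :: 'p \<Rightarrow> 'k. bdd_on L f} \<Longrightarrow> 0 < e \<Longrightarrow>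
    (\<exists>c\<in>conv_weights L. (\<forall>r\<in>A. norm (comb c (\<lambda>p. ev p (fst r)) - T (fst r)) \<le> 2 * (\<epsilon> * norm (fst r) + snd r)) \<and>
      (\<forall>f\<in>I. dist (comb c f) (\<nu> f) < e))" by metis
  have pos: "\<nu> \<in> pos_fun L"
  proof (rule pos_fun_of_approx)
    fix I :: "('p \<Rightarrow> 'k) set" and e :: real
    assume "finite I" "\<And>f. f \<in> I \<Longrightarrow> bdd_on L f" "0 < e"
    then show "\<exists>\<phi>\<in>pos_fun L. \<forall>f\<in>I. dist (\<phi> f) (\<nu> f) < e"
      using \<nu>[of "{}" I e] comb_pos_fun by fastforce
  qed
  moreover have "mass \<nu> = 1"
  proof -
    have "\<nu> (\<lambda>_. 1) = 1"
    proof (rule ccontr)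
      assume "\<nu> (\<lambda>_. 1) \<noteq> 1"
      then obtain c where c: "c \<in> conv_weights L" "dist (comb c (\<lambda>_. 1)) (\<nu> (\<lambda>_. 1)) < dist 1 (\<nu> (\<lambda>_. 1))"
        using \<nu>[of "{}" "{\<lambda>_. 1}" "dist 1 (\<nu> (\<lambda>_. 1))"] by auto
      then show False by (simp add: comb_mass[OF c(1)])
    qed
    then show ?thesis by (simp add: mass_def)
  qed
  moreover have "norm (\<nu> (\<lambda>p. ev p u) - T u) \<le> 2 * \<epsilon> * norm u" if u: "u \<in> E" for u
  proof (rule field_le_epsilon)
    fix e :: real assume e: "0 < e"
    obtain c where "c \<in> conv_weights L" "norm (comb c (\<lambda>p. ev p u) - T u) \<le> 2 * (\<epsilon> * norm u + e / 4)"
      "dist (comb c (\<lambda>p. ev p u)) (\<nu> (\<lambda>p. ev p u)) < e / 2"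
      \<comment> \<open>The slack \<open>e / 4\<close> enters doubled; the other half of
        \<open>e\<close> goes into the approximation of \<nu>.\<close>
      using \<nu>[of "{(u, e / 4)}" "{\<lambda>p. ev p u}" "e / 2"] u e bdd_ev[OF L u] by auto
    moreover have "norm (\<nu> (\<lambda>p. ev p u) - T u) \<le>
        dist (comb c (\<lambda>p. ev p u)) (\<nu> (\<lambda>p. ev p u)) + norm (comb c (\<lambda>p. ev p u) - T u)"
      using dist_triangle2[of "\<nu> (\<lambda>p. ev p u)" "T u" "comb c (\<lambda>p. ev p u)"]
      by (simp add: dist_norm norm_minus_commute)
    ultimately show "norm (\<nu> (\<lambda>p. ev p u) - T u) \<le> 2 * \<epsilon> * norm u + e" by (simp add: algebra_simps)
  qed
  ultimately show ?thesis by blast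
qed


text \<open>The lower bound passes from partial sums to the limit, and vectors of norm at most 1
  give the upper one with constant 1. Closedness of \<open>E\<close> keeps the sums inside.\<close>

lemma contains_ell1I:
  fixes u :: "nat \<Rightarrow> 'e"
  assumes u: "\<And>n. u n \<in> E" "\<And>n. norm (u n) \<le> 1" and m: "0 < m"
    and low: "\<And>N a. m * (\<Sum>n<N. norm (a n)) \<le> norm (\<Sum>n<N. sc (a n) (u n))"
  shows "contains_ell1 sc E"
proof -
  define S where "S a = (\<Sum>n. sc (a n) (u n))" for a :: "nat \<Rightarrow> 'k"
  have nle: "norm (sc (a n) (u n)) \<le> norm (a n)" for a :: "nat \<Rightarrow> 'k" and n
    using u norm_sc[OF u(1)] mult_left_mono[OF u(2), of "norm (a n)"] by simp
  have sumn: "summable (\<lambda>n. norm (sc (a n) (u n)))" if "a \<in> ell1" for a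
    using that unfolding ell1_def
    by (intro summable_comparison_test'[of "\<lambda>n. norm (a n)" 0 "\<lambda>n. norm (sc (a n) (u n))"]) (simp_all add: nle)
  have summ: "summable (\<lambda>n. sc (a n) (u n))" if "a \<in> ell1" for a
    by (rule summable_norm_cancel[OF sumn[OF that]])
  have lim: "(\<lambda>N. \<Sum>n<N. sc (a n) (u n)) \<longlonglongrightarrow> S a" if "a \<in> ell1" for a
    unfolding S_def by (rule summable_LIMSEQ[OF summ[OF that]])
  have "S a \<in> E" if "a \<in> ell1" for a
    by (rule closed_sequentially[OF closed_E _ lim[OF that]]) (intro sum_mem sc_mem u)
  moreover have "S (\<lambda>n. a n + b n) = S a + S b" if "a \<in> ell1" "b \<in> ell1" for a b
    unfolding S_def suminf_add[OF summ[OF that(1)] summ[OF that(2)]] by (simp add: sc_add u)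
  moreover have "S (\<lambda>n. c * a n) = sc c (S a)" if "a \<in> ell1" for a c
    unfolding S_def bounded_linear.suminf[OF sc_bounded_linear summ[OF that]] by (simp add: sc_sc u)
  moreover have "m * (\<Sum>n. norm (a n)) \<le> norm (S a) \<and> norm (S a) \<le> 1 * (\<Sum>n. norm (a n))" if a: "a \<in> ell1" for a
  proof
    have sa: "summable (\<lambda>n. norm (a n))" using a by (simp add: ell1_def)
    show "m * (\<Sum>n. norm (a n)) \<le> norm (S a)"
      by (rule LIMSEQ_le[OF tendsto_mult_left[OF summable_LIMSEQ[OF sa], of m] tendsto_norm[OF lim[OF a]]])
        (use low in auto)
    have "norm (S a) \<le> (\<Sum>n. norm (sc (a n) (u n)))" unfolding S_def by (rule summable_norm[OF sumn[OF a]])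
    also have "\<dots> \<le> (\<Sum>n. norm (a n))" by (rule suminf_le[OF _ sumn[OF a] sa]) (rule nle)
    finally show "norm (S a) \<le> 1 * (\<Sum>n. norm (a n))" by simp
  qed
  ultimately show ?thesis unfolding contains_ell1_def using m by blast
qed

text \<open>\<open>far\<close> gives every convex combination its own \<open>u\<close>. Minimax over
  the unit ball exchanges the order and yields one \<open>u\<close> for all points of
  \<open>A\<close>; half of \<open>d\<close> is given up because \<open>finite_minimax\<close>
  reaches only values strictly below \<open>d\<close>.\<close>

lemma ex_separating:
  assumes L: "L \<subseteq> topspace \<tau>" and \<nu>: "\<nu> \<in> pos_fun L" "mass \<nu> = 1" and d: "0 < d"
    and far: "\<And>c. c \<in> conv_weights L \<Longrightarrow> \<exists>u\<in>E. d * norm u < norm (\<nu> (\<lambda>p. ev p u) - comb c (\<lambda>p. ev p u))"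
    and A: "finite A" "A \<subseteq> L"
  shows "\<exists>u\<in>E. norm u \<le> 1 \<and> (\<forall>k\<in>A. re_part (ev k u) + d / 2 \<le> re_part (\<nu> (\<lambda>p. ev p u)))"
proof (cases "A = {}")
  case True
  then show ?thesis using zero_mem by (intro bexI[of _ 0]) auto
next
  case False
  define S where "S u = \<nu> (\<lambda>p. ev p u)" for u
  have S: "functional S" unfolding S_def[abs_def] by (rule functional_comp_ev[OF L \<nu>(1)])
  have S_le: "norm (S u) \<le> norm u" if "u \<in> E" for u
    using norm_pos_fun_le[OF \<nu>(1), of "\<lambda>p. ev p u" "norm u"] norm_ev_le L that \<nu>(2) by (auto simp: S_def)
  \<comment> \<open>The value 0 off \<open>A\<close> makes convexity hold in every coordinate, also
    outside the space, where \<open>ev\<close> need not be linear.\<close>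
  define v where "v u = (\<lambda>k. if k \<in> A then re_part (S u - ev k u) else 0)" for u
  have "\<exists>w\<in>v ` {u \<in> E. norm u \<le> 1}. \<forall>k\<in>A. d / 2 \<le> w k"
  proof (rule finite_minimax[OF A(1) False, where d = d and B = 2])
    fix a b :: "'p \<Rightarrow> real" and t :: real
    assume ab: "a \<in> v ` {u \<in> E. norm u \<le> 1}" "b \<in> v ` {u \<in> E. norm u \<le> 1}" and t: "0 \<le> t" "t \<le> 1"
    then obtain x y where xy: "x \<in> E" "y \<in> E" "norm x \<le> 1" "norm y \<le> 1" "a = v x" "b = v y" by auto
    define z where "z = x + t *\<^sub>R (y - x)"
    have z: "z \<in> E" unfolding z_def by (intro add_mem scaleR_mem diff_mem xy)
    have zeq: "z = (1 - t) *\<^sub>R x + t *\<^sub>R y" by (simp add: z_def algebra_simps)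
    have "norm z \<le> norm ((1 - t) *\<^sub>R x) + norm (t *\<^sub>R y)" unfolding zeq by (rule norm_triangle_ineq)
    also have "\<dots> \<le> (1 - t) * 1 + t * 1"
      unfolding norm_scaleR using t xy by (intro add_mono mult_mono) auto
    finally have "norm z \<le> 1" by simp
    moreover have lin: "F z = F x + of_real t * (F y - F x)" if F: "functional F" for F
      unfolding z_def using xy
      by (simp add: functional_add[OF F] functional_scaleR[OF F] functional_diff[OF F] scaleR_mem diff_mem)
    have "a k + t * (b k - a k) = v z k" for k
    proof (cases "k \<in> A")
      case True
      then have "k \<in> topspace \<tau>" using A L by auto
      then show ?thesis using True
        unfolding xy v_def lin[OF S] lin[OF functional_ev[OF \<open>k \<in> topspace \<tau>\<close>]]
        by (simp add: algebra_simps)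
    qed (simp add: xy v_def)
    then have "(\<lambda>k. a k + t * (b k - a k)) = v z" by auto
    ultimately show "(\<lambda>k. a k + t * (b k - a k)) \<in> v ` {u \<in> E. norm u \<le> 1}" using z by auto
  next
    fix a k assume "a \<in> v ` {u \<in> E. norm u \<le> 1}" and k: "k \<in> A"
    then obtain u where u: "u \<in> E" "norm u \<le> 1" "a = v u" by auto
    have "norm (ev k u) \<le> 1" using norm_ev_le[of k u] k A L u by auto
    then have "norm (S u - ev k u) \<le> 2"
      using norm_triangle_ineq4[of "S u" "ev k u"] S_le[OF u(1)] u(2) by linarith
    then show "\<bar>a k\<bar> \<le> 2" using abs_re_part_le[of "S u - ev k u"] k by (simp add: u v_def)
  next
    fix l :: "'p \<Rightarrow> real" assume l: "\<And>i. i \<in> A \<Longrightarrow> 0 \<le> l i" "sum l A = 1"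
    define c where "c p = (if p \<in> A then l p else 0)" for p
    have c: "c \<in> conv_weights L" by (rule conv_weightsI[OF A]) (use l in \<open>auto simp: c_def\<close>)
    obtain u where u: "u \<in> E" "d * norm u < norm (S u - comb c (\<lambda>p. ev p u))"
      using far[OF c] by (auto simp: S_def)
    obtain r where r: "norm r = 1" "r * (S u - comb c (\<lambda>p. ev p u)) = of_real (norm (S u - comb c (\<lambda>p. ev p u)))"
      using ex_rotation by blast
    have u0: "0 < norm u"
    proof (rule ccontr)
      assume "\<not> 0 < norm u"
      then have "u = 0" by simp
      then show False
        using u functional_0[OF S] functional_0[OF functional_comp_ev[OF L comb_pos_fun[OF c]]] by simp
    qed
    \<comment> \<open>Normalised and rotated, so that the separation becomes a positive real
      part.\<close>
    define w where "w = sc (of_real (1 / norm u) * r) u"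
    have w: "w \<in> E" "norm w = 1" using u u0 r by (auto simp: w_def sc_mem norm_sc norm_mult norm_divide)
    have "d \<le> norm (S u - comb c (\<lambda>p. ev p u)) / norm u" using u(2) u0 by (simp add: pos_le_divide_eq)
    also have "\<dots> = re_part (S w - comb c (\<lambda>p. ev p w))"
    proof -
      have "S w - comb c (\<lambda>p. ev p w) = of_real (1 / norm u) * (r * (S u - comb c (\<lambda>p. ev p u)))"
        unfolding w_def functional_sc[OF S u(1)]
          functional_sc[OF functional_comp_ev[OF L comb_pos_fun[OF c]] u(1)] by (simp add: algebra_simps)
      also have "\<dots> = of_real (norm (S u - comb c (\<lambda>p. ev p u)) / norm u)" unfolding r(2) by simp
      finally show ?thesis by (simp only: re_part_of_real)
    qed
    also have "comb c (\<lambda>p. ev p w) = (\<Sum>p\<in>A. of_real (l p) * ev p w)"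
      by (subst comb_superset[OF A(1)]) (auto simp: c_def)
    also have "re_part (S w - (\<Sum>p\<in>A. of_real (l p) * ev p w)) = (\<Sum>p\<in>A. l p * v w p)"
      using l(2) by (simp add: v_def re_part_sum right_diff_distrib sum_subtractf sum_distrib_right[symmetric])
    finally show "\<exists>a\<in>v ` {u \<in> E. norm u \<le> 1}. d \<le> (\<Sum>p\<in>A. l p * a p)" using w by auto
  qed (use d in simp)
  then show ?thesis by (fastforce simp: v_def S_def)
qed

text \<open>A quantitative form of Haydon's theorem.\<close>

lemma norm_approx:
  assumes noell1: "\<not> contains_ell1 sc E"
    and T: "functional T" and L: "compactin \<tau> L" and H: "almost_below T \<epsilon> L" and \<epsilon>: "0 \<le> \<epsilon>" and d: "0 < d"
  shows "\<exists>c\<in>conv_weights L. \<forall>u\<in>E. norm (T u - comb c (\<lambda>p. ev p u)) \<le> (2 * \<epsilon> + d) * norm u"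
proof (rule ccontr)
  assume contra: "\<not> ?thesis"
  have Lsub: "L \<subseteq> topspace \<tau>" using L by (rule compactin_subset_topspace)
  obtain \<nu> where \<nu>: "\<nu> \<in> pos_fun L" "mass \<nu> = 1"
    "\<And>u. u \<in> E \<Longrightarrow> norm (\<nu> (\<lambda>p. ev p u) - T u) \<le> 2 * \<epsilon> * norm u"
    using ex_pos_fun_approx[OF T Lsub H \<epsilon>] by blast
  \<comment> \<open>\<nu> differs from \<open>T\<close> by at most \<open>2 * \<epsilon>\<close>, so
    a combination farther than \<open>2 * \<epsilon> + d\<close> from \<open>T\<close> is still more
    than \<open>d\<close> away from \<nu>.\<close>
  have far: "\<exists>u\<in>E. d * norm u < norm (\<nu> (\<lambda>p. ev p u) - comb c (\<lambda>p. ev p u))" if "c \<in> conv_weights L" for c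
  proof -
    obtain u where u: "u \<in> E" "(2 * \<epsilon> + d) * norm u < norm (T u - comb c (\<lambda>p. ev p u))"
      using contra \<open>c \<in> conv_weights L\<close> by (meson not_le)
    have "norm (T u - comb c (\<lambda>p. ev p u)) \<le>
      norm (\<nu> (\<lambda>p. ev p u) - comb c (\<lambda>p. ev p u)) + norm (\<nu> (\<lambda>p. ev p u) - T u)"
      using norm_triangle_ineq4[of "\<nu> (\<lambda>p. ev p u) - comb c (\<lambda>p. ev p u)" "\<nu> (\<lambda>p. ev p u) - T u"] by simp
    then show ?thesis using u \<nu>(3)[OF u(1)] by (intro bexI[OF _ u(1)]) (simp add: distrib_right)
  qed
  define G where "G = (\<lambda>u p. ev p u) ` {u \<in> E. norm u \<le> 1}"
  interpret separated_functional \<tau> L G "d / 2" \<nu>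
  proof
    show "continuous_map (subtopology \<tau> L) euclidean e" if "e \<in> G" for e
      using that ev_continuous by (auto simp: G_def intro: continuous_map_from_subtopology)
    show "norm (e p) \<le> 1" if "e \<in> G" "p \<in> L" for e p
    proof -
      obtain u where u: "u \<in> E" "norm u \<le> 1" "e = (\<lambda>p. ev p u)" using \<open>e \<in> G\<close> by (auto simp: G_def)
      show ?thesis using norm_ev_le[of p u] u Lsub \<open>p \<in> L\<close> by auto
    qed
    show "\<exists>e\<in>G. \<forall>k\<in>A. re_part (e k) + d / 2 \<le> re_part (\<nu> e)" if "finite A" "A \<subseteq> L" for A
      using ex_separating[OF Lsub \<nu>(1,2) d far that] by (auto simp: G_def)
  qed (use L \<nu> d in auto)
  from ex_ell1_sequence obtain e :: "nat \<Rightarrow> 'p \<Rightarrow> 'k" and m where e: "\<forall>n. e n \<in> G" and m: "0 < m" "\<forall>N a B.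
     (\<forall>p\<in>L. norm (\<Sum>n<N. a n * e n p) \<le> B) \<longrightarrow> m * (\<Sum>n<N. norm (a n)) \<le> B"
    by (elim exE conjE) (rule that, assumption+)
  have "\<forall>n. \<exists>u. u \<in> E \<and> norm u \<le> 1 \<and> e n = (\<lambda>p. ev p u)" using e by (auto simp: G_def)
  then obtain u where u: "\<And>n. u n \<in> E" "\<And>n. norm (u n) \<le> 1" "\<And>n. e n = (\<lambda>p. ev p (u n))" by metis
  have "contains_ell1 sc E"
  proof (rule contains_ell1I[OF u(1,2) m(1)])
    fix N and a :: "nat \<Rightarrow> 'k"
    have "norm (\<Sum>n<N. a n * e n p) \<le> norm (\<Sum>n<N. sc (a n) (u n))" if p: "p \<in> L" for p
    proof -
      have pK: "p \<in> topspace \<tau>" using p Lsub by auto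
      have "(\<Sum>n<N. a n * e n p) = ev p (\<Sum>n<N. sc (a n) (u n))"
        by (simp add: functional_sum[OF functional_ev[OF pK]] sc_mem u ev_sc pK)
      then show ?thesis using norm_ev_le[OF pK sum_mem[of "{..<N}" "\<lambda>n. sc (a n) (u n)"]] by (simp add: sc_mem u)
    qed
    then show "m * (\<Sum>n<N. norm (a n)) \<le> norm (\<Sum>n<N. sc (a n) (u n))" using m(2) by blast
  qed
  then show False using noell1 by blast
qed

section \<open>Points norming a single element\<close>

text \<open>As \<open>norm_ev_le\<close> bounds the modulus, the inequality forces
  \<open>ev p u = of_real (norm u)\<close>; in this form the set is visibly closed.\<close>

abbreviation norming_points :: "'e \<Rightarrow> 'p set" where
  "norming_points u \<equiv> {p \<in> topspace \<tau>. norm u \<le> re_part (ev p u)}"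

text \<open>The Bishop-Phelps argument: Ekeland's principle for \<open>norm x - Re (T x)\<close> gives a point \<open>u\<close>
  such that \<open>T\<close> is, up to \<open>\<epsilon>\<close>, below the directional derivatives of the norm at \<open>u\<close>, which are
  attained at points \<open>p\<close> with \<open>ev p u = norm u\<close>.\<close>

lemma bishop_phelps:
  assumes T: "functional T" and T_le: "\<And>u. u \<in> E \<Longrightarrow> norm (T u) \<le> norm u"
    and T_ge: "\<And>\<eta>. 0 < \<eta> \<Longrightarrow> \<exists>x\<in>E. norm x = 1 \<and> 1 - \<eta> < re_part (T x)" and \<epsilon>: "0 < \<epsilon>" "\<epsilon> \<le> 1"
  shows "\<exists>u\<in>E. u \<noteq> 0 \<and> compactin \<tau> (norming_points u) \<and>
    almost_below T \<epsilon> (norming_points u)"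
proof -
  obtain x0 where x0: "x0 \<in> E" "norm x0 = 1" "1 - \<epsilon> < re_part (T x0)" using T_ge[OF \<epsilon>(1)] by blast
  define F where "F x = norm x - re_part (T x)" for x
  have dT: "norm (T x - T y) \<le> norm (x - y)" if "x \<in> E" "y \<in> E" for x y
    using T_le[OF diff_mem[OF that]] by (simp add: functional_diff[OF T that])
  have "continuous_on E T"
    unfolding continuous_on_iff dist_norm using dT by (meson le_less_trans)
  then have cont: "continuous_on E F" unfolding F_def by (intro continuous_intros)
  have F0: "0 \<le> F x" if "x \<in> E" for x using T_le[OF that] re_part_le_norm[of "T x"] by (simp add: F_def)
  obtain u where u: "u \<in> E" "F u + \<epsilon> * dist u x0 \<le> F x0" "\<And>v. v \<in> E \<Longrightarrow> F u - \<epsilon> * dist v u \<le> F v"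
    using ekeland[OF closed_E cont F0 x0(1) \<epsilon>(1)] by auto
  \<comment> \<open>At 0 the first inequality for \<open>u\<close> would read
    \<open>\<epsilon> \<le> F x0\<close>, whereas \<open>x0\<close> was chosen with
    \<open>F x0\<close> below \<epsilon>.\<close>
  have "u \<noteq> 0"
  proof
    assume "u = 0"
    then have "\<epsilon> \<le> F x0" using u(2) x0(2) by (simp add: F_def functional_0[OF T] dist_norm)
    then show False using x0 by (simp add: F_def)
  qed
  have compact_sub: "compactin \<tau> {p \<in> topspace \<tau>. r \<le> re_part (ev p h)}" if "h \<in> E" for r h
  proof (rule closedin_compact_space[OF compact_space])
    have "closedin euclidean {z :: 'k. r \<le> re_part z}"
      by (simp add: closed_Collect_le continuous_on_re_part)
    from closedin_continuous_map_preimage[OF ev_continuous[OF that] this]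
    show "closedin \<tau> {p \<in> topspace \<tau>. r \<le> re_part (ev p h)}" by simp
  qed
  have "\<exists>p\<in>topspace \<tau>. norm u \<le> re_part (ev p u) \<and> re_part (T h) - \<epsilon> * norm h \<le> re_part (ev p h)" if h: "h \<in> E" for h
  proof -
    define C where "C = {p \<in> topspace \<tau>. re_part (T h) - \<epsilon> * norm h \<le> re_part (ev p h)}"
    \<comment> \<open>A point norming \<open>u + t *\<^sub>R h\<close> lies in \<open>C\<close> for
      every \<open>t\<close>, by the second inequality for \<open>u\<close>, and norms
      \<open>u\<close> up to an error that vanishes with \<open>t\<close>.\<close>
    have near: "\<exists>p\<in>C. norm u - 2 * t * norm h \<le> re_part (ev p u)" if t: "0 < t" for t
    proof -
      have th: "t *\<^sub>R h \<in> E" "u + t *\<^sub>R h \<in> E" using h u scaleR_mem add_mem by auto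
      obtain p where p: "p \<in> topspace \<tau>" "ev p (u + t *\<^sub>R h) = of_real (norm (u + t *\<^sub>R h))"
        using norming[OF th(2)] by blast
      have "re_part (ev p (u + t *\<^sub>R h)) = norm (u + t *\<^sub>R h)" using p(2) by simp
      then have eq: "re_part (ev p u) + t * re_part (ev p h) = norm (u + t *\<^sub>R h)"
        using p(1) h u th by (simp add: ev_add ev_scaleR)
      have "F u - \<epsilon> * (t * norm h) \<le> F (u + t *\<^sub>R h)" using u(3)[OF th(2)] t by (simp add: dist_norm)
      moreover have "re_part (T (u + t *\<^sub>R h)) = re_part (T u) + t * re_part (T h)"
        by (simp add: functional_add[OF T u(1) th(1)] functional_scaleR[OF T h])
      ultimately have ge: "norm u + t * re_part (T h) - \<epsilon> * (t * norm h) \<le> norm (u + t *\<^sub>R h)" by (simp add: F_def)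
      have "re_part (ev p u) \<le> norm u" "re_part (ev p h) \<le> norm h"
        using norm_ev_le[OF p(1)] u(1) h re_part_le_norm order_trans by blast+
      then have "t * (re_part (T h) - \<epsilon> * norm h) \<le> t * re_part (ev p h)" using ge eq by (simp add: algebra_simps)
      then have "p \<in> C" using t p(1) by (simp add: C_def)
      moreover have "norm u \<le> norm (u + t *\<^sub>R h) + t * norm h"
        using norm_triangle_ineq4[of "u + t *\<^sub>R h" "t *\<^sub>R h"] t by simp
      moreover have "t * re_part (ev p h) \<le> t * norm h" using \<open>re_part (ev p h) \<le> norm h\<close> t by simp
      ultimately show ?thesis using eq by (intro bexI[of _ p]) linarith+
    qed
    \<comment> \<open>The error cannot be removed by a sequence of such points; instead, a point of
      \<open>C\<close> maximising the real part of \<open>ev p u\<close> beats all of them.\<close>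
    have "compact ((\<lambda>p. ev p u) ` C)"
      using image_compactin[OF compact_sub[OF h] ev_continuous[OF u(1)]] unfolding C_def by simp
    then have "compact (re_part ` (\<lambda>p. ev p u) ` C)"
      by (intro compact_continuous_image continuous_on_re_part continuous_on_id)
    moreover have "C \<noteq> {}" using near[of 1] by auto
    ultimately obtain p where p: "p \<in> C" "\<And>q. q \<in> C \<Longrightarrow> re_part (ev q u) \<le> re_part (ev p u)"
      using compact_attains_sup[of "re_part ` (\<lambda>p. ev p u) ` C"] by auto
    have "norm u \<le> re_part (ev p u)"
    proof (rule field_le_epsilon)
      fix e :: real assume e: "0 < e"
      \<comment> \<open>The summand 1 keeps \<open>b\<close> positive when \<open>h\<close> is
        0.\<close>
      define b where "b = norm h + 1"
      define t where "t = e / (2 * b)"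
      have b: "0 < b" by (simp add: b_def add_nonneg_pos)
      then have t: "0 < t" using e by (simp add: t_def)
      have "2 * t * b = e" using b by (simp add: t_def)
      then have "2 * t * (norm h + 1) = e" by (simp add: b_def)
      then have "2 * t * norm h \<le> e" using t by (simp add: distrib_left)
      then show "norm u \<le> re_part (ev p u) + e" using near[OF t] p(2) by fastforce
    qed
    then show ?thesis using p(1) by (auto simp: C_def)
  qed
  then have "almost_below T \<epsilon> (norming_points u)" unfolding almost_below_def by blast
  then show ?thesis using u(1) \<open>u \<noteq> 0\<close> compact_sub[OF u(1)] by blast
qed

end

section \<open>Scalar-valued measures\<close>

lemma space_borel_of [simp]: "space (borel_of \<tau>) = topspace \<tau>"
  unfolding borel_of_def by (simp add: space_measure_of_conv)

lemma openin_sets_borel_of: "openin \<tau> U \<Longrightarrow> U \<in> sets (borel_of \<tau>)"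
  unfolding borel_of_def using openin_subset by (auto simp: sets_measure_of_conv)

lemma closedin_sets_borel_of:
  assumes "closedin \<tau> C"
  shows "C \<in> sets (borel_of \<tau>)"
proof -
  have "topspace \<tau> - C \<in> sets (borel_of \<tau>)" using assms by (auto simp: closedin_def intro: openin_sets_borel_of)
  then have "space (borel_of \<tau>) - (topspace \<tau> - C) \<in> sets (borel_of \<tau>)" by (rule sets.compl_sets)
  moreover have "space (borel_of \<tau>) - (topspace \<tau> - C) = C" using closedin_subset[OF assms] by auto
  ultimately show ?thesis by simp
qed

lemma continuous_map_measurable_borel_of:
  assumes "continuous_map \<tau> euclidean f"
  shows "f \<in> borel_measurable (borel_of \<tau>)"
proof (rule borel_measurableI)
  fix S :: "'b set" assume "open S"
  then have "openin \<tau> {x \<in> topspace \<tau>. f x \<in> S}"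
    using openin_continuous_map_preimage[OF assms] by simp
  moreover have "{x \<in> topspace \<tau>. f x \<in> S} = f -` S \<inter> space (borel_of \<tau>)" by auto
  ultimately show "f -` S \<inter> space (borel_of \<tau>) \<in> sets (borel_of \<tau>)" using openin_sets_borel_of by metis
qed

lemma ennreal_norm_sums_le:
  fixes f :: "nat \<Rightarrow> 'k::real_normed_vector"
  assumes "f sums s"
  shows "ennreal (norm s) \<le> (\<Sum>i. ennreal (norm (f i)))"
proof (rule LIMSEQ_le_const2)
  show "(\<lambda>n. ennreal (norm (\<Sum>i<n. f i))) \<longlonglongrightarrow> ennreal (norm s)"
    using assms unfolding sums_def by (intro tendsto_ennrealI tendsto_norm)
  have "ennreal (norm (\<Sum>i<n. f i)) \<le> (\<Sum>i. ennreal (norm (f i)))" for n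
  proof -
    have "ennreal (norm (\<Sum>i<n. f i)) \<le> ennreal (\<Sum>i<n. norm (f i))" by (intro ennreal_leI norm_sum)
    also have "\<dots> = (\<Sum>i<n. ennreal (norm (f i)))" by simp
    also have "\<dots> \<le> (\<Sum>i. ennreal (norm (f i)))" by (intro sum_le_suminf) auto
    finally show ?thesis .
  qed
  then show "\<exists>N. \<forall>n\<ge>N. ennreal (norm (\<Sum>i<n. f i)) \<le> (\<Sum>i. ennreal (norm (f i)))" by blast
qed

lemma AE_nonneg_of_set_integrals:
  fixes f :: "'a \<Rightarrow> real"
  assumes f: "integrable M f" and nn: "\<And>A. A \<in> sets M \<Longrightarrow> 0 \<le> (LINT x|M. indicator A x *\<^sub>R f x)"
  shows "AE x in M. 0 \<le> f x"
proof -
  have [measurable]: "f \<in> borel_measurable M" using f by auto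
  define A where "A = {x \<in> space M. f x < 0}"
  have A[measurable]: "A \<in> sets M" unfolding A_def by measurable
  have int: "integrable M (\<lambda>x. - (indicator A x *\<^sub>R f x))"
    using integrable_mult_indicator[OF A f] by simp
  have "AE x in M. 0 \<le> - (indicator A x *\<^sub>R f x)" by (auto simp: A_def indicator_def)
  moreover from integral_nonneg_AE[OF this] have "(LINT x|M. - (indicator A x *\<^sub>R f x)) = 0"
    using nn[OF A] by simp
  ultimately have "AE x in M. - (indicator A x *\<^sub>R f x) = 0"
    using integral_nonneg_eq_0_iff_AE[OF int] by simp
  then show ?thesis
  proof (rule AE_mp, intro AE_I2 impI)
    fix x assume "x \<in> space M" "- (indicator A x *\<^sub>R f x) = 0"
    then show "0 \<le> f x" by (cases "x \<in> A") (auto simp: A_def)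
  qed
qed

locale scalar_measure_on =
  fixes \<tau> :: "'p topology" and \<mu> :: "'p set \<Rightarrow> 'k::rc_field"
  assumes scalar_measure: "scalar_measure \<tau> \<mu>"
begin

abbreviation "\<B> \<equiv> sets (borel_of \<tau>)"
abbreviation "V \<equiv> variation \<tau> \<mu>"

lemma sums: "range A \<subseteq> \<B> \<Longrightarrow> disjoint_family A \<Longrightarrow> (\<lambda>n. \<mu> (A n)) sums \<mu> (\<Union>n. A n)"
  for A :: "nat \<Rightarrow> 'p set"
  using scalar_measure by (simp add: scalar_measure_def)

lemma empty [simp]: "\<mu> {} = 0"
proof -
  have "(\<lambda>n::nat. \<mu> {}) sums \<mu> {}" using sums[of "\<lambda>_. {}"] by (simp add: disjoint_family_on_def)
  then show ?thesis using summable_const_iff sums_summable by blast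
qed

lemma Un:
  assumes "A \<in> \<B>" "B \<in> \<B>" "A \<inter> B = {}"
  shows "\<mu> (A \<union> B) = \<mu> A + \<mu> B"
proof -
  have "(\<lambda>n. \<mu> (binaryset A B n)) sums \<mu> (\<Union>n. binaryset A B n)"
    using assms by (intro sums) (auto simp: range_binaryset_eq disjoint_family_on_def binaryset_def)
  then have 1: "(\<lambda>n. \<mu> (binaryset A B n)) sums \<mu> (A \<union> B)" by (simp only: UN_binaryset_eq)
  have 2: "(\<lambda>n. \<mu> (binaryset A B n)) sums (\<Sum>n<2. \<mu> (binaryset A B n))"
    by (rule sums_finite) (auto simp: binaryset_def)
  have "(\<Sum>n<2. \<mu> (binaryset A B n)) = \<mu> A + \<mu> B"
    by (simp add: numeral_2_eq_2 lessThan_Suc binaryset_def add.commute)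
  then show ?thesis using sums_unique2[OF 1 2] by simp
qed

lemma Union:
  assumes "finite P" "disjoint P" "P \<subseteq> \<B>"
  shows "\<mu> (\<Union>P) = sum \<mu> P"
  using assms
proof (induction P rule: finite_induct)
  case (insert A P)
  have "A \<inter> B = {}" if "B \<in> P" for B
    using disjointD[OF insert.prems(1), of A B] insert.hyps(2) that by blast
  then have "A \<inter> \<Union>P = {}" by blast
  moreover have "\<Union>P \<in> \<B>" using insert by (intro sets.finite_Union) auto
  moreover have "disjoint P" using insert.prems by (simp add: disjoint_def)
  ultimately show ?case using insert by (simp add: Un)
qed simp

lemma variation_ge:
  "finite P \<Longrightarrow> disjoint P \<Longrightarrow> P \<subseteq> \<B> \<Longrightarrow> \<Union>P = E \<Longrightarrow> (\<Sum>A\<in>P. ennreal (norm (\<mu> A))) \<le> V E"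
  unfolding variation_def by (rule SUP_upper) simp

text \<open>Partitions are sets of sets, in which repeated members collapse; in a disjoint family
  only the empty set can repeat, and it contributes nothing.\<close>

lemma variation_ge_indexed:
  assumes fin: "finite I" and D: "\<And>i. i \<in> I \<Longrightarrow> D i \<in> \<B>" "disjoint_family_on D I"
  shows "(\<Sum>i\<in>I. ennreal (norm (\<mu> (D i)))) \<le> V (\<Union>i\<in>I. D i)"
proof -
  define I' where "I' = {i \<in> I. D i \<noteq> {}}"
  have inj: "inj_on D I'"
    using D(2) unfolding I'_def inj_on_def disjoint_family_on_def by blast
  have "(\<Sum>i\<in>I. ennreal (norm (\<mu> (D i)))) = (\<Sum>i\<in>I'. ennreal (norm (\<mu> (D i))))"
    using fin by (intro sum.mono_neutral_right) (auto simp: I'_def)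
  also have "\<dots> = (\<Sum>A\<in>D ` I'. ennreal (norm (\<mu> A)))" by (simp add: sum.reindex[OF inj])
  also have "\<dots> \<le> V (\<Union>i\<in>I. D i)"
  proof (rule variation_ge)
    show "disjoint (D ` I')"
    proof (rule disjointI)
      fix a b assume "a \<in> D ` I'" "b \<in> D ` I'" "a \<noteq> b"
      then obtain i j where "i \<in> I" "j \<in> I" "i \<noteq> j" "a = D i" "b = D j" by (auto simp: I'_def)
      then show "a \<inter> b = {}" using disjoint_family_onD[OF D(2)] by simp
    qed
  qed (use fin D(1) in \<open>auto simp: I'_def\<close>)
  finally show ?thesis .
qed

lemma norm_le_variation: "A \<in> \<B> \<Longrightarrow> ennreal (norm (\<mu> A)) \<le> V A"
  using variation_ge[of "{A}" A] by (simp add: disjoint_def)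

lemma variation_le:
  "(\<And>P. finite P \<Longrightarrow> disjoint P \<Longrightarrow> P \<subseteq> \<B> \<Longrightarrow> \<Union>P = E \<Longrightarrow> (\<Sum>A\<in>P. ennreal (norm (\<mu> A))) \<le> b) \<Longrightarrow> V E \<le> b"
  unfolding variation_def by (rule SUP_least) simp

lemma variation_empty: "V {} = 0"
proof -
  have "V {} \<le> 0"
  proof (rule variation_le)
    fix P assume "\<Union>P = ({} :: 'p set)"
    then have "(\<Sum>A\<in>P. ennreal (norm (\<mu> A))) = (\<Sum>A\<in>P. 0)" by (intro sum.cong) auto
    then show "(\<Sum>A\<in>P. ennreal (norm (\<mu> A))) \<le> 0" by simp
  qed
  then show ?thesis by simp
qed

lemma variation_superadd:
  assumes A: "A \<in> \<B>" and B: "B \<in> \<B>" and AB: "A \<inter> B = {}"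
  shows "V A + V B \<le> V (A \<union> B)"
proof -
  let ?Q = "\<lambda>E. {P. finite P \<and> disjoint P \<and> P \<subseteq> \<B> \<and> \<Union>P = E}"
  let ?s = "\<lambda>P. \<Sum>A\<in>P. ennreal (norm (\<mu> A))"
  have ne: "?Q A \<noteq> {}" "?Q B \<noteq> {}" 
  proof -
    have Q: "{A} \<in> ?Q A" "{B} \<in> ?Q B" using A B by (simp_all add: disjoint_def)
    show "?Q A \<noteq> {}" by (rule ex_in_conv[THEN iffD1], rule exI, rule Q(1))
    show "?Q B \<noteq> {}" by (rule ex_in_conv[THEN iffD1], rule exI, rule Q(2))
  qed
  have "?s P + ?s P' \<le> V (A \<union> B)" if P: "P \<in> ?Q A" "P' \<in> ?Q B" for P P'
  proof -
    \<comment> \<open>The sum type indexes the two partitions together without identifying common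
      members such as the empty set.\<close>
    have "disjoint_family_on (\<lambda>x. case x of Inl C \<Rightarrow> C | Inr C \<Rightarrow> C) (Inl ` P \<union> Inr ` P')"
      unfolding disjoint_family_on_def
    proof (intro ballI impI)
      have d: "C \<inter> D = {}" if "C \<in> P" "D \<in> P'" for C D
      proof -
        have "C \<subseteq> A" "D \<subseteq> B" using P that by auto
        then show ?thesis using AB by blast
      qed
      fix x y assume "x \<in> Inl ` P \<union> Inr ` P'" "y \<in> Inl ` P \<union> Inr ` P'" "x \<noteq> y"
      then consider C D where "C \<in> P" "D \<in> P" "C \<noteq> D" "x = Inl C" "y = Inl D"
        | C D where "C \<in> P" "D \<in> P'" "x = Inl C" "y = Inr D"
        | C D where "C \<in> P'" "D \<in> P" "x = Inr C" "y = Inl D"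
        | C D where "C \<in> P'" "D \<in> P'" "C \<noteq> D" "x = Inr C" "y = Inr D"
        by (elim UnE imageE) auto
      then show "(case x of Inl C \<Rightarrow> C | Inr C \<Rightarrow> C) \<inter> (case y of Inl C \<Rightarrow> C | Inr C \<Rightarrow> C) = {}"
      proof cases
        case 1 then show ?thesis using disjointD[of P C D] P by simp
      next
        case 2 then show ?thesis using d by simp
      next
        case 3 then show ?thesis using d[of D C] by (simp add: Int_commute)
      next
        case 4 then show ?thesis using disjointD[of P' C D] P by simp
      qed
    qed
    then have "(\<Sum>x\<in>Inl ` P \<union> Inr ` P'. ennreal (norm (\<mu> (case x of Inl C \<Rightarrow> C | Inr C \<Rightarrow> C)))) \<le>
        V (\<Union>x\<in>Inl ` P \<union> Inr ` P'. case x of Inl C \<Rightarrow> C | Inr C \<Rightarrow> C)"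
      using P by (intro variation_ge_indexed) auto
    moreover have "(\<Union>x\<in>Inl ` P \<union> Inr ` P'. case x of Inl C \<Rightarrow> C | Inr C \<Rightarrow> C) = A \<union> B" using P by auto
    moreover have "(\<Sum>x\<in>Inl ` P \<union> Inr ` P'. ennreal (norm (\<mu> (case x of Inl C \<Rightarrow> C | Inr C \<Rightarrow> C)))) = ?s P + ?s P'"
      using P by (subst sum.union_disjoint) (auto simp: sum.reindex)
    ultimately show ?thesis by simp
  qed
  then have "(SUP P'\<in>?Q B. ?s P + ?s P') \<le> V (A \<union> B)" if "P \<in> ?Q A" for P
    using that by (intro SUP_least) auto
  then have "?s P + V B \<le> V (A \<union> B)" if "P \<in> ?Q A" for P
    using that unfolding variation_def ennreal_SUP_add_right[OF ne(2)] by blast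
  then have "(SUP P\<in>?Q A. ?s P + V B) \<le> V (A \<union> B)" by (rule SUP_least)
  then show ?thesis unfolding ennreal_SUP_add_left[OF ne(1)] by (simp add: variation_def[of _ _ A])
qed

lemma variation_mono: "A \<in> \<B> \<Longrightarrow> B \<in> \<B> \<Longrightarrow> A \<subseteq> B \<Longrightarrow> V A \<le> V B"
  using variation_superadd[of A "B - A"] by (simp add: Un_absorb1 add_increasing2 order_trans[rotated])

text \<open>One direction is finite superadditivity; for the other, a partition of the union is
  refined by the sets \<open>A i\<close>.\<close>

lemma variation_UN:
  fixes A :: "nat \<Rightarrow> 'p set"
  assumes A: "range A \<subseteq> \<B>" and disj: "disjoint_family A"
  shows "(\<Sum>i. V (A i)) = V (\<Union>i. A i)"
proof (rule antisym)
  have fin: "(\<Sum>i<n. V (A i)) \<le> V (\<Union>i<n. A i)" for n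
  proof (induction n)
    case (Suc n)
    have "A i \<inter> A n = {}" if "i < n" for i using disjoint_family_onD[OF disj, of i n] that by simp
    then have "(\<Union>i<n. A i) \<inter> A n = {}" by blast
    then have le: "V (\<Union>i<n. A i) + V (A n) \<le> V ((\<Union>i<n. A i) \<union> A n)"
      using A by (intro variation_superadd sets.finite_UN) auto
    have eq: "(\<Union>i<n. A i) \<union> A n = (\<Union>i<Suc n. A i)" by (auto simp: lessThan_Suc)
    have "(\<Sum>i<Suc n. V (A i)) \<le> V (\<Union>i<n. A i) + V (A n)"
      unfolding sum.lessThan_Suc by (rule add_right_mono[OF Suc])
    then show ?case using le unfolding eq by (rule order_trans)
  qed (simp add: variation_empty)
  show "(\<Sum>i. V (A i)) \<le> V (\<Union>i. A i)"
  proof (rule suminf_le_const)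
    show "(\<Sum>i<n. V (A i)) \<le> V (\<Union>i. A i)" for n
    proof (rule order_trans[OF fin])
      show "V (\<Union>i<n. A i) \<le> V (\<Union>i. A i)"
        using A by (intro variation_mono sets.finite_UN sets.countable_UN) auto
    qed
  qed simp
  show "V (\<Union>i. A i) \<le> (\<Sum>i. V (A i))"
  proof (rule variation_le)
    fix P assume P: "finite P" "disjoint P" "P \<subseteq> \<B>" "\<Union>P = (\<Union>i. A i)"
    have "(\<Sum>C\<in>P. ennreal (norm (\<mu> C))) \<le> (\<Sum>C\<in>P. \<Sum>i. ennreal (norm (\<mu> (C \<inter> A i))))"
    proof (rule sum_mono)
      fix C assume C: "C \<in> P"
      have "disjoint_family (\<lambda>i. C \<inter> A i)" by (rule disjoint_family_subset[OF disj]) auto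
      then have "(\<lambda>i. \<mu> (C \<inter> A i)) sums \<mu> (\<Union>i. C \<inter> A i)"
        using P C A by (intro sums) auto
      moreover have "(\<Union>i. C \<inter> A i) = C" using P(4) C by auto
      ultimately show "ennreal (norm (\<mu> C)) \<le> (\<Sum>i. ennreal (norm (\<mu> (C \<inter> A i))))"
        using ennreal_norm_sums_le by metis
    qed
    also have "\<dots> = (\<Sum>i. \<Sum>C\<in>P. ennreal (norm (\<mu> (C \<inter> A i))))"
      by (rule suminf_sum[symmetric]) simp
    also have "\<dots> \<le> (\<Sum>i. V (A i))"
    proof (rule suminf_le)
      fix i
      have "(\<Sum>C\<in>P. ennreal (norm (\<mu> (C \<inter> A i)))) \<le> V (\<Union>C\<in>P. C \<inter> A i)"
        using P A by (intro variation_ge_indexed) (auto simp: disjoint_family_on_def disjoint_def)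
      moreover have "(\<Union>C\<in>P. C \<inter> A i) = A i" using P(4) by auto
      ultimately show "(\<Sum>C\<in>P. ennreal (norm (\<mu> (C \<inter> A i)))) \<le> V (A i)" by simp
    qed simp_all
    finally show "(\<Sum>C\<in>P. ennreal (norm (\<mu> C))) \<le> (\<Sum>i. V (A i))" .
  qed
qed

lemma space_variation_measure [simp]: "space (variation_measure \<tau> \<mu>) = topspace \<tau>"
  unfolding variation_measure_def by (simp add: space_measure_of_conv)

lemma sets_variation_measure [simp, measurable_cong]: "sets (variation_measure \<tau> \<mu>) = \<B>"
proof -
  have "sigma_sets (topspace \<tau>) \<B> = \<B>" using sets.sigma_sets_eq[of "borel_of \<tau>"] by simp
  moreover have "\<B> \<subseteq> Pow (topspace \<tau>)" using sets.space_closed[of "borel_of \<tau>"] by simp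
  ultimately show ?thesis unfolding variation_measure_def by (simp add: sets_measure_of_conv)
qed

lemma emeasure_variation_measure:
  assumes "A \<in> \<B>"
  shows "emeasure (variation_measure \<tau> \<mu>) A = V A"
  unfolding variation_measure_def
proof (rule emeasure_measure_of_sigma)
  show "sigma_algebra (topspace \<tau>) \<B>" using sets.sigma_algebra_axioms[of "borel_of \<tau>"] by simp
  show "countably_additive \<B> V"
    unfolding countably_additive_def using variation_UN by blast
qed (use assms in \<open>auto simp: positive_def variation_empty\<close>)

section \<open>Finiteness of the variation\<close>

text \<open>Infinite variation provides a subset whose value exceeds that of \<open>E\<close> by
  more than 1 in modulus, so its complement in \<open>E\<close> also has value of modulus at least
  1. Either one may be split off, and one of the two still has infinite variation.\<close>

lemma infinite_variation_split:
  assumes E: "E \<in> \<B>" and inf: "V E = top"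
  shows "\<exists>A\<in>\<B>. A \<subseteq> E \<and> V A = top \<and> 1 \<le> norm (\<mu> (E - A))"
proof -
  \<comment> \<open>The factor 4 compensates the loss in \<open>ex_large_subset_sum\<close>.\<close>
  define t where "t = 4 * (1 + norm (\<mu> E))"
  have "ennreal t < V E" using inf by simp
  then obtain P where P: "finite P" "disjoint P" "P \<subseteq> \<B>" "\<Union>P = E" "ennreal t < (\<Sum>A\<in>P. ennreal (norm (\<mu> A)))"
    unfolding variation_def less_SUP_iff by auto
  then have "ennreal t < ennreal (\<Sum>A\<in>P. norm (\<mu> A))" by simp
  moreover have "0 \<le> t" by (simp add: t_def)
  ultimately have "t < (\<Sum>A\<in>P. norm (\<mu> A))" using ennreal_less_iff by blast
  moreover obtain Q where Q: "Q \<subseteq> P" "(\<Sum>A\<in>P. norm (\<mu> A)) \<le> 4 * norm (sum \<mu> Q)"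
    using ex_large_subset_sum[OF P(1)] by blast
  ultimately have gt: "1 + norm (\<mu> E) < norm (sum \<mu> Q)" by (simp add: t_def)
  define A where "A = \<Union>Q"
  have fQ: "finite Q" using Q P finite_subset by blast
  have A: "A \<in> \<B>" "A \<subseteq> E" unfolding A_def using Q P fQ by (auto intro!: sets.finite_Union)
  have "disjoint Q" using P(2) Q(1) by (auto simp: disjoint_def)
  then have \<mu>A: "\<mu> A = sum \<mu> Q" unfolding A_def using fQ Q(1) P(3) by (intro Union) auto
  have "\<mu> E = \<mu> A + \<mu> (E - A)" using Un[of A "E - A"] A E by (simp add: Un_absorb1)
  then have "norm (\<mu> A) \<le> norm (\<mu> E) + norm (\<mu> (E - A))"
    using norm_triangle_ineq4[of "\<mu> E" "\<mu> (E - A)"] by simp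
  then have big: "1 \<le> norm (\<mu> A)" "1 \<le> norm (\<mu> (E - A))" using gt norm_ge_zero[of "\<mu> E"] unfolding \<mu>A[symmetric] by - linarith+
  have "V E = V A + V (E - A)"
  proof -
    have bs: "range (binaryset A (E - A)) \<subseteq> \<B>" "disjoint_family (binaryset A (E - A))"
      using A E by (auto simp: range_binaryset_eq disjoint_family_on_def binaryset_def)
    have "(\<lambda>n. V (binaryset A (E - A) n)) sums (\<Sum>n<2. V (binaryset A (E - A) n))"
      by (rule sums_finite) (auto simp: binaryset_def variation_empty)
    then show ?thesis using variation_UN[OF bs] A(2)
      by (simp add: sums_iff UN_binaryset_eq binaryset_def lessThan_nat_numeral lessThan_Suc Un_absorb1 add.commute)
  qed
  then consider "V A = top" | "V (E - A) = top" using inf by (metis ennreal_add_eq_top)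
  then show ?thesis
  proof cases
    case 1
    then show ?thesis using A big by blast
  next
    case 2
    have "E - (E - A) = A" using A by auto
    then show ?thesis using 2 A E big by (intro bexI[of _ "E - A"]) auto
  qed
qed

text \<open>Repeated splitting produces disjoint pieces with values of modulus at least 1, and these
  cannot form a convergent series.\<close>

lemma variation_finite: "V (topspace \<tau>) \<noteq> top"
proof
  assume inf: "V (topspace \<tau>) = top"
  have top: "topspace \<tau> \<in> \<B>" using sets.top[of "borel_of \<tau>"] by simp
  have "\<exists>B. \<forall>n. (B n \<in> \<B> \<and> V (B n) = top) \<and> (B (Suc n) \<subseteq> B n \<and> 1 \<le> norm (\<mu> (B n - B (Suc n))))"
  proof (rule dependent_nat_choice)
    show "\<exists>B. B \<in> \<B> \<and> V B = top" using inf top by blast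
  qed (use infinite_variation_split in blast)
  then obtain B where B: "\<And>n. B n \<in> \<B>" "\<And>n. B (Suc n) \<subseteq> B n" "\<And>n. 1 \<le> norm (\<mu> (B n - B (Suc n)))"
    by blast
  have anti: "B m \<subseteq> B n" if "n \<le> m" for n m
    using that by (induction rule: dec_induct) (use B(2) in auto)
  have "disjoint_family (\<lambda>n. B n - B (Suc n))"
    unfolding disjoint_family_on_def
  proof (intro ballI impI)
    fix m n :: nat assume "m \<noteq> n"
    then consider "Suc m \<le> n" | "Suc n \<le> m" by linarith
    then show "(B m - B (Suc m)) \<inter> (B n - B (Suc n)) = {}"
      by cases (use anti in blast)+
  qed
  then have "(\<lambda>n. \<mu> (B n - B (Suc n))) sums \<mu> (\<Union>n. B n - B (Suc n))"
    using B(1) by (intro sums) auto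
  then have "(\<lambda>n. \<mu> (B n - B (Suc n))) \<longlonglongrightarrow> 0" using sums_summable summable_LIMSEQ_zero by blast
  then have "\<forall>\<^sub>F n in sequentially. norm (\<mu> (B n - B (Suc n))) < 1"
    using tendsto_norm_zero order_tendstoD(2) by (metis zero_less_one)
  then obtain n where "norm (\<mu> (B n - B (Suc n))) < 1" by (auto simp: eventually_sequentially)
  then show False using B(3)[of n] by simp
qed

lemma finite_measure_variation: "finite_measure (variation_measure \<tau> \<mu>)"
  using variation_finite sets.top[of "borel_of \<tau>"]
  by (intro finite_measureI) (simp add: emeasure_variation_measure)

lemma measure_variation:
  "A \<in> \<B> \<Longrightarrow> norm (\<mu> A) \<le> measure (variation_measure \<tau> \<mu>) A"
  using norm_le_variation[of A] finite_measure.emeasure_eq_measure[OF finite_measure_variation, of A]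
  by (simp add: emeasure_variation_measure)

section \<open>The polar decomposition\<close>

text \<open>The variation dominates the real set function, so adding it gives a positive measure to
  which Radon-Nikodym applies; the density is then too large by 1.\<close>

lemma real_density:
  fixes c :: 'k
  assumes c: "norm c \<le> 1"
  defines "M \<equiv> variation_measure \<tau> \<mu>"
  shows "\<exists>f. integrable M f \<and> (\<forall>A\<in>\<B>. (LINT x|M. indicator A x *\<^sub>R f x) = re_part (c * \<mu> A))"
proof -
  interpret M: finite_measure M unfolding M_def by (rule finite_measure_variation)
  have setsM [simp]: "sets M = \<B>" and spM [simp]: "space M = topspace \<tau>" by (simp_all add: M_def)
  define r where "r A = re_part (c * \<mu> A) + measure M A" for A
  have le: "\<bar>re_part (c * \<mu> A)\<bar> \<le> measure M A" if "A \<in> \<B>" for A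
  proof -
    have "norm (c * \<mu> A) \<le> 1 * norm (\<mu> A)" unfolding norm_mult using c by (intro mult_right_mono) auto
    then show ?thesis using abs_re_part_le[of "c * \<mu> A"] measure_variation[OF that] by (simp add: M_def)
  qed
  have r0: "0 \<le> r A" if "A \<in> \<B>" for A using le[OF that] by (simp add: r_def abs_le_iff)
  define N where "N = measure_of (topspace \<tau>) \<B> (\<lambda>A. ennreal (r A))"
  have setsN [simp]: "sets N = \<B>" "space N = topspace \<tau>"
    using sets.sigma_sets_eq[of "borel_of \<tau>"] sets.space_closed[of "borel_of \<tau>"]
    by (auto simp: N_def sets_measure_of_conv space_measure_of_conv)
  have emN: "emeasure N A = ennreal (r A)" if "A \<in> \<B>" for A
    unfolding N_def
  proof (rule emeasure_measure_of_sigma[OF _ _ _ that])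
    show "sigma_algebra (topspace \<tau>) \<B>" using sets.sigma_algebra_axioms[of "borel_of \<tau>"] by simp
    show "positive \<B> (\<lambda>A. ennreal (r A))" by (simp add: positive_def r_def)
    show "countably_additive \<B> (\<lambda>A. ennreal (r A))"
      unfolding countably_additive_def
    proof (intro allI impI)
      fix A :: "nat \<Rightarrow> 'p set" assume A: "range A \<subseteq> \<B>" "disjoint_family A" "\<Union>(range A) \<in> \<B>"
      have "(\<lambda>n. re_part (c * \<mu> (A n)) + measure M (A n)) sums (re_part (c * \<mu> (\<Union>n. A n)) + measure M (\<Union>n. A n))"
        using A by (intro sums_add bounded_linear.sums[OF bounded_linear_re_part] sums_mult sums M.finite_measure_UNION) auto
      then have "(\<lambda>n. r (A n)) sums r (\<Union>n. A n)" by (simp add: r_def)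
      then show "(\<Sum>n. ennreal (r (A n))) = ennreal (r (\<Union>(range A)))"
        using r0 A(1) by (intro suminf_ennreal_eq) auto
    qed
  qed
  have "absolutely_continuous M N"
  proof (unfold absolutely_continuous_def, rule subsetI)
    fix A assume "A \<in> null_sets M"
    then have A: "A \<in> \<B>" "measure M A = 0" by (auto simp: null_sets_def measure_def)
    then have "r A = 0" using le[OF A(1)] by (simp add: r_def)
    then show "A \<in> null_sets N" using A emN[OF A(1)] by (auto simp: null_sets_def)
  qed
  then obtain f where f: "f \<in> borel_measurable M" "density M f = N"
    using M.Radon_Nikodym[of N] by auto
  have nn: "(\<integral>\<^sup>+x. f x * indicator A x \<partial>M) = ennreal (r A)" if "A \<in> \<B>" for A
    using emeasure_density[OF f(1), of A] emN[OF that] that f(2) by simp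
  have fin: "AE x in M. f x \<noteq> \<infinity>"
  proof (rule nn_integral_PInf_AE[OF f(1)])
    have "(\<integral>\<^sup>+x. f x \<partial>M) = (\<integral>\<^sup>+x. f x * indicator (topspace \<tau>) x \<partial>M)" by (intro nn_integral_cong) simp
    also have "\<dots> = ennreal (r (topspace \<tau>))" using sets.top[of "borel_of \<tau>"] by (intro nn) simp
    finally show "(\<integral>\<^sup>+x. f x \<partial>M) \<noteq> \<infinity>" by simp
  qed
  have nn': "(\<integral>\<^sup>+x. ennreal (indicator A x *\<^sub>R enn2real (f x)) \<partial>M) = ennreal (r A)" if A: "A \<in> \<B>" for A
  proof -
    have "(\<integral>\<^sup>+x. ennreal (indicator A x *\<^sub>R enn2real (f x)) \<partial>M) = (\<integral>\<^sup>+x. f x * indicator A x \<partial>M)"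
    proof (rule nn_integral_cong_AE, rule AE_mp[OF fin], intro AE_I2 impI)
      fix x assume "f x \<noteq> \<infinity>"
      then show "ennreal (indicator A x *\<^sub>R enn2real (f x)) = f x * indicator A x"
        by (auto simp: indicator_def ennreal_enn2real_if)
    qed
    then show ?thesis using nn[OF A] by simp
  qed
  have fm: "(\<lambda>x. enn2real (f x)) \<in> borel_measurable M" using f(1) by measurable
  have int: "integrable M (\<lambda>x. enn2real (f x))"
  proof (rule integrableI_nonneg[OF fm])
    have "(\<integral>\<^sup>+x. ennreal (enn2real (f x)) \<partial>M) =
        (\<integral>\<^sup>+x. ennreal (indicator (topspace \<tau>) x *\<^sub>R enn2real (f x)) \<partial>M)" by (intro nn_integral_cong) simp
    also have "\<dots> = ennreal (r (topspace \<tau>))" using sets.top[of "borel_of \<tau>"] by (intro nn') simp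
    finally show "(\<integral>\<^sup>+x. ennreal (enn2real (f x)) \<partial>M) < \<infinity>" by simp
  qed simp
  have "(LINT x|M. indicator A x *\<^sub>R (enn2real (f x) - 1)) = re_part (c * \<mu> A)" if A: "A \<in> \<B>" for A
  proof -
    have i1: "integrable M (\<lambda>x. indicator A x *\<^sub>R enn2real (f x))"
      using A int by (intro integrable_mult_indicator) auto
    have i2: "integrable M (\<lambda>x. indicator A x :: real)" 
    proof (rule M.integrable_const_bound[of _ 1])
      show "(\<lambda>x. indicator A x :: real) \<in> borel_measurable M" using A by (intro borel_measurable_indicator) simp
    qed auto
    have "(LINT x|M. indicator A x *\<^sub>R enn2real (f x)) = enn2real (ennreal (r A))"
      unfolding nn'[OF A, symmetric] by (rule integral_eq_nn_integral) (use i1 in auto)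
    then have "(LINT x|M. indicator A x *\<^sub>R enn2real (f x)) = r A" using r0[OF A] by simp
    moreover have "(LINT x|M. indicator A x *\<^sub>R (enn2real (f x) - 1)) =
        (LINT x|M. indicator A x *\<^sub>R enn2real (f x)) - (LINT x|M. indicator A x :: real)"
      using Bochner_Integration.integral_diff[OF i1 i2] by (simp add: right_diff_distrib)
    moreover have "A \<inter> topspace \<tau> = A" using sets.sets_into_space[OF A] by auto
    ultimately show ?thesis using A by (simp add: r_def)
  qed
  moreover have "integrable M (\<lambda>x. enn2real (f x) - 1)" using int by simp
  ultimately show ?thesis by blast
qed


lemma scalar_density:
  defines "M \<equiv> variation_measure \<tau> \<mu>"
  shows "\<exists>h :: 'p \<Rightarrow> 'k. integrable M h \<and> (\<forall>A\<in>\<B>. (LINT x|M. indicator A x *\<^sub>R h x) = \<mu> A)"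
proof -
  obtain f where f: "integrable M f" "\<And>A. A \<in> \<B> \<Longrightarrow> (LINT x|M. indicator A x *\<^sub>R f x) = re_part (1 * \<mu> A)"
    using real_density[of 1] unfolding M_def by auto
  obtain g where g: "integrable M g" "\<And>A. A \<in> \<B> \<Longrightarrow> (LINT x|M. indicator A x *\<^sub>R g x) = re_part (neg_i * \<mu> A)"
    using real_density[OF norm_neg_i] unfolding M_def by auto
  have int: "integrable M (\<lambda>x. of_real (f x) - neg_i * of_real (g x) :: 'k)"
    by (intro Bochner_Integration.integrable_diff integrable_mult_right integrable_of_real f g)
  have "(LINT x|M. indicator A x *\<^sub>R (of_real (f x) - neg_i * of_real (g x))) = \<mu> A" if A: "A \<in> \<B>" for A
  proof -
    have A': "A \<in> sets M" using A by (simp add: M_def)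
    have i: "integrable M (\<lambda>x. indicator A x *\<^sub>R f x)" "integrable M (\<lambda>x. indicator A x *\<^sub>R g x)"
      by (rule integrable_mult_indicator[OF A' f(1)]) (rule integrable_mult_indicator[OF A' g(1)])
    have "(\<lambda>x. indicator A x *\<^sub>R (of_real (f x) - neg_i * of_real (g x)) :: 'k) =
        (\<lambda>x. of_real (indicator A x *\<^sub>R f x) - neg_i * of_real (indicator A x *\<^sub>R g x))"
      by (auto simp: indicator_def)
    then have "(LINT x|M. indicator A x *\<^sub>R (of_real (f x) - neg_i * of_real (g x)) :: 'k) =
        (LINT x|M. of_real (indicator A x *\<^sub>R f x) - neg_i * of_real (indicator A x *\<^sub>R g x))" by (rule arg_cong)
    also have "\<dots> = (LINT x|M. of_real (indicator A x *\<^sub>R f x)) - (LINT x|M. neg_i * of_real (indicator A x *\<^sub>R g x))"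
      by (intro Bochner_Integration.integral_diff integrable_mult_right integrable_of_real i)
    also have "\<dots> = of_real (re_part (1 * \<mu> A)) - neg_i * of_real (re_part (neg_i * \<mu> A))"
      by (simp only: integral_mult_right_zero integral_of_real[OF i(1)] integral_of_real[OF i(2)] f(2)[OF A] g(2)[OF A])
    also have "\<dots> = of_real (re_part (\<mu> A)) - neg_i * of_real (re_part (neg_i * \<mu> A))" by simp
    finally show ?thesis by (simp only: neg_i_decomp)
  qed
  then show ?thesis using int by blast
qed

text \<open>The integral of \<open>norm (h x)\<close> over a set bounds its variation, hence the
  modulus is at least 1 almost everywhere. Conversely the measure of a set bounds the modulus of its
  value, which gives \<open>re_part (d * h x) \<le> norm d\<close> almost everywhere for each fixed
  \<open>d\<close>.\<close>

lemma norm_scalar_density: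
  fixes h :: "'p \<Rightarrow> 'k"
  defines "M \<equiv> variation_measure \<tau> \<mu>"
  assumes h: "integrable M h" and eq: "\<And>A. A \<in> \<B> \<Longrightarrow> (LINT x|M. indicator A x *\<^sub>R h x) = \<mu> A"
  shows "AE x in M. norm (h x) = 1"
proof -
  interpret M: finite_measure M unfolding M_def by (rule finite_measure_variation)
  have setsM [simp]: "sets M = \<B>" by (simp add: M_def)
  have ind: "integrable M (\<lambda>x. indicator A x *\<^sub>R f x)" if "integrable M f" "A \<in> \<B>"
    for A and f :: "'p \<Rightarrow> 'v::{banach, second_countable_topology}"
    using that by (intro integrable_mult_indicator) auto
  have "AE x in M. 0 \<le> norm (h x) - 1"
  proof (rule AE_nonneg_of_set_integrals)
    show "integrable M (\<lambda>x. norm (h x) - 1)" using h by (intro Bochner_Integration.integrable_diff) auto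
    fix A assume "A \<in> sets M"
    then have A: "A \<in> \<B>" by simp
    have nn: "0 \<le> (LINT x|M. indicator A x *\<^sub>R norm (h x))"
      by (rule Bochner_Integration.integral_nonneg) (simp add: indicator_def)
    have "V A \<le> ennreal (LINT x|M. indicator A x *\<^sub>R norm (h x))"
    proof (rule variation_le)
      fix P assume P: "finite P" "disjoint P" "P \<subseteq> \<B>" "\<Union>P = A"
      have "norm (\<mu> C) \<le> (LINT x|M. indicator C x *\<^sub>R norm (h x))" if "C \<in> P" for C
      proof -
        have "norm (\<mu> C) \<le> (LINT x|M. norm (indicator C x *\<^sub>R h x))"
          using eq[of C] that P integral_norm_bound[of M "\<lambda>x. indicator C x *\<^sub>R h x"] by auto
        then show ?thesis by simp
      qed
      then have "(\<Sum>C\<in>P. norm (\<mu> C)) \<le> (\<Sum>C\<in>P. LINT x|M. indicator C x *\<^sub>R norm (h x))" by (rule sum_mono)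
      also have "\<dots> = (LINT x|M. (\<Sum>C\<in>P. indicator C x *\<^sub>R norm (h x)))"
        using P h by (intro Bochner_Integration.integral_sum[symmetric] ind) auto
      also have "(\<lambda>x. \<Sum>C\<in>P. indicator C x *\<^sub>R norm (h x)) = (\<lambda>x. indicator A x *\<^sub>R norm (h x))"
      proof
        fix x
        show "(\<Sum>C\<in>P. indicator C x *\<^sub>R norm (h x)) = indicator A x *\<^sub>R norm (h x)"
        proof (cases "x \<in> A")
          case True
          then obtain C where C: "C \<in> P" "x \<in> C" using P(4) by auto
          have "indicator D x *\<^sub>R norm (h x) = 0" if "D \<in> P - {C}" for D
            using disjointD[OF P(2), of C D] C that by (auto simp: indicator_def)
          then have "(\<Sum>D\<in>P - {C}. indicator D x *\<^sub>R norm (h x)) = 0" by (intro sum.neutral) blast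
          then show ?thesis using C True by (simp add: sum.remove[OF P(1) C(1)])
        next
          case False
          then show ?thesis using P(4) by (auto intro!: sum.neutral)
        qed
      qed
      finally have "ennreal (\<Sum>C\<in>P. norm (\<mu> C)) \<le> ennreal (LINT x|M. indicator A x *\<^sub>R norm (h x))"
        by (rule ennreal_leI)
      then show "(\<Sum>C\<in>P. ennreal (norm (\<mu> C))) \<le> ennreal (LINT x|M. indicator A x *\<^sub>R norm (h x))"
        by (simp only: sum_ennreal norm_ge_zero)
    qed
    moreover have "V A = ennreal (measure M A)"
      using emeasure_variation_measure[OF A] unfolding M_def[symmetric] M.emeasure_eq_measure ..
    ultimately have "ennreal (measure M A) \<le> ennreal (LINT x|M. indicator A x *\<^sub>R norm (h x))" by (simp only:)
    then have "measure M A \<le> (LINT x|M. indicator A x *\<^sub>R norm (h x))" using ennreal_le_iff[OF nn] by blast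
    moreover have "(LINT x|M. indicator A x *\<^sub>R (norm (h x) - 1)) =
        (LINT x|M. indicator A x *\<^sub>R norm (h x)) - measure M A"
      using Bochner_Integration.integral_diff[OF ind[OF integrable_norm[OF h] A] ind[OF _ A, of "\<lambda>_. 1 :: real"]] A
      by (simp add: right_diff_distrib)
    ultimately show "0 \<le> (LINT x|M. indicator A x *\<^sub>R (norm (h x) - 1))" by simp
  qed
  moreover have "AE x in M. re_part (d * h x) \<le> norm d" for d :: 'k
  proof -
    have int: "integrable M (\<lambda>x. re_part (d * h x))"
      using integrable_bounded_linear[OF bounded_linear_re_part integrable_mult_right[OF h, of d]] by simp
    have "AE x in M. 0 \<le> norm d - re_part (d * h x)"
    proof (rule AE_nonneg_of_set_integrals)
      show "integrable M (\<lambda>x. norm d - re_part (d * h x))" using int by simp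
      fix A assume "A \<in> sets M"
      then have A: "A \<in> \<B>" by simp
      have "(LINT x|M. indicator A x *\<^sub>R re_part (d * h x)) = (LINT x|M. re_part (d * (indicator A x *\<^sub>R h x)))"
        by (intro Bochner_Integration.integral_cong) (auto simp: indicator_def)
      also have "\<dots> = re_part (LINT x|M. d * (indicator A x *\<^sub>R h x))"
        by (rule integral_bounded_linear[OF bounded_linear_re_part integrable_mult_right[OF ind[OF h A], of d]])
      also have "\<dots> = re_part (d * \<mu> A)" by (simp only: integral_mult_right_zero eq[OF A])
      finally have 1: "(LINT x|M. indicator A x *\<^sub>R re_part (d * h x)) = re_part (d * \<mu> A)" .
      have "re_part (d * \<mu> A) \<le> norm d * norm (\<mu> A)" using re_part_le_norm[of "d * \<mu> A"] by (simp add: norm_mult)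
      also have "\<dots> \<le> norm d * measure M A"
        using measure_variation[OF A] by (intro mult_left_mono) (auto simp: M_def)
      finally have "re_part (d * \<mu> A) \<le> norm d * measure M A" .
      moreover have "(LINT x|M. indicator A x *\<^sub>R (norm d - re_part (d * h x))) = norm d * measure M A - re_part (d * \<mu> A)"
        using Bochner_Integration.integral_diff[OF ind[OF _ A, of "\<lambda>_. norm d"] ind[OF int A]] A 1
        by (simp add: right_diff_distrib mult.commute)
      ultimately show "0 \<le> (LINT x|M. indicator A x *\<^sub>R (norm d - re_part (d * h x)))" by simp
    qed
    then show ?thesis by simp
  qed
  \<comment> \<open>Every \<open>d\<close> has its own null set; countably many of them can be
    discarded together.\<close>
  moreover obtain D :: "'k set" where D: "countable D" "\<And>X. open X \<Longrightarrow> X \<noteq> {} \<Longrightarrow> \<exists>d\<in>D. d \<in> X"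
    by (rule countable_dense_setE) blast
  ultimately have "AE x in M. 0 \<le> norm (h x) - 1 \<and> (\<forall>d\<in>D. re_part (d * h x) \<le> norm d)"
    by (simp add: AE_ball_countable)
  then show ?thesis
  proof (rule AE_mp, intro AE_I2 impI)
    fix x assume x: "0 \<le> norm (h x) - 1 \<and> (\<forall>d\<in>D. re_part (d * h x) \<le> norm d)"
    obtain c where c: "norm c = 1" "c * h x = of_real (norm (h x))" using ex_rotation by blast
    have "norm (h x) \<le> 1"
    proof (rule field_le_epsilon)
      fix e :: real assume e: "0 < e"
      \<comment> \<open>Replacing the rotation \<open>c\<close> by a nearby \<open>d\<close> costs
        at most \<open>r\<close> in \<open>norm d\<close> and \<open>r * norm (h x)\<close> in the
        product, \<open>e\<close> in all.\<close>
      define r where "r = e / (norm (h x) + 1)"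
      have r: "0 < r" using e by (simp add: r_def add_nonneg_pos)
      have re: "r * (norm (h x) + 1) = e"
        using add_nonneg_pos[OF norm_ge_zero[of "h x"] zero_less_one] by (simp add: r_def)
      obtain d where d: "d \<in> D" "dist c d < r" using D(2)[of "ball c r"] r by auto
      have "norm (h x) = re_part (d * h x) + re_part ((c - d) * h x)"
        using c(2) by (simp flip: re_part_add distrib_right)
      also have "\<dots> \<le> norm d + norm ((c - d) * h x)" using x d(1) re_part_le_norm by (intro add_mono) auto
      also have "norm d \<le> 1 + r" using norm_triangle_ineq2[of d c] c(1) d(2) by (simp add: dist_norm norm_minus_commute)
      also have "norm ((c - d) * h x) \<le> r * norm (h x)"
        unfolding norm_mult using d(2) by (intro mult_right_mono) (auto simp: dist_norm)
      finally have "norm (h x) \<le> 1 + r + r * norm (h x)" by simp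
      then show "norm (h x) \<le> 1 + e" using re by (simp add: distrib_left)
    qed
    then show "norm (h x) = 1" using x by simp
  qed
qed

lemma polar_density_props:
  "polar_density \<tau> \<mu> \<in> borel_measurable (borel_of \<tau>)"
  "\<And>p. p \<in> topspace \<tau> \<Longrightarrow> norm (polar_density \<tau> \<mu> p) = 1"
  "\<And>A. A \<in> \<B> \<Longrightarrow> \<mu> A = (LINT p|variation_measure \<tau> \<mu>. indicator A p *\<^sub>R polar_density \<tau> \<mu> p)"
proof -
  let ?M = "variation_measure \<tau> \<mu>"
  obtain h :: "'p \<Rightarrow> 'k" where h: "integrable ?M h" "\<And>A. A \<in> \<B> \<Longrightarrow> (LINT x|?M. indicator A x *\<^sub>R h x) = \<mu> A"
    using scalar_density by blast
  have hm: "h \<in> borel_measurable (borel_of \<tau>)"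
    using borel_measurable_integrable[OF h(1)] by (simp cong: measurable_cong_sets)
  \<comment> \<open>The density has modulus 1 almost everywhere; the value 1 on the exceptional set
    gives it everywhere.\<close>
  define g where "g x = (if norm (h x) = 1 then h x else 1)" for x
  have gm: "g \<in> borel_measurable (borel_of \<tau>)" unfolding g_def using hm by measurable
  have gM: "g \<in> borel_measurable ?M" using gm by (simp cong: measurable_cong_sets)
  have "AE x in ?M. norm (h x) = 1" by (rule norm_scalar_density[OF h(1)]) (rule h(2))
  then have "AE x in ?M. g x = h x" by eventually_elim (simp add: g_def)
  have "\<mu> A = (LINT p|?M. indicator A p *\<^sub>R g p)" if A: "A \<in> \<B>" for A
  proof -
    have "(LINT p|?M. indicator A p *\<^sub>R g p) = (LINT p|?M. indicator A p *\<^sub>R h p)"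
    proof (rule integral_cong_AE)
      show "AE x in ?M. indicator A x *\<^sub>R g x = indicator A x *\<^sub>R h x"
        using \<open>AE x in ?M. g x = h x\<close> by eventually_elim simp
    qed (use A gM h(1) in auto)
    then show ?thesis using h(2)[OF A] by simp
  qed
  then have "\<exists>h. h \<in> borel_measurable (borel_of \<tau>) \<and> (\<forall>p\<in>topspace \<tau>. norm (h p) = 1) \<and>
     (\<forall>E\<in>\<B>. \<mu> E = (LINT p|?M. indicator E p *\<^sub>R h p))"
    using gm by (intro exI[of _ g]) (auto simp: g_def)
  from someI_ex[OF this, folded polar_density_def]
  show "polar_density \<tau> \<mu> \<in> borel_measurable (borel_of \<tau>)"
    "\<And>p. p \<in> topspace \<tau> \<Longrightarrow> norm (polar_density \<tau> \<mu> p) = 1"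
    "\<And>A. A \<in> \<B> \<Longrightarrow> \<mu> A = (LINT p|?M. indicator A p *\<^sub>R polar_density \<tau> \<mu> p)" by blast+
qed

context
  fixes f :: "'p \<Rightarrow> 'k" and B :: real
  assumes f: "f \<in> borel_measurable (borel_of \<tau>)" and f_le: "\<And>p. p \<in> topspace \<tau> \<Longrightarrow> norm (f p) \<le> B"
begin

lemma integrable_polar: "integrable (variation_measure \<tau> \<mu>) (\<lambda>p. f p * polar_density \<tau> \<mu> p)"
proof -
  interpret M: finite_measure "variation_measure \<tau> \<mu>" by (rule finite_measure_variation)
  show ?thesis
  proof (rule M.integrable_const_bound[of _ B])
    show "AE p in variation_measure \<tau> \<mu>. norm (f p * polar_density \<tau> \<mu> p) \<le> B"
      by (rule AE_I2) (simp add: norm_mult polar_density_props(2) f_le)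
    have "(\<lambda>p. f p * polar_density \<tau> \<mu> p) \<in> borel_measurable (borel_of \<tau>)"
      by (intro borel_measurable_times f polar_density_props)
    then show "(\<lambda>p. f p * polar_density \<tau> \<mu> p) \<in> borel_measurable (variation_measure \<tau> \<mu>)"
      by (simp cong: measurable_cong_sets)
  qed
qed

lemma norm_scalar_integral_le:
  "norm (scalar_integral \<tau> \<mu> f) \<le> B * measure (variation_measure \<tau> \<mu>) (topspace \<tau>)"
proof -
  interpret M: finite_measure "variation_measure \<tau> \<mu>" by (rule finite_measure_variation)
  have "norm (scalar_integral \<tau> \<mu> f) \<le> (LINT p|variation_measure \<tau> \<mu>. norm (f p * polar_density \<tau> \<mu> p))"
    unfolding scalar_integral_def by (rule integral_norm_bound)
  also have "\<dots> \<le> (LINT p|variation_measure \<tau> \<mu>. B)"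
    by (intro integral_mono integrable_norm integrable_polar)
      (auto simp: norm_mult polar_density_props(2) f_le)
  finally show ?thesis by (simp add: mult.commute)
qed

lemma scalar_integral_scale: "scalar_integral \<tau> \<mu> (\<lambda>p. c * f p) = c * scalar_integral \<tau> \<mu> f"
  unfolding scalar_integral_def by (simp add: mult.assoc)

end

lemma scalar_integral_add:
  assumes "f \<in> borel_measurable (borel_of \<tau>)" "\<And>p. p \<in> topspace \<tau> \<Longrightarrow> norm (f p) \<le> B"
    and "g \<in> borel_measurable (borel_of \<tau>)" "\<And>p. p \<in> topspace \<tau> \<Longrightarrow> norm (g p) \<le> C"
  shows "scalar_integral \<tau> \<mu> (\<lambda>p. f p + g p) = scalar_integral \<tau> \<mu> f + scalar_integral \<tau> \<mu> g"
  unfolding scalar_integral_def distrib_right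
  by (intro Bochner_Integration.integral_add integrable_polar[OF assms(1,2)] integrable_polar[OF assms(3,4)])

end

section \<open>Discrete measures\<close>

context
  fixes \<tau> :: "'p topology" and \<nu> :: "'p measure" and \<mu> :: "'p set \<Rightarrow> 'k::rc_field"
  assumes fin: "finite_measure \<nu>" and sets_\<nu>: "sets \<nu> = sets (borel_of \<tau>)"
  defines "\<mu> \<equiv> \<lambda>A. of_real (measure \<nu> A)"
begin

interpretation finite_measure \<nu> by (rule fin)

lemma space_of_sets: "space \<nu> = topspace \<tau>"
  using sets_eq_imp_space_eq[OF sets_\<nu>] by simp

lemma scalar_measure_of_measure: "scalar_measure \<tau> \<mu>"
  unfolding scalar_measure_def \<mu>_def
  by (intro allI impI sums_of_real finite_measure_UNION) (simp_all add: sets_\<nu>)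

interpretation m: scalar_measure_on \<tau> \<mu>
  by standard (rule scalar_measure_of_measure)

lemma variation_of_measure:
  assumes "E \<in> sets (borel_of \<tau>)"
  shows "variation \<tau> \<mu> E = emeasure \<nu> E"
proof (rule antisym)
  show "variation \<tau> \<mu> E \<le> emeasure \<nu> E"
  proof (rule m.variation_le)
    fix P assume P: "finite P" "disjoint P" "P \<subseteq> sets (borel_of \<tau>)" "\<Union>P = E"
    have "(\<Sum>A\<in>P. ennreal (norm (\<mu> A))) = (\<Sum>A\<in>P. emeasure \<nu> A)"
      by (simp add: \<mu>_def emeasure_eq_measure)
    also have "\<dots> = emeasure \<nu> (\<Union>A\<in>P. A)"
      using P by (intro sum_emeasure) (auto simp: sets_\<nu> disjoint_family_on_def disjoint_def)
    finally show "(\<Sum>A\<in>P. ennreal (norm (\<mu> A))) \<le> emeasure \<nu> E" using P(4) by simp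
  qed
  show "emeasure \<nu> E \<le> variation \<tau> \<mu> E"
    using m.norm_le_variation[OF assms] by (simp add: \<mu>_def emeasure_eq_measure)
qed

lemma variation_measure_of_measure: "variation_measure \<tau> \<mu> = \<nu>"
  by (rule measure_eqI) (simp_all add: sets_\<nu> m.emeasure_variation_measure variation_of_measure)

lemma tv_norm_of_measure: "tv_norm \<tau> \<mu> = measure \<nu> (topspace \<tau>)"
  using sets.top[of "borel_of \<tau>"] unfolding tv_norm_def by (simp add: variation_of_measure measure_def)

text \<open>The integral of the density is the total mass while its modulus is 1, so its real part
  must be 1 almost everywhere.\<close>

lemma polar_density_of_measure: "AE p in \<nu>. polar_density \<tau> \<mu> p = 1"
proof -
  let ?h = "polar_density \<tau> \<mu>"
  note h = m.polar_density_props[unfolded variation_measure_of_measure]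
  have top: "topspace \<tau> \<in> sets (borel_of \<tau>)" using sets.top[of "borel_of \<tau>"] by simp
  have hm: "?h \<in> borel_measurable \<nu>" using h(1) sets_\<nu> by (simp cong: measurable_cong_sets)
  have hi: "integrable \<nu> ?h"
    by (rule integrable_const_bound[OF AE_I2 hm, of 1]) (simp add: h(2) space_of_sets)
  have ri: "integrable \<nu> (\<lambda>p. re_part (?h p))" by (rule integrable_bounded_linear[OF bounded_linear_re_part hi])
  have "(LINT p|\<nu>. ?h p) = (LINT p|\<nu>. indicator (topspace \<tau>) p *\<^sub>R ?h p)"
    by (intro Bochner_Integration.integral_cong) (auto simp: space_of_sets)
  then have "(LINT p|\<nu>. ?h p) = of_real (measure \<nu> (topspace \<tau>))"
    using h(3)[OF top] by (simp add: \<mu>_def)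
  then have "(LINT p|\<nu>. re_part (?h p)) = measure \<nu> (topspace \<tau>)"
    using integral_bounded_linear[OF bounded_linear_re_part hi] by simp
  then have "(LINT p|\<nu>. 1 - re_part (?h p)) = 0"
    using Bochner_Integration.integral_diff[OF _ ri, of "\<lambda>_. 1"] by (simp add: space_of_sets)
  moreover have "AE p in \<nu>. 0 \<le> 1 - re_part (?h p)"
    by (rule AE_I2) (use h(2) re_part_le_norm space_of_sets in \<open>metis diff_ge_0_iff_ge\<close>)
  ultimately have "AE p in \<nu>. 1 - re_part (?h p) = 0"
    using integral_nonneg_eq_0_iff_AE[of \<nu> "\<lambda>p. 1 - re_part (?h p)"] ri by auto
  then show ?thesis
  proof (rule AE_mp, intro AE_I2 impI)
    fix p assume p: "p \<in> space \<nu>" "1 - re_part (?h p) = 0"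
    \<comment> \<open>The real part of \<open>- ?h p\<close> is -1 and its modulus 1; by the
      definition of \<open>re_part\<close> the square of this norm is then 0.\<close>
    have "norm (- ?h p + 1) = 0"
      using p h(2)[of p] re_part_minus[of "?h p"] unfolding re_part_def[of "- ?h p"] by (simp add: space_of_sets)
    then show "?h p = 1" by simp
  qed
qed

lemma scalar_integral_of_measure:
  assumes "f \<in> borel_measurable (borel_of \<tau>)"
  shows "scalar_integral \<tau> \<mu> f = (LINT p|\<nu>. f p)"
  unfolding scalar_integral_def variation_measure_of_measure
proof (rule integral_cong_AE)
  have f: "f \<in> borel_measurable \<nu>" using assms sets_\<nu> by (simp cong: measurable_cong_sets)
  show "f \<in> borel_measurable \<nu>" by (rule f)
  have "polar_density \<tau> \<mu> \<in> borel_measurable \<nu>"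
    using m.polar_density_props(1) sets_\<nu> by (simp cong: measurable_cong_sets)
  then show "(\<lambda>p. f p * polar_density \<tau> \<mu> p) \<in> borel_measurable \<nu>" using f by simp
  show "AE p in \<nu>. f p * polar_density \<tau> \<mu> p = f p"
    using polar_density_of_measure by eventually_elim simp
qed

end

text \<open>The measure is the image of the weights under \<open>p\<close>. Regularity holds because
  finite sets of points are compact and closed: \<open>E\<close> is exhausted from inside by its
  finite parts \<open>C n\<close> and approached from outside by the complements \<open>U n\<close>
  of finitely many points off \<open>E\<close>.\<close>

lemma ex_discrete_radon_measure:
  fixes c :: "'i \<Rightarrow> real" and p :: "'i \<Rightarrow> 'p"
  assumes haus: "Hausdorff_space \<tau>" and I: "countable I" "I \<noteq> {}" and c0: "\<And>i. i \<in> I \<Longrightarrow> 0 \<le> c i"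
    and abs: "Infinite_Set_Sum.abs_summable_on c I" and p: "\<And>i. i \<in> I \<Longrightarrow> p i \<in> topspace \<tau>"
  shows "\<exists>\<mu> :: 'p set \<Rightarrow> 'k::rc_field. radon_measure \<tau> \<mu> \<and> tv_norm \<tau> \<mu> = infsetsum c I \<and>
    (\<forall>f \<in> borel_measurable (borel_of \<tau>). scalar_integral \<tau> \<mu> f = infsetsum (\<lambda>i. c i *\<^sub>R f (p i)) I)"
proof -
  define D where "D = density (count_space I) (\<lambda>i. ennreal (c i))"
  define \<nu> where "\<nu> = distr D (borel_of \<tau>) p"
  define \<mu> :: "'p set \<Rightarrow> 'k" where "\<mu> A = of_real (measure \<nu> A)" for A
  have pm: "p \<in> measurable D (borel_of \<tau>)" using p by (simp add: D_def)
  have spD: "space D = I" by (simp add: D_def)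
  have sets\<nu>: "sets \<nu> = sets (borel_of \<tau>)" by (simp add: \<nu>_def)
  have sp\<nu>: "space \<nu> = topspace \<tau>" by (simp add: \<nu>_def)
  have em: "emeasure \<nu> A = emeasure D (p -` A \<inter> I)" if "A \<in> sets (borel_of \<tau>)" for A
    unfolding \<nu>_def by (simp add: emeasure_distr[OF pm that] spD)
  have cint: "integrable (count_space I) c" using abs by (simp add: abs_summable_on_def)
  have emD: "emeasure D I = ennreal (infsetsum c I)"
  proof -
    have "emeasure D I = (\<integral>\<^sup>+i. ennreal (c i) * indicator I i \<partial>count_space I)"
      unfolding D_def by (subst emeasure_density) auto
    also have "\<dots> = (\<integral>\<^sup>+i. ennreal (c i) \<partial>count_space I)" by (intro nn_integral_cong) simp
    also have "\<dots> = ennreal (infsetsum c I)"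
      unfolding infsetsum_def using c0 by (intro nn_integral_eq_integral[OF cint] AE_I2) simp
    finally show ?thesis .
  qed
  have top: "topspace \<tau> \<in> sets (borel_of \<tau>)" using sets.top[of "borel_of \<tau>"] by simp
  have pI: "p -` topspace \<tau> \<inter> I = I" using p by auto
  have em_top: "emeasure \<nu> (topspace \<tau>) = ennreal (infsetsum c I)" by (simp add: em[OF top] pI emD)
  have fin: "finite_measure \<nu>" by (rule finite_measureI) (simp add: sp\<nu> em_top)
  interpret \<nu>: finite_measure \<nu> by (rule fin)
  note of_measure = scalar_measure_of_measure variation_of_measure tv_norm_of_measure scalar_integral_of_measure
  note of_meas = of_measure[OF fin sets\<nu>, where 'k = 'k, folded \<mu>_def[abs_def]]
  have V: "variation \<tau> \<mu> E = emeasure \<nu> E" if "E \<in> sets (borel_of \<tau>)" for E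
    using of_meas(2)[OF that] by simp
  define F where "F n = from_nat_into I ` {..n}" for n
  have F: "finite (F n)" "F n \<subseteq> I" for n
    using from_nat_into[OF I(2)] by (auto simp: F_def)
  have FU: "\<exists>n. i \<in> F n" if "i \<in> I" for i
    using from_nat_into_surj[OF I(1) that] by (auto simp: F_def)
  have Fmono: "F n \<subseteq> F m" if "n \<le> m" for n m using that by (auto simp: F_def)
  have closed: "closedin \<tau> C" if "finite C" "C \<subseteq> topspace \<tau>" for C
    using Hausdorff_imp_t1_space[OF haus] that by (simp add: t1_space_closedin_finite)
  have pF: "finite (p ` F n)" "p ` F n \<subseteq> topspace \<tau>" for n using F[of n] p by auto
  have radon: "variation \<tau> \<mu> E = (INF U \<in> {U. openin \<tau> U \<and> E \<subseteq> U}. variation \<tau> \<mu> U) \<and>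
        variation \<tau> \<mu> E = (SUP C \<in> {C. compactin \<tau> C \<and> C \<in> sets (borel_of \<tau>) \<and> C \<subseteq> E}. variation \<tau> \<mu> C)"
    if E: "E \<in> sets (borel_of \<tau>)" for E
  proof
    have Esub: "E \<subseteq> topspace \<tau>" using sets.sets_into_space[OF E] by simp
    define U where "U n = topspace \<tau> - (p ` F n - E)" for n
    have Uopen: "openin \<tau> (U n)" for n
      unfolding U_def using pF[of n] by (intro openin_diff openin_topspace closed) auto
    then have Us: "U n \<in> sets (borel_of \<tau>)" for n by (rule openin_sets_borel_of)
    have UE: "E \<subseteq> U n" for n using Esub by (auto simp: U_def)
    have IU: "(\<Inter>n. U n) \<in> sets (borel_of \<tau>)" using Us by (intro sets.countable_INT) auto
    have "(\<lambda>n. emeasure \<nu> (U n)) \<longlonglongrightarrow> emeasure \<nu> (\<Inter>n. U n)"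
    proof (rule Lim_emeasure_decseq)
      show "decseq U" unfolding decseq_def U_def using Fmono by blast
    qed (use Us sets\<nu> in auto)
    also have "emeasure \<nu> (\<Inter>n. U n) = emeasure \<nu> E"
    proof -
      have "p -` (\<Inter>n. U n) \<inter> I = p -` E \<inter> I"
        using FU p Esub by (fastforce simp: U_def)
      then show ?thesis using em[OF IU] em[OF E] by simp
    qed
    finally have lim: "(\<lambda>n. variation \<tau> \<mu> (U n)) \<longlonglongrightarrow> variation \<tau> \<mu> E" by (simp add: V[OF Us] V[OF E])
    show "variation \<tau> \<mu> E = (INF U \<in> {U. openin \<tau> U \<and> E \<subseteq> U}. variation \<tau> \<mu> U)"
    proof (rule antisym)
      show "variation \<tau> \<mu> E \<le> (INF U \<in> {U. openin \<tau> U \<and> E \<subseteq> U}. variation \<tau> \<mu> U)"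
      proof (rule INF_greatest)
        fix W assume W: "W \<in> {U. openin \<tau> U \<and> E \<subseteq> U}"
        then have "W \<in> sets (borel_of \<tau>)" by (auto intro: openin_sets_borel_of)
        then show "variation \<tau> \<mu> E \<le> variation \<tau> \<mu> W"
          using W E by (simp add: V emeasure_mono sets\<nu>)
      qed
      show "(INF U \<in> {U. openin \<tau> U \<and> E \<subseteq> U}. variation \<tau> \<mu> U) \<le> variation \<tau> \<mu> E"
      proof (rule LIMSEQ_le_const[OF lim], intro exI[of _ 0] allI impI)
        fix n show "(INF U \<in> {U. openin \<tau> U \<and> E \<subseteq> U}. variation \<tau> \<mu> U) \<le> variation \<tau> \<mu> (U n)"
          by (rule INF_lower) (simp add: Uopen UE)
      qed
    qed
    define C where "C n = p ` F n \<inter> E" for n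
    have Cfin: "finite (C n)" "C n \<subseteq> topspace \<tau>" "C n \<subseteq> E" for n using pF[of n] by (auto simp: C_def)
    have Cs: "C n \<in> sets (borel_of \<tau>)" for n by (intro closedin_sets_borel_of closed Cfin)
    have UC: "(\<Union>n. C n) \<in> sets (borel_of \<tau>)" using Cs by (intro sets.countable_UN) auto
    have "(\<lambda>n. emeasure \<nu> (C n)) \<longlonglongrightarrow> emeasure \<nu> (\<Union>n. C n)"
    proof (rule Lim_emeasure_incseq)
      show "incseq C" unfolding incseq_def C_def using Fmono by blast
    qed (use Cs sets\<nu> in auto)
    also have "emeasure \<nu> (\<Union>n. C n) = emeasure \<nu> E"
    proof -
      have "p -` (\<Union>n. C n) \<inter> I = p -` E \<inter> I"
        using FU by (fastforce simp: C_def)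
      then show ?thesis using em[OF UC] em[OF E] by simp
    qed
    finally have lim: "(\<lambda>n. variation \<tau> \<mu> (C n)) \<longlonglongrightarrow> variation \<tau> \<mu> E" by (simp add: V[OF Cs] V[OF E])
    show "variation \<tau> \<mu> E = (SUP C \<in> {C. compactin \<tau> C \<and> C \<in> sets (borel_of \<tau>) \<and> C \<subseteq> E}. variation \<tau> \<mu> C)"
    proof (rule antisym)
      show "(SUP C \<in> {C. compactin \<tau> C \<and> C \<in> sets (borel_of \<tau>) \<and> C \<subseteq> E}. variation \<tau> \<mu> C) \<le> variation \<tau> \<mu> E"
        by (rule SUP_least) (use E in \<open>auto simp: V emeasure_mono sets\<nu>\<close>)
      show "variation \<tau> \<mu> E \<le> (SUP C \<in> {C. compactin \<tau> C \<and> C \<in> sets (borel_of \<tau>) \<and> C \<subseteq> E}. variation \<tau> \<mu> C)"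
      proof (rule LIMSEQ_le_const2[OF lim], intro exI[of _ 0] allI impI)
        fix n show "variation \<tau> \<mu> (C n) \<le> (SUP C \<in> {C. compactin \<tau> C \<and> C \<in> sets (borel_of \<tau>) \<and> C \<subseteq> E}. variation \<tau> \<mu> C)"
          by (rule SUP_upper) (simp add: Cs Cfin finite_imp_compactin)
      qed
    qed
  qed
  have "scalar_integral \<tau> \<mu> f = infsetsum (\<lambda>i. c i *\<^sub>R f (p i)) I" if f: "f \<in> borel_measurable (borel_of \<tau>)" for f :: "'p \<Rightarrow> 'k"
  proof -
    have "scalar_integral \<tau> \<mu> f = (LINT x|\<nu>. f x)" using of_meas(4)[OF f] .
    also have "\<dots> = (LINT i|D. f (p i))" unfolding \<nu>_def by (rule integral_distr[OF pm f])
    also have "\<dots> = (LINT i|count_space I. c i *\<^sub>R f (p i))"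
      unfolding D_def using c0 by (intro integral_density) (auto intro: AE_I2)
    finally show ?thesis by (simp add: infsetsum_def)
  qed
  moreover have "radon_measure \<tau> \<mu>" unfolding radon_measure_def using of_meas(1) radon by blast
  moreover have "tv_norm \<tau> \<mu> = infsetsum c I"
    using of_meas(3) em_top infsetsum_nonneg[OF c0, of I] by (simp add: measure_def)
  ultimately show ?thesis by blast
qed

section \<open>Expansion into a series of evaluations\<close>

context function_space
begin

lemma functional_scaled: "functional T \<Longrightarrow> functional (\<lambda>u. c * T u)"
  by (simp add: functional_def algebra_simps)

lemma functional_minus: "functional S \<Longrightarrow> functional T \<Longrightarrow> functional (\<lambda>u. S u - T u)"
  by (simp add: functional_def algebra_simps)

text \<open>Every functional of norm at most \<open>\<rho>\<close> is, up to \<open>\<rho> / 2\<close>, \<open>\<rho>\<close> times a convex combination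
  of evaluations. Iterating this writes it as an absolutely convergent series of evaluations.\<close>

lemma evaluation_series:
  assumes noell1: "\<not> contains_ell1 sc E" and T: "functional T" and \<rho>: "0 < \<rho>"
    and T_le: "\<And>u. u \<in> E \<Longrightarrow> norm (T u) \<le> \<rho> * norm u"
  shows "\<exists>(I :: (nat \<times> 'p) set) c. countable I \<and> I \<noteq> {} \<and> (\<forall>i\<in>I. 0 \<le> c i \<and> snd i \<in> topspace \<tau>) \<and>
    Infinite_Set_Sum.abs_summable_on c I \<and> infsetsum c I \<le> 2 * \<rho> \<and>
    (\<forall>u\<in>E. T u = infsetsum (\<lambda>i. c i *\<^sub>R ev (snd i) u) I)"
proof -
  \<comment> \<open>\<open>r n\<close> bounds the remainder after \<open>n\<close> steps;
    \<open>norm_approx\<close> with \<open>\<epsilon> = 0\<close> and \<open>d = 1/2\<close> halves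
    it each time.\<close>
  define r where "r n = \<rho> * (1 / 2) ^ n" for n
  have r: "0 < r n" for n using \<rho> by (simp add: r_def)
  have Kc: "compactin \<tau> (topspace \<tau>)" using compact_space by (simp add: compact_space_def)
  define good where "good S n \<longleftrightarrow> functional S \<and> (\<forall>u\<in>E. norm (S u) \<le> r n * norm u)" for S n
  have step: "\<exists>c\<in>conv_weights (topspace \<tau>). good (\<lambda>u. S u - of_real (r n) * comb c (\<lambda>p. ev p u)) (Suc n)"
    if S: "good S n" for S n
  proof -
    define S' where "S' u = of_real (1 / r n) * S u" for u
    have fS: "functional S'" unfolding S'_def[abs_def] using S by (intro functional_scaled) (simp add: good_def)
    have S'_le: "norm (S' u) \<le> norm u" if "u \<in> E" for u
      using S that r[of n] by (simp add: S'_def good_def norm_mult norm_divide pos_divide_le_eq mult.commute)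
    \<comment> \<open>Over the whole space, \<open>norming\<close> puts every functional of norm at
      most 1 below the evaluations, without error.\<close>
    have "almost_below S' 0 (topspace \<tau>)"
      unfolding almost_below_def
    proof
      fix h assume h: "h \<in> E"
      obtain p where "p \<in> topspace \<tau>" "ev p h = of_real (norm h)" using norming[OF h] by blast
      then show "\<exists>p\<in>topspace \<tau>. re_part (S' h) - 0 * norm h \<le> re_part (ev p h)"
        using S'_le[OF h] re_part_le_norm[of "S' h"] by (intro bexI[of _ p]) auto
    qed
    from norm_approx[OF noell1 fS Kc this, of "1/2"] obtain c where c: "c \<in> conv_weights (topspace \<tau>)"
      "\<And>u. u \<in> E \<Longrightarrow> norm (S' u - comb c (\<lambda>p. ev p u)) \<le> 1 / 2 * norm u" by auto
    have "norm (S u - of_real (r n) * comb c (\<lambda>p. ev p u)) \<le> r (Suc n) * norm u" if u: "u \<in> E" for u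
    proof -
      have "S u - of_real (r n) * comb c (\<lambda>p. ev p u) = of_real (r n) * (S' u - comb c (\<lambda>p. ev p u))"
        using r[of n] by (simp add: S'_def right_diff_distrib)
      then have "norm (S u - of_real (r n) * comb c (\<lambda>p. ev p u)) = r n * norm (S' u - comb c (\<lambda>p. ev p u))"
        using r[of n] by (simp add: norm_mult)
      also have "\<dots> \<le> r n * (1 / 2 * norm u)" using c(2)[OF u] r[of n] by (intro mult_left_mono) auto
      finally show ?thesis by (simp add: r_def)
    qed
    moreover have "functional (\<lambda>u. S u - of_real (r n) * comb c (\<lambda>p. ev p u))"
      using S functional_comp_ev[OF order_refl comb_pos_fun[OF c(1)]]
      by (intro functional_minus functional_scaled) (auto simp: good_def)
    ultimately show ?thesis using c(1) unfolding good_def by blast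
  qed
  have "\<exists>S. \<forall>n. (good (S n) n \<and> (n = 0 \<longrightarrow> S n = T)) \<and>
     (\<exists>c\<in>conv_weights (topspace \<tau>). S (Suc n) = (\<lambda>u. S n u - of_real (r n) * comb c (\<lambda>p. ev p u)))"
  proof (rule dependent_nat_choice)
    show "\<exists>S. good S 0 \<and> (0 = (0::nat) \<longrightarrow> S = T)" using T T_le by (auto simp: good_def r_def)
  qed (use step in blast)
  then obtain S where S: "\<And>n. good (S n) n" "S 0 = T"
     "\<And>n. \<exists>c\<in>conv_weights (topspace \<tau>). S (Suc n) = (\<lambda>u. S n u - of_real (r n) * comb c (\<lambda>p. ev p u))"
    by metis
  from S(3) obtain c where c: "\<And>n. c n \<in> conv_weights (topspace \<tau>)"
    "\<And>n. S (Suc n) = (\<lambda>u. S n u - of_real (r n) * comb (c n) (\<lambda>p. ev p u))" by metis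
  have part: "(\<Sum>n<N. of_real (r n) * comb (c n) (\<lambda>p. ev p u)) = T u - S N u" for N u
    by (induction N) (simp_all add: S(2) c(2))
  have series: "(\<lambda>n. of_real (r n) * comb (c n) (\<lambda>p. ev p u)) sums T u" if u: "u \<in> E" for u
  proof -
    have "(\<lambda>N. r N * norm u) \<longlonglongrightarrow> \<rho> * 0 * norm u" unfolding r_def
      by (intro tendsto_intros LIMSEQ_realpow_zero) auto
    then have "(\<lambda>N. S N u) \<longlonglongrightarrow> 0"
      by (rule tendsto_0_le[where K = 1, OF tendsto_eq_rhs])
        (use S(1) u in \<open>auto simp: good_def intro!: always_eventually intro: order_trans[OF _ abs_ge_self]\<close>)
    then have "(\<lambda>N. T u - S N u) \<longlonglongrightarrow> T u - 0" by (intro tendsto_intros)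
    then show ?thesis by (simp add: sums_def part)
  qed
  define B where "B n = {p. c n p \<noteq> 0}" for n
  have B: "finite (B n)" "B n \<subseteq> topspace \<tau>" "\<And>p. 0 \<le> c n p" "sum (c n) (B n) = 1" for n
    using c(1)[of n] by (auto simp: B_def conv_weights_def)
  \<comment> \<open>Pairs keep apart the uses of the same point in different steps.\<close>
  define I where "I = Sigma (UNIV :: nat set) B"
  define w where "w i = r (fst i) * c (fst i) (snd i)" for i
  have w0: "0 \<le> w i" for i using r[of "fst i"] B(3) by (simp add: w_def less_imp_le)
  have cI: "countable I" unfolding I_def by (intro countable_SIGMA) (auto intro: countable_finite B)
  have sumw: "(\<Sum>p\<in>B n. w (n, p)) = r n" for n
    using B(4)[of n] by (simp add: w_def sum_distrib_left[symmetric])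
  have sr: "summable r" "suminf r = 2 * \<rho>"
    unfolding r_def by (auto simp: suminf_mult suminf_geometric summable_mult summable_geometric)
  have "Infinite_Set_Sum.abs_summable_on r UNIV"
    using sr(1) r by (simp add: abs_summable_on_nat_iff' less_imp_le)
  then have absw: "Infinite_Set_Sum.abs_summable_on w I" unfolding I_def
    by (subst abs_summable_on_Sigma_iff) (auto intro: countable_finite B simp: B(1) w0 sumw)
  have "infsetsum w I = infsetsum (\<lambda>n. infsetsum (\<lambda>p. w (n, p)) (B n)) UNIV"
    unfolding I_def by (rule infsetsum_Sigma) (use absw B in \<open>auto simp: I_def intro: countable_finite\<close>)
  also have "\<dots> = infsetsum r UNIV" by (simp add: B(1) sumw)
  also have "\<dots> = 2 * \<rho>"
    using sr r by (subst infsetsum_nat') (auto simp: abs_summable_on_nat_iff' less_imp_le)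
  finally have total: "infsetsum w I = 2 * \<rho>" .
  have repr: "T u = infsetsum (\<lambda>i. w i *\<^sub>R ev (snd i) u) I" if u: "u \<in> E" for u
  proof -
    have le: "norm (w i *\<^sub>R ev (snd i) u) \<le> norm u * w i" if "i \<in> I" for i
    proof -
      have "snd i \<in> topspace \<tau>" using that B(2)[of "fst i"] by (auto simp: I_def)
      then have "w i * norm (ev (snd i) u) \<le> w i * norm u" using u w0[of i] by (intro mult_left_mono norm_ev_le)
      then show ?thesis using w0[of i] by (simp add: mult.commute)
    qed
    have abs: "Infinite_Set_Sum.abs_summable_on (\<lambda>i. w i *\<^sub>R ev (snd i) u) I"
      by (rule abs_summable_on_comparison_test'[OF abs_summable_on_cmult_right[OF absw] le])
    then have abs': "Infinite_Set_Sum.abs_summable_on (\<lambda>i. w i *\<^sub>R ev (snd i) u) (Sigma UNIV B)" by (simp add: I_def)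
    have inner: "(\<Sum>p\<in>B n. w (n, p) *\<^sub>R ev p u) = of_real (r n) * comb (c n) (\<lambda>p. ev p u)" for n
      by (simp add: comb_def B_def w_def sum_distrib_left scaleR_conv_of_real mult.assoc)
    have "infsetsum (\<lambda>i. w i *\<^sub>R ev (snd i) u) I =
        infsetsum (\<lambda>n. infsetsum (\<lambda>p. w (n, p) *\<^sub>R ev p u) (B n)) UNIV"
      unfolding I_def using infsetsum_Sigma[OF _ _ abs'] B(1) by (simp add: countable_finite)
    also have "\<dots> = infsetsum (\<lambda>n. of_real (r n) * comb (c n) (\<lambda>p. ev p u)) UNIV"
      by (simp add: B(1) inner)
    also have "\<dots> = (\<Sum>n. of_real (r n) * comb (c n) (\<lambda>p. ev p u))"
    proof (rule infsetsum_nat')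
      have le: "norm (of_real (r n) * comb (c n) (\<lambda>p. ev p u)) \<le> norm u * r n" for n
      proof -
        have "norm (comb (c n) (\<lambda>p. ev p u)) \<le> norm u"
          by (rule norm_comb_le[OF c(1)]) (rule norm_ev_le[OF _ u])
        then show ?thesis using r[of n] by (simp add: norm_mult mult.commute)
      qed
      have "summable (\<lambda>n. norm (of_real (r n) * comb (c n) (\<lambda>p. ev p u)))"
      proof (rule summable_comparison_test'[OF summable_mult[OF sr(1), of "norm u"], of 0])
        show "norm (norm (of_real (r n) * comb (c n) (\<lambda>p. ev p u))) \<le> norm u * r n" for n
          unfolding real_norm_def abs_norm_cancel by (rule le)
      qed
      then show "Infinite_Set_Sum.abs_summable_on (\<lambda>n. of_real (r n) * comb (c n) (\<lambda>p. ev p u)) UNIV"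
        by (simp add: abs_summable_on_nat_iff')
    qed
    also have "\<dots> = T u" using series[OF u] by (simp add: sums_iff)
    finally show ?thesis ..
  qed
  have ne: "I \<noteq> {}"
  proof
    assume "I = {}"
    then have "B 0 = {}" by (auto simp: I_def)
    then show False using B(4)[of 0] by simp
  qed
  have sndI: "snd i \<in> topspace \<tau>" if "i \<in> I" for i using that B(2)[of "fst i"] by (auto simp: I_def)
  show ?thesis
  proof (intro exI conjI ballI)
    show "countable I" by (rule cI)
    show "I \<noteq> {}" by (rule ne)
    show "0 \<le> w i" for i by (rule w0)
    show "snd i \<in> topspace \<tau>" if "i \<in> I" for i by (rule sndI[OF that])
    show "Infinite_Set_Sum.abs_summable_on w I" by (rule absw)
    show "infsetsum w I \<le> 2 * \<rho>" by (simp add: total)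
    show "T u = infsetsum (\<lambda>i. w i *\<^sub>R ev (snd i) u) I" if "u \<in> E" for u by (rule repr[OF that])
  qed
qed

end

section \<open>The injective tensor product as a function space\<close>

instance bcontfun :: (metric_space, banach) banach ..

section \<open>Weak* compactness of the dual balls\<close>

text \<open>Alaoglu's theorem: \<open>C\<close> consists of the linear functions in a product of
  compact discs, and \<open>Blinfun\<close> maps it continuously onto the ball.\<close>

lemma compactin_dual_ball:
  fixes s :: "'k::rc_field \<Rightarrow> 'a::real_normed_vector \<Rightarrow> 'a"
  shows "compactin strong_operator_topology (dual_ball s :: ('a \<Rightarrow>\<^sub>L 'k) set)"
proof -
  define P :: "('a \<Rightarrow> 'k) set" where "P = PiE UNIV (\<lambda>x. cball 0 (norm x))"
  define C where "C = P \<inter> {\<phi>. (\<forall>x y. \<phi> (x + y) = \<phi> x + \<phi> y) \<and> (\<forall>r x. \<phi> (r *\<^sub>R x) = r *\<^sub>R \<phi> x) \<and>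
    (\<forall>c x. \<phi> (s c x) = c * \<phi> x)}"
  have "compactin (product_topology (\<lambda>_. euclidean) UNIV) P"
    unfolding P_def by (simp add: compactin_PiE compact_cball_rc_field)
  then have "compact P" by (simp add: euclidean_product_topology)
  moreover have "closed {\<phi> :: 'a \<Rightarrow> 'k. (\<forall>x y. \<phi> (x + y) = \<phi> x + \<phi> y) \<and> (\<forall>r x. \<phi> (r *\<^sub>R x) = r *\<^sub>R \<phi> x) \<and>
    (\<forall>c x. \<phi> (s c x) = c * \<phi> x)}"
    by (intro closed_Collect_conj closed_Collect_all closed_Collect_eq continuous_intros) auto
  ultimately have "compact C" unfolding C_def by (rule compact_Int_closed)
  have lin: "bounded_linear \<phi>" if "\<phi> \<in> C" for \<phi>
  proof (rule bounded_linear_intro[where K = 1])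
    show "norm (\<phi> x) \<le> norm x * 1" for x
    proof -
      have "\<phi> x \<in> cball 0 (norm x)" using that by (auto simp: C_def P_def)
      then show ?thesis by simp
    qed
  qed (use that in \<open>auto simp: C_def\<close>)
  have app: "blinfun_apply (Blinfun \<phi>) x = \<phi> x" if "\<phi> \<in> C" for \<phi> x
    using bounded_linear_Blinfun_apply[OF lin[OF that]] by simp
  have "continuous_map (subtopology euclidean C) strong_operator_topology Blinfun"
    unfolding continuous_on_strong_operator_topo_iff_coordinatewise
  proof
    fix x
    have "continuous_map (subtopology euclidean C) euclidean (\<lambda>\<phi>. \<phi> x)"
      by (simp add: continuous_on_product_coordinates continuous_on_subset[of UNIV])
    then show "continuous_map (subtopology euclidean C) euclidean (\<lambda>\<phi>. blinfun_apply (Blinfun \<phi>) x)"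
      by (rule continuous_map_eq) (simp add: app)
  qed
  then have "compactin strong_operator_topology (Blinfun ` C)"
    using \<open>compact C\<close> by (intro image_compactin[of "subtopology euclidean C"]) (auto simp: compactin_subtopology)
  moreover have "Blinfun ` C = dual_ball s"
  proof (intro equalityI subsetI)
    fix f :: "'a \<Rightarrow>\<^sub>L 'k" assume "f \<in> Blinfun ` C"
    then obtain \<phi> where \<phi>: "\<phi> \<in> C" "f = Blinfun \<phi>" by auto
    have "norm f \<le> 1"
    proof (rule norm_blinfun_bound)
      show "norm (f x) \<le> 1 * norm x" for x
      proof -
        have "\<phi> x \<in> cball 0 (norm x)" using \<phi> by (auto simp: C_def P_def)
        then show ?thesis by (simp add: \<phi>(2) app[OF \<phi>(1)])
      qed
    qed simp
    moreover have "f \<in> K_dual s" using \<phi> app[OF \<phi>(1)] by (simp add: K_dual_def C_def)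
    ultimately show "f \<in> dual_ball s" by (simp add: dual_ball_def)
  next
    fix f :: "'a \<Rightarrow>\<^sub>L 'k" assume f: "f \<in> dual_ball s"
    have "norm (f x) \<le> norm x" for x
      using norm_blinfun[of f x] f mult_right_mono[of "norm f" 1 "norm x"] by (simp add: dual_ball_def)
    then have "blinfun_apply f \<in> C" using f
      by (auto simp: C_def P_def dual_ball_def K_dual_def blinfun.bilinear_simps)
    then show "f \<in> Blinfun ` C" by (metis blinfun_apply_inverse image_eqI)
  qed
  ultimately show ?thesis by simp
qed

lemma Hausdorff_strong_operator_topology:
  "Hausdorff_space (strong_operator_topology :: ('a::real_normed_vector \<Rightarrow>\<^sub>L 'b::real_normed_vector) topology)"
proof (rule Hausdorff_space_injective_preimage)
  show "Hausdorff_space (euclidean :: ('a \<Rightarrow> 'b) topology)"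
    unfolding euclidean_product_topology[symmetric]
    by (simp add: Hausdorff_space_product_topology Hausdorff_space_euclidean)
  show "continuous_map strong_operator_topology euclidean (blinfun_apply :: ('a \<Rightarrow>\<^sub>L 'b) \<Rightarrow> 'a \<Rightarrow> 'b)"
    using continuous_map_pullback[OF continuous_map_id, of UNIV blinfun_apply euclidean]
    by (simp add: strong_operator_topology_def id_def o_def)
  show "inj_on blinfun_apply (topspace (strong_operator_topology :: ('a \<Rightarrow>\<^sub>L 'b) topology))"
    by (simp add: inj_on_def blinfun_apply_inject)
qed

lemma topspace_dual_balls_topology [simp]:
  "topspace (dual_balls_topology sX sY) = dual_ball sX \<times> dual_ball sY"
  by (simp add: dual_balls_topology_def strong_operator_topology_topspace)

lemma compact_dual_balls_topology: "compact_space (dual_balls_topology sX sY)"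
  unfolding dual_balls_topology_def
  by (simp add: compact_space_prod_topology compact_space_subtopology compactin_dual_ball)

lemma Hausdorff_dual_balls_topology: "Hausdorff_space (dual_balls_topology sX sY)"
  unfolding dual_balls_topology_def
  by (simp add: Hausdorff_space_prod_topology Hausdorff_space_subtopology Hausdorff_strong_operator_topology)

section \<open>Evaluations on the completed tensor product\<close>

definition evaluation :: "'p \<Rightarrow> ('p discrete \<Rightarrow>\<^sub>C 'k::rc_field) \<Rightarrow> 'k" where
  "evaluation p u = apply_bcontfun u (discrete p)"

lemma evaluation_add [simp]: "evaluation p (u + v) = evaluation p u + evaluation p v"
  by (simp add: evaluation_def)

lemma evaluation_0 [simp]: "evaluation p 0 = 0"
  by (simp add: evaluation_def)

lemma evaluation_tensor_scale [simp]: "evaluation p (tensor_scale c u) = c * evaluation p u"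
  by (simp add: evaluation_def apply_tensor_scale)

lemma norm_evaluation_le: "norm (evaluation p u) \<le> norm u"
  by (simp add: evaluation_def norm_bounded)

lemma norm_evaluation_diff_le: "norm (evaluation p u - evaluation p v) \<le> norm (u - v)"
  using norm_evaluation_le[of p "u - v"] by (simp add: evaluation_def)

lemma bounded_linear_evaluation: "bounded_linear (evaluation p)"
  by (rule bounded_linear_intro[where K = 1]) (simp_all add: evaluation_def norm_bounded)

lemma evaluation_eqI: "(\<And>p. evaluation p u = evaluation p v) \<Longrightarrow> u = v"
  unfolding evaluation_def by (rule bcontfun_eqI) (metis of_discrete_inverse)

lemma norm_le_evaluation: "(\<And>p. norm (evaluation p u) \<le> B) \<Longrightarrow> norm u \<le> B"
  unfolding evaluation_def by (rule norm_bound) (metis of_discrete_inverse)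

lemma evaluation_tensor:
  "p \<in> dual_ball sX \<times> dual_ball sY \<Longrightarrow> evaluation p (tensor sX sY x y) = blinfun_apply (fst p) x * blinfun_apply (snd p) y"
  "p \<notin> dual_ball sX \<times> dual_ball sY \<Longrightarrow> evaluation p (tensor sX sY x y) = 0"
  by (cases p, auto simp: evaluation_def apply_tensor)+

lemma alg_tensorI: "(\<Sum>i<(n::nat). tensor sX sY (x i) (y i)) \<in> alg_tensor sX sY"
  unfolding alg_tensor_def mem_Collect_eq by (rule exI[of _ n], rule exI[of _ x], rule exI[of _ y]) simp

lemma alg_tensorE:
  assumes "u \<in> alg_tensor sX sY"
  obtains n x y where "u = (\<Sum>i<(n::nat). tensor sX sY (x i) (y i))"
  using assms unfolding alg_tensor_def mem_Collect_eq by (elim exE conjE) (rule that)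

lemma inj_tensor_induct:
  assumes u: "u \<in> inj_tensor sX sY" and closed: "closed {u. P u}" and zero: "P 0"
    and tensor: "\<And>x y. P (tensor sX sY x y)" and add: "\<And>u v. P u \<Longrightarrow> P v \<Longrightarrow> P (u + v)"
  shows "P u"
proof -
  have "P (\<Sum>i<n. tensor sX sY (x i) (y i))" for n :: nat and x y
    by (induction n) (auto intro: zero tensor add)
  then have "alg_tensor sX sY \<subseteq> {u. P u}" by (auto elim: alg_tensorE)
  then have "inj_tensor sX sY \<subseteq> {u. P u}" unfolding inj_tensor_def by (rule closure_minimal[OF _ closed])
  then show ?thesis using u by auto
qed

lemma tensor_mem: "tensor sX sY x y \<in> inj_tensor sX sY"
proof -
  have "tensor sX sY x y \<in> alg_tensor sX sY"
    using alg_tensorI[of sX sY "\<lambda>_. x" "\<lambda>_. y" "Suc 0"] by simp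
  then show ?thesis unfolding inj_tensor_def using closure_subset by blast
qed

lemma alg_tensor_add_tensor:
  assumes "u \<in> alg_tensor sX sY"
  shows "u + tensor sX sY a b \<in> alg_tensor sX sY"
proof -
  obtain n x y where u: "u = (\<Sum>i<(n::nat). tensor sX sY (x i) (y i))" using assms by (rule alg_tensorE)
  have "u + tensor sX sY a b = (\<Sum>i<Suc n. tensor sX sY ((x(n := a)) i) ((y(n := b)) i))"
    by (simp add: u)
  then show ?thesis by (simp only: alg_tensorI)
qed

lemma alg_tensor_add:
  assumes "u \<in> alg_tensor sX sY" "v \<in> alg_tensor sX sY"
  shows "u + v \<in> alg_tensor sX sY"
proof -
  obtain n x y where v: "v = (\<Sum>i<(n::nat). tensor sX sY (x i) (y i))" using assms(2) by (rule alg_tensorE)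
  have "u + (\<Sum>i<n. tensor sX sY (x i) (y i)) \<in> alg_tensor sX sY"
  proof (induction n)
    case (Suc n)
    then show ?case using alg_tensor_add_tensor by (simp add: add.assoc[symmetric])
  qed (use assms in simp)
  then show ?thesis by (simp add: v)
qed

lemma inj_tensor_add:
  assumes "u \<in> inj_tensor sX sY" "v \<in> inj_tensor sX sY"
  shows "u + v \<in> inj_tensor sX sY"
proof -
  obtain a b where ab: "\<And>n. a n \<in> alg_tensor sX sY" "a \<longlonglongrightarrow> u" "\<And>n. b n \<in> alg_tensor sX sY" "b \<longlonglongrightarrow> v"
    using assms unfolding inj_tensor_def closure_sequential by auto
  have "\<forall>n. a n + b n \<in> alg_tensor sX sY" using ab by (auto intro: alg_tensor_add)
  then show ?thesis unfolding inj_tensor_def closure_sequential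
    using tendsto_add[OF ab(2,4)] by (intro exI[of _ "\<lambda>n. a n + b n"] conjI)
qed

lemma zero_inj_tensor: "0 \<in> inj_tensor sX sY"
proof -
  have "0 \<in> alg_tensor sX sY" using alg_tensorI[of sX sY _ _ 0] by simp
  then show ?thesis unfolding inj_tensor_def using closure_subset by force
qed

lemma closed_inj_tensor: "closed (inj_tensor sX sY)"
  by (simp add: inj_tensor_def)

lemma norm_tensor_scale:
  fixes u :: "'p discrete \<Rightarrow>\<^sub>C 'k::rc_field"
  shows "norm (tensor_scale c u) = norm c * norm u"
proof (rule antisym)
  have le: "norm (tensor_scale d v) \<le> norm d * norm v" for d :: 'k and v :: "'p discrete \<Rightarrow>\<^sub>C 'k"
    by (rule norm_le_evaluation) (simp add: norm_mult mult_left_mono norm_evaluation_le)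
  show "norm (tensor_scale c u) \<le> norm c * norm u" by (rule le)
  show "norm c * norm u \<le> norm (tensor_scale c u)"
  proof (cases "c = 0")
    case False
    have "u = tensor_scale (1 / c) (tensor_scale c u)" using False by (intro evaluation_eqI) simp
    then have "norm u \<le> norm (1 / c) * norm (tensor_scale c u)" using le by metis
    then show ?thesis using False by (simp add: norm_divide field_simps)
  qed simp
qed

lemma tensor_scale_of_real: "tensor_scale (of_real r) u = r *\<^sub>R u" for u :: "'p discrete \<Rightarrow>\<^sub>C 'k::rc_field"
proof (rule evaluation_eqI)
  fix p
  have "evaluation p (r *\<^sub>R u) = r *\<^sub>R evaluation p u"
    by (simp add: evaluation_def)
  then show "evaluation p (tensor_scale (of_real r) u) = evaluation p (r *\<^sub>R u)"
    by (simp add: scaleR_conv_of_real)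
qed

lemma tensor_scale_simps:
  fixes u v :: "'p discrete \<Rightarrow>\<^sub>C 'k::rc_field"
  shows "tensor_scale (a + b) u = tensor_scale a u + tensor_scale b u"
    and "tensor_scale a (u + v) = tensor_scale a u + tensor_scale a v"
    and "tensor_scale a (tensor_scale b u) = tensor_scale (a * b) u"
  by (rule evaluation_eqI, simp add: algebra_simps)+

lemma bounded_linear_tensor_scale: "bounded_linear (tensor_scale c :: ('p discrete \<Rightarrow>\<^sub>C 'k::rc_field) \<Rightarrow> _)"
proof (rule bounded_linear_intro[where K = "norm c"])
  show "tensor_scale c (r *\<^sub>R u) = r *\<^sub>R tensor_scale c u" for r and u :: "'p discrete \<Rightarrow>\<^sub>C 'k"
    by (simp flip: tensor_scale_of_real add: tensor_scale_simps mult.commute)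
qed (simp_all add: tensor_scale_simps norm_tensor_scale mult.commute)

lemma tensor_scale_tensor:
  "tensor_scale c (tensor sX sY x y) = tensor sX sY (sX c x) y"
proof (rule evaluation_eqI)
  fix p
  show "evaluation p (tensor_scale c (tensor sX sY x y)) = evaluation p (tensor sX sY (sX c x) y)"
    by (cases "p \<in> dual_ball sX \<times> dual_ball sY")
      (auto simp: evaluation_tensor dual_ball_def K_dual_def mult.assoc)
qed

lemma inj_tensor_scale:
  assumes u: "u \<in> inj_tensor sX sY"
  shows "tensor_scale c u \<in> inj_tensor sX sY"
  using u
proof (rule inj_tensor_induct)
  have "closed (tensor_scale c -` inj_tensor sX sY)"
    by (intro closed_vimage closed_inj_tensor linear_continuous_on[OF bounded_linear_tensor_scale])
  then show "closed {u. tensor_scale c u \<in> inj_tensor sX sY}" by (simp add: vimage_def)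
  show "tensor_scale c 0 \<in> inj_tensor sX sY"
    using linear_0[OF bounded_linear.linear[OF bounded_linear_tensor_scale]] zero_inj_tensor by metis
qed (auto simp: tensor_scale_tensor tensor_mem tensor_scale_simps intro: inj_tensor_add)

lemma evaluation_outside:
  assumes u: "u \<in> inj_tensor sX sY" and p: "p \<notin> dual_ball sX \<times> dual_ball sY"
  shows "evaluation p u = 0"
  using u
proof (rule inj_tensor_induct)
  show "closed {u. evaluation p u = 0}"
    by (intro closed_Collect_eq linear_continuous_on[OF bounded_linear_evaluation] continuous_on_const)
qed (use p in \<open>auto simp: evaluation_tensor\<close>)

lemma dual_ball_scale: "f \<in> dual_ball s \<Longrightarrow> norm c \<le> 1 \<Longrightarrow> dual_scale c f \<in> dual_ball s"
proof -
  assume f: "f \<in> dual_ball s" and c: "norm c \<le> 1"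
  have "norm (dual_scale c f) \<le> 1"
  proof (rule norm_blinfun_bound)
    show "norm (dual_scale c f x) \<le> 1 * norm x" for x
    proof -
      have "norm (f x) \<le> 1 * norm x"
        using norm_blinfun[of f x] f by (intro order_trans[OF norm_blinfun] mult_right_mono) (auto simp: dual_ball_def)
      then have "norm c * norm (f x) \<le> 1 * (1 * norm x)" using c by (intro mult_mono) auto
      then show ?thesis by (simp add: dual_scale_apply norm_mult)
    qed
  qed simp
  then show ?thesis using f by (simp add: dual_ball_def K_dual_def dual_scale_apply)
qed

text \<open>The evaluations at the product of the balls form a circled set; this is what turns a
  point of maximal modulus into a norming point.\<close>

lemma evaluation_dual_scale:
  assumes u: "u \<in> inj_tensor sX sY" and p: "(f, g) \<in> dual_ball sX \<times> dual_ball sY" and c: "norm c \<le> 1"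
  shows "evaluation (dual_scale c f, g) u = c * evaluation (f, g) u"
  using u
proof (rule inj_tensor_induct)
  show "closed {u. evaluation (dual_scale c f, g) u = c * evaluation (f, g) u}"
    by (intro closed_Collect_eq linear_continuous_on[OF bounded_linear_evaluation] continuous_on_mult continuous_on_const)
  show "evaluation (dual_scale c f, g) (tensor sX sY x y) = c * evaluation (f, g) (tensor sX sY x y)" for x y
    using p c by (simp add: evaluation_tensor dual_ball_scale dual_scale_apply)
qed (simp_all add: distrib_left)

lemma continuous_map_evaluation:
  assumes u: "u \<in> inj_tensor sX sY"
  shows "continuous_map (dual_balls_topology sX sY) euclidean (\<lambda>p. evaluation p u)"
proof -
  let ?\<tau> = "dual_balls_topology sX sY"
  have tensor: "continuous_map ?\<tau> euclidean (\<lambda>p. evaluation p (tensor sX sY x y))" for x y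
  proof -
    have "continuous_map ?\<tau> euclidean ((\<lambda>f. blinfun_apply f x) \<circ> fst)"
      unfolding dual_balls_topology_def
      by (rule continuous_map_compose[OF continuous_map_fst])
        (intro continuous_map_from_subtopology strong_operator_topology_continuous_evaluation)
    moreover have "continuous_map ?\<tau> euclidean ((\<lambda>f. blinfun_apply f y) \<circ> snd)"
      unfolding dual_balls_topology_def
      by (rule continuous_map_compose[OF continuous_map_snd])
        (intro continuous_map_from_subtopology strong_operator_topology_continuous_evaluation)
    ultimately have "continuous_map ?\<tau> euclidean (\<lambda>p. (blinfun_apply (fst p) x, blinfun_apply (snd p) y))"
      unfolding prod_topology_euclidean[symmetric] o_def by (rule continuous_map_pairedI)
    then have "continuous_map ?\<tau> euclidean ((\<lambda>(a, b). a * b) \<circ> (\<lambda>p. (blinfun_apply (fst p) x, blinfun_apply (snd p) y)))"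
      by (rule continuous_map_compose) (auto intro!: continuous_intros simp: case_prod_unfold)
    then show ?thesis by (rule continuous_map_eq) (simp add: evaluation_tensor)
  qed
  have add: "continuous_map ?\<tau> euclidean (\<lambda>p. evaluation p (u + v))"
    if "continuous_map ?\<tau> euclidean (\<lambda>p. evaluation p u)" "continuous_map ?\<tau> euclidean (\<lambda>p. evaluation p v)" for u v
    using continuous_map_add[OF that] by simp
  show ?thesis using u
  proof (rule inj_tensor_induct[OF _ _ _ tensor add])
    \<comment> \<open>A norm limit is a uniform limit of the functions, and these preserve
      continuity by the usual three-term estimate.\<close>
    show "closed {u. continuous_map ?\<tau> euclidean (\<lambda>p. evaluation p u)}"
      unfolding closed_sequential_limits
    proof (intro allI impI, elim conjE)
      fix v u
      assume v: "\<forall>n. v n \<in> {u. continuous_map ?\<tau> euclidean (\<lambda>p. evaluation p u)}" and lim: "v \<longlonglongrightarrow> u"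
      have "openin ?\<tau> {p \<in> topspace ?\<tau>. evaluation p u \<in> S}" if S: "open S" for S
      proof (subst openin_subopen, intro ballI)
        fix p assume "p \<in> {p \<in> topspace ?\<tau>. evaluation p u \<in> S}"
        then have p: "p \<in> topspace ?\<tau>" "evaluation p u \<in> S" by auto
        obtain e where e: "0 < e" "ball (evaluation p u) e \<subseteq> S" using S p(2) by (meson openE)
        obtain n where n: "norm (v n - u) < e / 3"
          using LIMSEQ_D[OF lim, of "e / 3"] e(1) by auto
        define T where "T = {q \<in> topspace ?\<tau>. evaluation q (v n) \<in> ball (evaluation p (v n)) (e / 3)}"
        have "openin ?\<tau> T" unfolding T_def
          using v by (intro openin_continuous_map_preimage[of _ euclidean]) auto
        moreover have "p \<in> T" using p(1) e(1) by (simp add: T_def)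
        moreover have "T \<subseteq> {p \<in> topspace ?\<tau>. evaluation p u \<in> S}"
        proof
          fix q assume q: "q \<in> T"
          have "dist (evaluation p u) (evaluation q u) < e"
          proof -
            have "dist (evaluation p u) (evaluation p (v n)) < e / 3" "dist (evaluation q (v n)) (evaluation q u) < e / 3"
              using norm_evaluation_diff_le[of p u "v n"] norm_evaluation_diff_le[of q "v n" u] n
              by (simp_all add: dist_norm norm_minus_commute)
            moreover have "dist (evaluation p (v n)) (evaluation q (v n)) < e / 3" using q by (simp add: T_def)
            moreover have "dist (evaluation p u) (evaluation q u) \<le> dist (evaluation p u) (evaluation p (v n)) +
                dist (evaluation p (v n)) (evaluation q (v n)) + dist (evaluation q (v n)) (evaluation q u)"
              using dist_triangle[of "evaluation p u" "evaluation q u" "evaluation p (v n)"]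
                dist_triangle[of "evaluation p (v n)" "evaluation q u" "evaluation q (v n)"] by linarith
            ultimately show ?thesis by linarith
          qed
          then show "q \<in> {p \<in> topspace ?\<tau>. evaluation p u \<in> S}" using e(2) q by (auto simp: T_def)
        qed
        ultimately show "\<exists>T. openin ?\<tau> T \<and> p \<in> T \<and> T \<subseteq> {p \<in> topspace ?\<tau>. evaluation p u \<in> S}" by blast
      qed
      then show "u \<in> {u. continuous_map ?\<tau> euclidean (\<lambda>p. evaluation p u)}" by (simp add: continuous_map_def)
    qed
  qed simp
qed

text \<open>Compactness gives a point of maximal modulus. As \<open>u\<close> vanishes off the
  product of the balls, this maximum is the norm, and rotating the first functional makes the value
  positive.\<close>

lemma ex_norming_evaluation:
  fixes sX :: "'k::rc_field \<Rightarrow> 'a::real_normed_vector \<Rightarrow> 'a" and sY :: "'k \<Rightarrow> 'b::real_normed_vector \<Rightarrow> 'b"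
  assumes u: "u \<in> inj_tensor sX sY"
  shows "\<exists>p\<in>dual_ball sX \<times> dual_ball sY. evaluation p u = of_real (norm u)"
proof -
  let ?K = "dual_ball sX \<times> dual_ball sY :: (('a \<Rightarrow>\<^sub>L 'k) \<times> ('b \<Rightarrow>\<^sub>L 'k)) set"
  have "compactin (dual_balls_topology sX sY) ?K"
    using compact_dual_balls_topology[of sX sY] by (simp add: compact_space_def)
  from image_compactin[OF this continuous_map_evaluation[OF u]]
  have "compact ((\<lambda>p. evaluation p u) ` ?K)" by simp
  then have "compact (norm ` (\<lambda>p. evaluation p u) ` ?K)"
    by (rule compact_continuous_image[rotated]) (intro continuous_intros)
  moreover have "(0, 0) \<in> ?K" by (simp add: dual_ball_def K_dual_def)
  ultimately obtain p where p: "p \<in> ?K" "\<And>q. q \<in> ?K \<Longrightarrow> norm (evaluation q u) \<le> norm (evaluation p u)"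
    using compact_attains_sup[of "norm ` (\<lambda>p. evaluation p u) ` ?K"] by blast
  have "norm u \<le> norm (evaluation p u)"
  proof (rule norm_le_evaluation)
    show "norm (evaluation q u) \<le> norm (evaluation p u)" for q
      using p(2)[of q] evaluation_outside[OF u, of q] by (cases "q \<in> ?K") auto
  qed
  then have eq: "norm (evaluation p u) = norm u" using norm_evaluation_le by (intro antisym)
  obtain f g where fg: "p = (f, g)" by fastforce
  obtain c where c: "norm c = 1" "c * evaluation p u = of_real (norm (evaluation p u))" using ex_rotation by blast
  then have "evaluation (dual_scale c f, g) u = of_real (norm u)"
    using evaluation_dual_scale[OF u, of f g c] p(1) eq by (simp add: fg)
  moreover have "(dual_scale c f, g) \<in> ?K" using p(1) c(1) by (simp add: fg dual_ball_scale)
  ultimately show ?thesis by blast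
qed

lemma function_space_inj_tensor:
  fixes sX :: "'k::rc_field \<Rightarrow> 'a::real_normed_vector \<Rightarrow> 'a" and sY :: "'k \<Rightarrow> 'b::real_normed_vector \<Rightarrow> 'b"
  shows "function_space (dual_balls_topology sX sY) (inj_tensor sX sY)
    (tensor_scale :: 'k \<Rightarrow> _ \<Rightarrow> ('a, 'b, 'k) tensor_fun) evaluation"
proof (rule function_space.intro)
  show "\<exists>p\<in>topspace (dual_balls_topology sX sY). evaluation p u = of_real (norm u)"
    if "u \<in> inj_tensor sX sY" for u
    using ex_norming_evaluation[OF that] by (simp only: topspace_dual_balls_topology)
  show "bounded_linear (tensor_scale c :: ('a, 'b, 'k) tensor_fun \<Rightarrow> _)" for c
    by (rule bounded_linear_tensor_scale)
qed (simp_all add: compact_dual_balls_topology closed_inj_tensor zero_inj_tensor inj_tensor_add inj_tensor_scale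
      tensor_scale_of_real tensor_scale_simps norm_tensor_scale continuous_map_evaluation norm_evaluation_le)

section \<open>Nuclear operators attaining their norm\<close>

text \<open>This includes \<open>f = 0\<close>, whose normalisation is 0.\<close>

lemma normalized_mem_dual_ball: "f \<in> K_dual s \<Longrightarrow> (1 / norm f) *\<^sub>R f \<in> dual_ball s"
  by (auto simp: dual_ball_def K_dual_def blinfun.scaleR_left)

context
  fixes sX :: "'k::rc_field \<Rightarrow> 'a::real_normed_vector \<Rightarrow> 'a" and sY :: "'k \<Rightarrow> 'b::real_normed_vector \<Rightarrow> 'b"
begin

interpretation fs: function_space "dual_balls_topology sX sY" "inj_tensor sX sY"
  "tensor_scale :: 'k \<Rightarrow> _ \<Rightarrow> ('a, 'b, 'k) tensor_fun" evaluation
  by (rule function_space_inj_tensor)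

abbreviation (input) "\<T> \<equiv> dual_balls_topology sX sY"
abbreviation (input) "\<E> \<equiv> inj_tensor sX sY"
abbreviation (input) "tf \<equiv> tensor_functional sX sY"

lemma functional_eqI:
  assumes \<Phi>: "fs.functional \<Phi>" "\<And>u. u \<in> \<E> \<Longrightarrow> norm (\<Phi> u) \<le> B * norm u"
    and \<Psi>: "fs.functional \<Psi>" "\<And>u. u \<in> \<E> \<Longrightarrow> norm (\<Psi> u) \<le> C * norm u"
    and eq: "\<And>x y. \<Phi> (tensor sX sY x y) = \<Psi> (tensor sX sY x y)" and u: "u \<in> \<E>"
  shows "\<Phi> u = \<Psi> u"
proof -
  obtain a where a: "\<And>n. a n \<in> alg_tensor sX sY" "a \<longlonglongrightarrow> u"
    using u unfolding inj_tensor_def closure_sequential by auto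
  have aE: "a n \<in> \<E>" for n using a(1) closure_subset unfolding inj_tensor_def by blast
  have alg: "\<Phi> v = \<Psi> v" if v: "v \<in> alg_tensor sX sY" for v
  proof -
    obtain n x y where v: "v = (\<Sum>i<(n::nat). tensor sX sY (x i) (y i))" using v by (rule alg_tensorE)
    show ?thesis unfolding v
      by (simp add: fs.functional_sum[OF \<Phi>(1)] fs.functional_sum[OF \<Psi>(1)] tensor_mem eq)
  qed
  have "norm (\<Phi> u - \<Psi> u) \<le> (B + C) * norm (u - a n)" for n
  proof -
    have d: "u - a n \<in> \<E>" by (rule fs.diff_mem[OF u aE])
    have "\<Phi> u - \<Psi> u = \<Phi> (u - a n) - \<Psi> (u - a n)"
      by (simp add: fs.functional_diff[OF \<Phi>(1) u aE] fs.functional_diff[OF \<Psi>(1) u aE] alg[OF a(1)])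
    then show ?thesis
      using norm_triangle_ineq4[of "\<Phi> (u - a n)" "\<Psi> (u - a n)"] \<Phi>(2)[OF d] \<Psi>(2)[OF d]
      by (simp add: distrib_right)
  qed
  moreover have "(\<lambda>n. (B + C) * norm (u - a n)) \<longlonglongrightarrow> (B + C) * norm (u - u)"
    by (intro tendsto_intros a(2))
  ultimately have "norm (\<Phi> u - \<Psi> u) \<le> (B + C) * norm (u - u)" by (intro LIMSEQ_le_const) auto
  then show ?thesis by simp
qed

lemma restrict_mem_inj_tensor_dual:
  assumes \<Phi>: "fs.functional \<Phi>" "\<And>u. u \<in> \<E> \<Longrightarrow> norm (\<Phi> u) \<le> B * norm u"
  shows "restrict \<Phi> \<E> \<in> inj_tensor_dual sX sY"
  unfolding inj_tensor_dual_def using \<Phi>(2)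
  by (auto simp: fs.functional_add[OF \<Phi>(1)] fs.functional_sc[OF \<Phi>(1)] fs.add_mem fs.sc_mem)

text \<open>Resolves the definite description in \<open>tensor_functional\<close>: by density a
  bounded functional on the completion is determined by its values on tensors.\<close>

lemma tensor_functional_eqI:
  fixes T :: "'a \<Rightarrow>\<^sub>L 'b \<Rightarrow>\<^sub>L 'k"
  assumes \<Phi>: "fs.functional \<Phi>" "\<And>u. u \<in> \<E> \<Longrightarrow> norm (\<Phi> u) \<le> B * norm u"
    and T: "\<And>x y. \<Phi> (tensor sX sY x y) = T x y"
  shows "tf T = restrict \<Phi> \<E>"
  unfolding tensor_functional_def
proof (rule the_equality)
  show "restrict \<Phi> \<E> \<in> inj_tensor_dual sX sY \<and> (\<forall>x y. restrict \<Phi> \<E> (tensor sX sY x y) = T x y)"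
    using restrict_mem_inj_tensor_dual[OF \<Phi>] by (simp add: tensor_mem T)
  fix \<phi> assume \<phi>: "\<phi> \<in> inj_tensor_dual sX sY \<and> (\<forall>x y. \<phi> (tensor sX sY x y) = T x y)"
  then have "\<exists>C. \<forall>u\<in>\<E>. norm (\<phi> u) \<le> C * norm u" unfolding inj_tensor_dual_def by blast
  then obtain C where C: "\<forall>u\<in>\<E>. norm (\<phi> u) \<le> C * norm u" by blast
  have f: "fs.functional \<phi>" using \<phi> unfolding fs.functional_def inj_tensor_dual_def by blast
  have "\<phi> u = \<Phi> u" if "u \<in> \<E>" for u
    by (rule functional_eqI[OF f bspec[OF C] \<Phi> _ that]) (use \<phi> T in auto)
  moreover have "\<phi> \<in> extensional \<E>" using \<phi> by (simp add: inj_tensor_dual_def)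
  ultimately show "\<phi> = restrict \<Phi> \<E>" by (intro extensionalityI[of _ \<E>]) auto
qed

text \<open>The integrand in \<open>represents\<close> is the evaluation of a tensor; integrating
  the evaluations of arbitrary elements extends \<open>T\<close> to the completion.\<close>

lemma integral_functional:
  assumes "T \<in> integral_operators sX sY"
  shows "\<exists>\<Phi> B. fs.functional \<Phi> \<and> (\<forall>u\<in>\<E>. norm (\<Phi> u) \<le> B * norm u) \<and> (\<forall>x y. \<Phi> (tensor sX sY x y) = T x y)"
proof -
  obtain \<mu> where \<mu>: "represents sX sY \<mu> T" using assms by (auto simp: integral_operators_def)
  interpret m: scalar_measure_on \<T> \<mu>
    by standard (use \<mu> in \<open>auto simp: represents_def radon_measure_def\<close>)
  define \<Phi> where "\<Phi> u = scalar_integral \<T> \<mu> (\<lambda>p. evaluation p u)" for u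
  have meas: "(\<lambda>p. evaluation p u) \<in> borel_measurable (borel_of \<T>)" if "u \<in> \<E>" for u
    by (rule continuous_map_measurable_borel_of[OF continuous_map_evaluation[OF that]])
  have "fs.functional \<Phi>"
    unfolding fs.functional_def \<Phi>_def evaluation_add evaluation_tensor_scale
    by (intro conjI ballI allI m.scalar_integral_add[OF meas norm_evaluation_le meas norm_evaluation_le]
        m.scalar_integral_scale[OF meas norm_evaluation_le])
  moreover have "norm (\<Phi> u) \<le> measure (variation_measure \<T> \<mu>) (topspace \<T>) * norm u" if "u \<in> \<E>" for u
    using m.norm_scalar_integral_le[OF meas[OF that] norm_evaluation_le] unfolding \<Phi>_def by (simp add: mult.commute)
  moreover have "\<Phi> (tensor sX sY x y) = T x y" for x y
  proof -
    have "\<Phi> (tensor sX sY x y) = scalar_integral \<T> \<mu> (\<lambda>(f :: 'a \<Rightarrow>\<^sub>L 'k, g :: 'b \<Rightarrow>\<^sub>L 'k). f x * g y)"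
      unfolding \<Phi>_def scalar_integral_def
      by (rule Bochner_Integration.integral_cong) (auto simp: evaluation_tensor)
    then show ?thesis using \<mu> by (simp add: represents_def)
  qed
  ultimately show ?thesis by blast
qed

section \<open>Nuclear representations as series of evaluations\<close>

text \<open>The index type stays free: nuclear representations are indexed by the naturals, the
  result of \<open>evaluation_series\<close> by pairs of a step and a point.\<close>

definition series :: "'i set \<Rightarrow> ('i \<Rightarrow> real) \<Rightarrow> ('i \<Rightarrow> ('a \<Rightarrow>\<^sub>L 'k) \<times> ('b \<Rightarrow>\<^sub>L 'k)) \<Rightarrow> bool" where
  "series I c p \<longleftrightarrow> countable I \<and> I \<noteq> {} \<and> (\<forall>i\<in>I. 0 \<le> c i \<and> p i \<in> topspace \<T>) \<and>
    Infinite_Set_Sum.abs_summable_on c I"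

definition series_functional ::
  "'i set \<Rightarrow> ('i \<Rightarrow> real) \<Rightarrow> ('i \<Rightarrow> ('a \<Rightarrow>\<^sub>L 'k) \<times> ('b \<Rightarrow>\<^sub>L 'k)) \<Rightarrow> ('a, 'b, 'k) tensor_fun \<Rightarrow> 'k" where
  "series_functional I c p u = infsetsum (\<lambda>i. c i *\<^sub>R evaluation (p i) u) I"

lemma series_functional_props:
  assumes s: "series I c p"
  shows "fs.functional (series_functional I c p)"
    and "norm (series_functional I c p u) \<le> infsetsum c I * norm u"
proof -
  have c: "Infinite_Set_Sum.abs_summable_on c I" "\<And>i. i \<in> I \<Longrightarrow> 0 \<le> c i" using s by (auto simp: series_def)
  have le: "norm (c i *\<^sub>R evaluation (p i) v) \<le> norm v * c i" if "i \<in> I" for i v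
    using mult_left_mono[OF norm_evaluation_le[of "p i" v] c(2)[OF that]] c(2)[OF that] by (simp add: mult.commute)
  have abs: "Infinite_Set_Sum.abs_summable_on (\<lambda>i. c i *\<^sub>R evaluation (p i) v) I" for v
    by (rule Infinite_Set_Sum.abs_summable_on_comparison_test'[OF
          Infinite_Set_Sum.abs_summable_on_cmult_right[OF c(1)] le])
  show "fs.functional (series_functional I c p)"
    unfolding fs.functional_def series_functional_def
  proof (intro conjI ballI allI)
    fix u v
    show "infsetsum (\<lambda>i. c i *\<^sub>R evaluation (p i) (u + v)) I =
        infsetsum (\<lambda>i. c i *\<^sub>R evaluation (p i) u) I + infsetsum (\<lambda>i. c i *\<^sub>R evaluation (p i) v) I"
      using infsetsum_add[OF abs abs] by (simp add: scaleR_right_distrib)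
  next
    fix d u
    have "infsetsum (\<lambda>i. c i *\<^sub>R evaluation (p i) (tensor_scale d u)) I = infsetsum (\<lambda>i. d * (c i *\<^sub>R evaluation (p i) u)) I"
      by simp
    then show "infsetsum (\<lambda>i. c i *\<^sub>R evaluation (p i) (tensor_scale d u)) I = d * infsetsum (\<lambda>i. c i *\<^sub>R evaluation (p i) u) I"
      using infsetsum_cmult_right[OF abs, of d] by simp
  qed
  have "norm (series_functional I c p u) \<le> infsetsum (\<lambda>i. norm (c i *\<^sub>R evaluation (p i) u)) I"
    unfolding series_functional_def by (rule norm_infsetsum_bound)
  also have "\<dots> \<le> infsetsum (\<lambda>i. norm u * c i) I"
  proof (rule infsetsum_mono)
    show "Infinite_Set_Sum.abs_summable_on (\<lambda>i. norm (c i *\<^sub>R evaluation (p i) u)) I"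
      by (rule Infinite_Set_Sum.abs_summable_on_normI[OF abs])
    show "Infinite_Set_Sum.abs_summable_on (\<lambda>i. norm u * c i) I"
      by (rule Infinite_Set_Sum.abs_summable_on_cmult_right[OF c(1)])
  qed (rule le)
  also have "\<dots> = norm u * infsetsum c I" by (rule infsetsum_cmult_right[OF c(1)])
  finally show "norm (series_functional I c p u) \<le> infsetsum c I * norm u" by (simp add: mult.commute)
qed

text \<open>The representing measure has weight \<open>c i\<close> at \<open>p i\<close>; as the
  weights are nonnegative, their sum is its total variation.\<close>

lemma series_represents:
  fixes T :: "'a \<Rightarrow>\<^sub>L 'b \<Rightarrow>\<^sub>L 'k"
  assumes s: "series I c p" and T: "\<And>x y. T x y = series_functional I c p (tensor sX sY x y)"
  shows "\<exists>\<mu>. represents sX sY \<mu> T \<and> tv_norm \<T> \<mu> = infsetsum c I"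
proof -
  obtain \<mu> :: "_ \<Rightarrow> 'k" where \<mu>: "radon_measure \<T> \<mu>" "tv_norm \<T> \<mu> = infsetsum c I"
    "\<And>f. f \<in> borel_measurable (borel_of \<T>) \<Longrightarrow> scalar_integral \<T> \<mu> f = infsetsum (\<lambda>i. c i *\<^sub>R f (p i)) I"
    using ex_discrete_radon_measure[OF Hausdorff_dual_balls_topology, of I c p sX sY, where 'k = 'k] s
    unfolding series_def by blast
  have "T x y = scalar_integral \<T> \<mu> (\<lambda>(f :: 'a \<Rightarrow>\<^sub>L 'k, g :: 'b \<Rightarrow>\<^sub>L 'k). f x * g y)" for x y
  proof -
    have "T x y = scalar_integral \<T> \<mu> (\<lambda>p. evaluation p (tensor sX sY x y))"
      unfolding T series_functional_def
      by (rule \<mu>(3)[symmetric]) (rule continuous_map_measurable_borel_of[OF continuous_map_evaluation[OF tensor_mem]])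
    also have "\<dots> = scalar_integral \<T> \<mu> (\<lambda>(f :: 'a \<Rightarrow>\<^sub>L 'k, g :: 'b \<Rightarrow>\<^sub>L 'k). f x * g y)"
    proof -
      interpret m: scalar_measure_on \<T> \<mu>
        by standard (use \<mu> in \<open>auto simp: radon_measure_def\<close>)
      show ?thesis unfolding scalar_integral_def
        by (rule Bochner_Integration.integral_cong) (auto simp: evaluation_tensor)
    qed
    finally show ?thesis .
  qed
  then show ?thesis using \<mu>(1,2) unfolding represents_def by blast
qed

text \<open>Normalising both factors turns the representation into nonnegative weights on points of
  the product of the balls, with the same total; a zero factor gives weight 0.\<close>

lemma nuclear_representation_series:
  assumes r: "nuclear_representation sX (K_dual sY) dual_scale f z T"
  shows "\<exists>p. series UNIV (\<lambda>i. norm (f i) * norm (z i)) p \<and>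
    (\<forall>x y. T x y = series_functional UNIV (\<lambda>i. norm (f i) * norm (z i)) p (tensor sX sY x y))"
proof -
  define c where "c i = norm (f i) * norm (z i)" for i
  define p where "p i = ((1 / norm (f i)) *\<^sub>R f i, (1 / norm (z i)) *\<^sub>R z i)" for i
  have f: "f i \<in> K_dual sX" and z: "z i \<in> K_dual sY" for i using r by (auto simp: nuclear_representation_def)
  have sc: "summable c" and sums: "\<And>x. (\<lambda>i. dual_scale (f i x) (z i)) sums T x"
    using r by (auto simp: nuclear_representation_def c_def[abs_def])
  have p: "p i \<in> dual_ball sX \<times> dual_ball sY" for i using f z by (simp add: p_def normalized_mem_dual_ball)
  have c0: "0 \<le> c i" for i by (simp add: c_def)
  have "series UNIV c p" using p c0 sc by (auto simp: series_def abs_summable_on_nat_iff')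
  moreover have "T x y = series_functional UNIV c p (tensor sX sY x y)" for x y
  proof -
    have "(\<lambda>i. blinfun_apply (dual_scale (f i x) (z i)) y) sums blinfun_apply (T x) y"
      by (rule bounded_linear.sums[OF blinfun.bounded_linear_left sums])
    moreover have "blinfun_apply (dual_scale (f i x) (z i)) y = c i *\<^sub>R evaluation (p i) (tensor sX sY x y)" for i
    proof -
      have "c i *\<^sub>R evaluation (p i) (tensor sX sY x y) =
          (norm (f i) *\<^sub>R ((1 / norm (f i)) *\<^sub>R f i x)) * (norm (z i) *\<^sub>R ((1 / norm (z i)) *\<^sub>R z i y))"
        unfolding evaluation_tensor(1)[OF p] by (simp add: p_def c_def blinfun.scaleR_left)
      also have "\<dots> = f i x * z i y"
        by (cases "f i = 0"; cases "z i = 0") simp_all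
      finally show ?thesis by (simp add: dual_scale_apply)
    qed
    ultimately have "(\<lambda>i. c i *\<^sub>R evaluation (p i) (tensor sX sY x y)) sums T x y" by simp
    moreover have "Infinite_Set_Sum.abs_summable_on (\<lambda>i. c i *\<^sub>R evaluation (p i) (tensor sX sY x y)) UNIV"
    proof -
      have cs: "Infinite_Set_Sum.abs_summable_on (\<lambda>i. norm (tensor sX sY x y) * c i) UNIV"
        using sc c0 by (intro Infinite_Set_Sum.abs_summable_on_cmult_right) (simp add: abs_summable_on_nat_iff')
      show ?thesis
      proof (rule Infinite_Set_Sum.abs_summable_on_comparison_test'[OF cs])
        show "norm (c i *\<^sub>R evaluation (p i) (tensor sX sY x y)) \<le> norm (tensor sX sY x y) * c i" for i
          using mult_left_mono[OF norm_evaluation_le[of "p i" "tensor sX sY x y"] c0[of i]] c0[of i]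
          by (simp add: mult.commute)
      qed
    qed
    ultimately show ?thesis unfolding series_functional_def by (simp add: infsetsum_nat' sums_iff)
  qed
  ultimately show ?thesis unfolding c_def by blast
qed

lemma nuclear_integral:
  assumes "T \<in> nuclear_operators sX (K_dual sY) dual_scale"
  shows "T \<in> integral_operators sX sY"
proof -
  obtain f z where T: "T \<in> operators sX (K_dual sY) dual_scale" "nuclear_representation sX (K_dual sY) dual_scale f z T"
    using assms by (auto simp: nuclear_operators_def)
  from nuclear_representation_series[OF T(2)] show ?thesis
    using series_represents T(1) unfolding integral_operators_def by blast
qed

text \<open>Being a series of evaluations, a nuclear representation bounds the functional on the
  whole completion by its total; testing at the single element \<open>u\<close> yields the lower
  bound.\<close>

lemma nuclear_representation_total_ge:
  assumes r: "nuclear_representation sX (K_dual sY) dual_scale f z T"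
    and \<Phi>: "fs.functional \<Phi>" "\<And>v. v \<in> \<E> \<Longrightarrow> norm (\<Phi> v) \<le> B * norm v"
    and T: "\<And>x y. \<Phi> (tensor sX sY x y) = T x y"
    and u: "u \<in> \<E>" "u \<noteq> 0" "r * norm u \<le> norm (\<Phi> u)"
  shows "r \<le> (\<Sum>i. norm (f i) * norm (z i))"
proof -
  define c where "c i = norm (f i) * norm (z i)" for i
  obtain p where p: "series UNIV c p" "\<And>x y. T x y = series_functional UNIV c p (tensor sX sY x y)"
    using nuclear_representation_series[OF r] unfolding c_def by blast
  have "\<Phi> u = series_functional UNIV c p u"
    by (rule functional_eqI[OF \<Phi> series_functional_props[OF p(1)] _ u(1)])
      (assumption | rule trans[OF T p(2)])+
  then have "r * norm u \<le> infsetsum c UNIV * norm u" using u(3) series_functional_props(2)[OF p(1), of u] by simp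
  then have "r \<le> infsetsum c UNIV" using u(2) by simp
  then show ?thesis using p(1) by (simp add: series_def infsetsum_nat' c_def)
qed

text \<open>The evident finite representation has total at most \<open>r\<close>, its points lying
  in the balls. All these points norm the same \<open>u\<close>, so the functional has modulus at
  least \<open>r * norm u\<close> there, and no representation can have a total below
  \<open>r\<close>.\<close>

lemma ex_NA_nu:
  assumes u: "u \<in> \<E>" "u \<noteq> 0" and r: "0 < r"
    and c: "c \<in> conv_weights (fs.norming_points u)"
  shows "\<exists>S\<in>NA_nu sX (K_dual sY) dual_scale. \<forall>x y. S x y = of_real r * comb c (\<lambda>p. evaluation p (tensor sX sY x y))"
proof -
  define A where "A = {p. c p \<noteq> 0}"
  have A: "finite A" "A \<subseteq> topspace \<T>" "\<And>p. p \<in> A \<Longrightarrow> norm u \<le> re_part (evaluation p u)" "\<And>p. 0 \<le> c p" "sum c A = 1"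
    using c by (auto simp: conv_weights_def A_def)
  obtain e where e: "bij_betw e {..<card A} A"
    using ex_bij_betw_nat_finite[OF A(1)] by (auto simp: atLeast0LessThan)
  define n where "n = card A"
  have eA: "e i \<in> A" if "i < n" for i using e that by (auto simp: n_def bij_betw_def)
  \<comment> \<open>The weight is put into the first factor; zeros from \<open>n\<close> on complete
    the finite sum to a series.\<close>
  define f :: "nat \<Rightarrow> 'a \<Rightarrow>\<^sub>L 'k" where "f i = (if i < n then (r * c (e i)) *\<^sub>R fst (e i) else 0)" for i
  define z :: "nat \<Rightarrow> 'b \<Rightarrow>\<^sub>L 'k" where "z i = (if i < n then snd (e i) else 0)" for i
  have f: "f i \<in> K_dual sX" and z: "z i \<in> K_dual sY" for i
    using eA[of i] A(2) by (auto simp: f_def z_def K_dual_def dual_ball_def blinfun.scaleR_left)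
  define S where "S = Blinfun (\<lambda>x. \<Sum>i<n. dual_scale (f i x) (z i))"
  have "bounded_linear (\<lambda>x. \<Sum>i<n. dual_scale (f i x) (z i))"
  proof (rule bounded_linear_sum)
    fix i
    have "bounded_linear (\<lambda>a. dual_scale a (z i))"
      unfolding dual_scale_def
      by (rule bounded_linear_compose[OF bounded_bilinear.bounded_linear_left[OF bounded_bilinear_blinfun_compose]
            bounded_linear_blinfun_mult_right])
    then show "bounded_linear (\<lambda>x. dual_scale (f i x) (z i))"
      by (rule bounded_linear_compose) (rule blinfun.bounded_linear_right)
  qed
  then have S: "S x = (\<Sum>i<n. dual_scale (f i x) (z i))" for x
    unfolding S_def by (simp add: bounded_linear_Blinfun_apply)
  have S_apply: "S x y = (\<Sum>i<n. f i x * z i y)" for x y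
    unfolding S by (simp add: blinfun.sum_left dual_scale_apply)
  have op: "S \<in> operators sX (K_dual sY) dual_scale"
  proof -
    have "S x \<in> K_dual sY" for x
      using z by (auto simp: K_dual_def S_apply sum_distrib_left intro!: sum.cong)
    moreover have "S (sX d x) = dual_scale d (S x)" for d x
      by (rule blinfun_eqI) (use f in \<open>auto simp: K_dual_def S_apply dual_scale_apply sum_distrib_left mult.assoc intro!: sum.cong\<close>)
    ultimately show ?thesis by (simp add: operators_def)
  qed
  have out: "norm (f i) * norm (z i) = 0" "dual_scale (f i x) (z i) = 0" if "i \<notin> {..<n}" for i x
    using that by (auto simp: f_def z_def intro: blinfun_eqI simp: dual_scale_apply)
  have rep: "nuclear_representation sX (K_dual sY) dual_scale f z S"
    unfolding nuclear_representation_def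
  proof (intro conjI allI f z)
    show "summable (\<lambda>i. norm (f i) * norm (z i))" by (rule summable_finite[of "{..<n}"]) (use out in auto)
    show "(\<lambda>i. dual_scale (f i x) (z i)) sums S x" for x
      unfolding S by (rule sums_finite) (use out in auto)
  qed
  define \<Phi> :: "('a, 'b, 'k) tensor_fun \<Rightarrow> 'k" where "\<Phi> v = of_real r * comb c (\<lambda>p. evaluation p v)" for v
  have val: "S x y = \<Phi> (tensor sX sY x y)" for x y
  proof -
    have "S x y = (\<Sum>i<n. of_real (r * c (e i)) * evaluation (e i) (tensor sX sY x y))"
      unfolding S_apply
    proof (intro sum.cong refl)
      fix i assume "i \<in> {..<n}"
      then show "f i x * z i y = of_real (r * c (e i)) * evaluation (e i) (tensor sX sY x y)"
        using eA[of i] A(2) evaluation_tensor(1)[of "e i" sX sY x y]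
        by (auto simp: f_def z_def blinfun.scaleR_left scaleR_conv_of_real mult.assoc)
    qed
    also have "\<dots> = (\<Sum>p\<in>A. of_real (r * c p) * evaluation p (tensor sX sY x y))"
      using e unfolding n_def by (rule sum.reindex_bij_betw)
    finally show ?thesis by (simp add: \<Phi>_def comb_def A_def sum_distrib_left mult.assoc)
  qed
  have Lsub: "fs.norming_points u \<subseteq> topspace \<T>" by auto
  have lin: "fs.functional \<Phi>" unfolding \<Phi>_def[abs_def]
    by (intro fs.functional_scaled fs.functional_comp_ev[OF Lsub comb_pos_fun[OF c]])
  have le: "norm (\<Phi> v) \<le> r * norm v" for v
    using norm_comb_le[OF c, of "\<lambda>p. evaluation p v" "norm v"] r by (simp add: \<Phi>_def norm_mult norm_evaluation_le)
  have "r * norm u \<le> norm (\<Phi> u)"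
  proof -
    have "norm u = (\<Sum>p\<in>A. c p * norm u)" using A(5) by (simp add: sum_distrib_right[symmetric])
    also have "\<dots> \<le> (\<Sum>p\<in>A. c p * re_part (evaluation p u))" using A(3,4) by (intro sum_mono mult_left_mono)
    also have "\<dots> = re_part (comb c (\<lambda>p. evaluation p u))" by (simp add: comb_def A_def re_part_sum)
    also have "\<dots> \<le> norm (comb c (\<lambda>p. evaluation p u))" by (rule re_part_le_norm)
    finally show ?thesis using r by (simp add: \<Phi>_def norm_mult)
  qed
  then have lower: "r \<le> (\<Sum>i. norm (f' i) * norm (z' i))"
    if "nuclear_representation sX (K_dual sY) dual_scale f' z' S" for f' z'
    using nuclear_representation_total_ge[OF that lin le _ u, of r] val by simp
  have "(\<Sum>i. norm (f i) * norm (z i)) = (\<Sum>i<n. norm (f i) * norm (z i))"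
    by (rule suminf_finite) (use out in auto)
  also have "\<dots> \<le> (\<Sum>i<n. r * c (e i))"
  proof (rule sum_mono)
    fix i assume "i \<in> {..<n}"
    then have i: "i < n" by simp
    have "norm (fst (e i)) \<le> 1" "norm (snd (e i)) \<le> 1" using eA[OF i] A(2) by (auto simp: dual_ball_def)
    then have "(r * c (e i)) * (norm (fst (e i)) * norm (snd (e i))) \<le> (r * c (e i)) * (1 * 1)"
      using r A(4) by (intro mult_left_mono mult_mono) auto
    then show "norm (f i) * norm (z i) \<le> r * c (e i)"
      using i r A(4) by (simp add: f_def z_def abs_mult mult.assoc)
  qed
  also have "\<dots> = (\<Sum>p\<in>A. r * c p)" using e unfolding n_def by (rule sum.reindex_bij_betw)
  also have "\<dots> = r" using A(5) by (simp add: sum_distrib_left[symmetric])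
  finally have upper: "(\<Sum>i. norm (f i) * norm (z i)) \<le> r" .
  have "nuclear_norm sX (K_dual sY) dual_scale S = (\<Sum>i. norm (f i) * norm (z i))"
    unfolding nuclear_norm_def
  proof (rule cInf_eq_minimum)
    show "(\<Sum>i. norm (f i) * norm (z i)) \<in> {\<Sum>i. norm (f i) * norm (z i) |f z. nuclear_representation sX (K_dual sY) dual_scale f z S}"
      using rep by blast
    show "(\<Sum>i. norm (f i) * norm (z i)) \<le> t"
      if "t \<in> {\<Sum>i. norm (f i) * norm (z i) |f z. nuclear_representation sX (K_dual sY) dual_scale f z S}" for t
      using that lower upper by fastforce
  qed
  then have "S \<in> NA_nu sX (K_dual sY) dual_scale" unfolding NA_nu_def nuclear_operators_def using op rep by blast
  then show ?thesis using val unfolding \<Phi>_def by blast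
qed

lemma zero_NA_nu: "0 \<in> NA_nu sX (K_dual sY) dual_scale"
proof -
  have rep: "nuclear_representation sX (K_dual sY) dual_scale (\<lambda>_. 0) (\<lambda>_. 0) 0"
    by (auto simp: nuclear_representation_def K_dual_def dual_scale_def)
  have "nuclear_norm sX (K_dual sY) dual_scale 0 = 0" unfolding nuclear_norm_def
  proof (rule cInf_eq_minimum)
    show "0 \<in> {\<Sum>i. norm (f i) * norm (z i) |f z. nuclear_representation sX (K_dual sY) dual_scale f z 0}"
      using rep by force
  qed (auto simp: nuclear_representation_def intro!: suminf_nonneg)
  moreover have "0 \<in> operators sX (K_dual sY) dual_scale"
    by (auto simp: operators_def K_dual_def dual_scale_def)
  ultimately show ?thesis unfolding NA_nu_def nuclear_operators_def using rep by force
qed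


section \<open>The two density statements\<close>

text \<open>\<open>nz\<close> makes the supremum over the unit sphere positive; a rotation turns
  nearly maximal moduli into real parts, as \<open>bishop_phelps\<close> expects them.\<close>

lemma ex_operator_norm:
  assumes \<Phi>: "fs.functional \<Phi>" "\<And>u. u \<in> \<E> \<Longrightarrow> norm (\<Phi> u) \<le> B * norm u" and nz: "\<exists>u\<in>\<E>. \<Phi> u \<noteq> 0"
  shows "\<exists>r>0. (\<forall>u\<in>\<E>. norm (\<Phi> u) \<le> r * norm u) \<and>
    (\<forall>\<eta>>0. \<exists>x\<in>\<E>. norm x = 1 \<and> (1 - \<eta>) * r < re_part (\<Phi> x))"
proof -
  define N where "N = (\<lambda>u. norm (\<Phi> u)) ` {u \<in> \<E>. norm u = 1}"
  have bdd: "bdd_above N" using \<Phi>(2) by (fastforce simp: N_def intro!: bdd_aboveI[where M = B])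
  have unit: "(1 / norm u) *\<^sub>R u \<in> {u \<in> \<E>. norm u = 1}" "norm (\<Phi> ((1 / norm u) *\<^sub>R u)) = norm (\<Phi> u) / norm u"
    if "u \<in> \<E>" "u \<noteq> 0" for u
    using that by (auto simp: fs.scaleR_mem fs.functional_scaleR[OF \<Phi>(1)] norm_divide norm_mult)
  define r where "r = Sup N"
  have le: "norm (\<Phi> u) \<le> r * norm u" if u: "u \<in> \<E>" for u
  proof (cases "u = 0")
    case True
    then show ?thesis by (simp add: fs.functional_0[OF \<Phi>(1)])
  next
    case False
    then have "norm (\<Phi> u) / norm u \<in> N" using unit[OF u] unfolding N_def by force
    then have "norm (\<Phi> u) / norm u \<le> r" unfolding r_def using bdd by (rule cSup_upper)
    then show ?thesis using False by (simp add: pos_divide_le_eq)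
  qed
  obtain u where u: "u \<in> \<E>" "\<Phi> u \<noteq> 0" using nz by blast
  then have "u \<noteq> 0" using fs.functional_0[OF \<Phi>(1)] by auto
  then have ne: "N \<noteq> {}" using unit(1)[OF u(1)] unfolding N_def by blast
  have "0 < r * norm u" using le[OF u(1)] u(2) by (meson less_le_trans zero_less_norm_iff)
  then have r: "0 < r" using \<open>u \<noteq> 0\<close> by (simp add: zero_less_mult_iff)
  have "\<exists>x\<in>\<E>. norm x = 1 \<and> (1 - \<eta>) * r < re_part (\<Phi> x)" if \<eta>: "0 < \<eta>" for \<eta>
  proof -
    have "(1 - \<eta>) * r < r" using \<eta> r by simp
    then obtain x where x: "x \<in> \<E>" "norm x = 1" "(1 - \<eta>) * r < norm (\<Phi> x)"
      using less_cSup_iff[OF ne bdd] unfolding r_def N_def by auto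
    obtain d where d: "norm d = 1" "d * \<Phi> x = of_real (norm (\<Phi> x))" using ex_rotation by blast
    then have "re_part (\<Phi> (tensor_scale d x)) = norm (\<Phi> x)" by (simp add: fs.functional_sc[OF \<Phi>(1) x(1)])
    then show ?thesis using x d(1) by (intro bexI[of _ "tensor_scale d x"]) (simp_all add: norm_tensor_scale fs.sc_mem)
  qed
  then show ?thesis using r le by blast
qed

text \<open>The common core of both densities: for weak* density \<open>F\<close> is finite and
  \<open>g\<close> constant, for norm density \<open>F\<close> is the whole completion and
  \<open>g\<close> the norm. \<open>approx\<close> stands for the approximation that is available on
  the points norming one element.\<close>

lemma ex_NA_nu_approx:
  assumes \<Phi>: "fs.functional \<Phi>" "\<And>u. u \<in> \<E> \<Longrightarrow> norm (\<Phi> u) \<le> B * norm u" and e: "0 < e"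
    and approx: "\<And>T \<epsilon> (u :: ('a, 'b, 'k) tensor_fun). fs.functional T \<Longrightarrow> 0 < \<epsilon> \<Longrightarrow>
      compactin \<T> (fs.norming_points u) \<Longrightarrow>
      fs.almost_below T \<epsilon> (fs.norming_points u) \<Longrightarrow>
      \<exists>c\<in>conv_weights (fs.norming_points u).
        \<forall>v\<in>F. norm (T v - comb c (\<lambda>p. evaluation p v)) \<le> 4 * \<epsilon> * g v"
    and F: "F \<subseteq> \<E>" and g: "\<And>v. 0 \<le> g v"
  shows "\<exists>S\<in>NA_nu sX (K_dual sY) dual_scale. \<exists>\<Psi> C. fs.functional \<Psi> \<and> (\<forall>u\<in>\<E>. norm (\<Psi> u) \<le> C * norm u) \<and>
    (\<forall>x y. \<Psi> (tensor sX sY x y) = S x y) \<and> (\<forall>v\<in>F. norm (\<Phi> v - \<Psi> v) \<le> e * g v)"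
proof (cases "\<exists>u\<in>\<E>. \<Phi> u \<noteq> 0")
  case False
  have "fs.functional (\<lambda>_. 0)" by (simp add: fs.functional_def)
  then show ?thesis using False F e g zero_NA_nu
    by (intro bexI[OF _ zero_NA_nu] exI[of _ "\<lambda>_. 0"] exI[of _ 0]) auto
next
  case True
  obtain r where r: "0 < r" "\<And>u. u \<in> \<E> \<Longrightarrow> norm (\<Phi> u) \<le> r * norm u"
    "\<And>\<eta>. 0 < \<eta> \<Longrightarrow> \<exists>x\<in>\<E>. norm x = 1 \<and> (1 - \<eta>) * r < re_part (\<Phi> x)"
    using ex_operator_norm[OF \<Phi> True] by blast
  define T where "T v = of_real (1 / r) * \<Phi> v" for v
  have T: "fs.functional T" unfolding T_def[abs_def] by (rule fs.functional_scaled[OF \<Phi>(1)])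
  have T_le: "norm (T v) \<le> norm v" if "v \<in> \<E>" for v
    using r(1) r(2)[OF that] by (simp add: T_def norm_mult norm_divide pos_divide_le_eq mult.commute)
  have T_ge: "\<exists>x\<in>\<E>. norm x = 1 \<and> 1 - \<eta> < re_part (T x)" if \<eta>: "0 < \<eta>" for \<eta>
  proof -
    obtain x where x: "x \<in> \<E>" "norm x = 1" "(1 - \<eta>) * r < re_part (\<Phi> x)" using r(3)[OF \<eta>] by blast
    have "re_part (T x) = re_part (\<Phi> x) / r" unfolding T_def re_part_of_real_mult by simp
    then show ?thesis using x r(1) by (intro bexI[of _ x]) (simp_all add: pos_less_divide_eq)
  qed
  \<comment> \<open>Undoing the normalisation multiplies the error \<open>4 * \<epsilon>\<close> by
    \<open>r\<close>; the bound 1 is a premise of \<open>bishop_phelps\<close>.\<close>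
  define \<epsilon> where "\<epsilon> = min 1 (e / (4 * r))"
  have \<epsilon>: "0 < \<epsilon>" "\<epsilon> \<le> 1" "r * (4 * \<epsilon>) \<le> e" using e r(1) by (auto simp: \<epsilon>_def min_def field_simps)
  obtain u where u: "u \<in> \<E>" "u \<noteq> 0" "compactin \<T> (fs.norming_points u)"
      "fs.almost_below T \<epsilon> (fs.norming_points u)"
    using fs.bishop_phelps[OF T T_le T_ge \<epsilon>(1,2)] by blast
  obtain c where c: "c \<in> conv_weights (fs.norming_points u)"
    "\<And>v. v \<in> F \<Longrightarrow> norm (T v - comb c (\<lambda>p. evaluation p v)) \<le> 4 * \<epsilon> * g v"
    using approx[OF T \<epsilon>(1) u(3,4)] by blast
  obtain S where S: "S \<in> NA_nu sX (K_dual sY) dual_scale"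
    "\<And>x y. S x y = of_real r * comb c (\<lambda>p. evaluation p (tensor sX sY x y))"
    using ex_NA_nu[OF u(1,2) r(1) c(1)] by blast
  define \<Psi> :: "('a, 'b, 'k) tensor_fun \<Rightarrow> 'k" where "\<Psi> v = of_real r * comb c (\<lambda>p. evaluation p v)" for v
  have Lsub: "fs.norming_points u \<subseteq> topspace \<T>" by auto
  have "fs.functional \<Psi>" unfolding \<Psi>_def[abs_def]
    by (intro fs.functional_scaled fs.functional_comp_ev[OF Lsub comb_pos_fun[OF c(1)]])
  moreover have "norm (\<Psi> v) \<le> r * norm v" for v
    using norm_comb_le[OF c(1), of "\<lambda>p. evaluation p v" "norm v"] r(1)
    by (simp add: \<Psi>_def norm_mult norm_evaluation_le)
  moreover have "norm (\<Phi> v - \<Psi> v) \<le> e * g v" if v: "v \<in> F" for v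
  proof -
    have "\<Phi> v - \<Psi> v = of_real r * (T v - comb c (\<lambda>p. evaluation p v))"
      using r(1) by (simp add: T_def \<Psi>_def right_diff_distrib)
    then have "norm (\<Phi> v - \<Psi> v) = r * norm (T v - comb c (\<lambda>p. evaluation p v))" using r(1) by (simp add: norm_mult)
    also have "\<dots> \<le> r * (4 * \<epsilon> * g v)" using c(2)[OF v] r(1) by (intro mult_left_mono) auto
    also have "\<dots> = (r * (4 * \<epsilon>)) * g v" by simp
    also have "\<dots> \<le> e * g v" using \<epsilon>(3) g by (rule mult_right_mono)
    finally show ?thesis .
  qed
  ultimately show ?thesis using S by (intro bexI[OF _ S(1)] exI[of _ \<Psi>] exI[of _ r]) (auto simp: \<Psi>_def)
qed

lemma NA_nu_subset_integral: "NA_nu sX (K_dual sY) dual_scale \<subseteq> integral_operators sX sY"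
  using nuclear_integral by (auto simp: NA_nu_def)

lemma wstar_dense_NA_nu: "wstar_dense sX sY (NA_nu sX (K_dual sY) dual_scale)"
  unfolding wstar_dense_def
proof (intro conjI NA_nu_subset_integral subset_antisym subsetI)
  let ?D = "NA_nu sX (K_dual sY) dual_scale"
  fix T
  assume "T \<in> wstar_topology sX sY closure_of ?D"
  then have "T \<in> topspace (wstar_topology sX sY)" by (rule subsetD[OF closure_of_subset_topspace])
  then show "T \<in> integral_operators sX sY" by (simp add: wstar_topology_def topspace_pullback_topology)
next
  let ?D = "NA_nu sX (K_dual sY) dual_scale"
  fix T assume T: "T \<in> integral_operators sX sY"
  obtain \<Phi> B where \<Phi>: "fs.functional \<Phi>" "\<And>u. u \<in> \<E> \<Longrightarrow> norm (\<Phi> u) \<le> B * norm u"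
      "\<And>x y. \<Phi> (tensor sX sY x y) = T x y"
    using integral_functional[OF T] by blast
  have tfT: "tf T = restrict \<Phi> \<E>" by (rule tensor_functional_eqI[OF \<Phi>])
  show "T \<in> wstar_topology sX sY closure_of ?D"
    unfolding in_closure_of
  proof (intro conjI allI impI)
    show "T \<in> topspace (wstar_topology sX sY)"
      using T by (simp add: wstar_topology_def topspace_pullback_topology tfT)
    fix U assume U: "T \<in> U \<and> openin (wstar_topology sX sY) U"
    then obtain V where V: "openin (product_topology (\<lambda>_. euclidean) \<E>) V" "U = tf -` V \<inter> integral_operators sX sY"
      unfolding wstar_topology_def openin_pullback_topology by blast
    have "tf T \<in> V" using U V(2) by blast
    then obtain X where X: "tf T \<in> PiE \<E> X" "\<And>i. open (X i)" "finite {i. X i \<noteq> UNIV}" "PiE \<E> X \<subseteq> V"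
      using product_topology_open_contains_basis[OF V(1) \<open>tf T \<in> V\<close>] by auto
    \<comment> \<open>A basic neighbourhood in the product topology restricts only these finitely
      many coordinates.\<close>
    define F where "F = {i \<in> \<E>. X i \<noteq> UNIV}"
    have F: "finite F" "F \<subseteq> \<E>" using X(3) by (auto simp: F_def)
    have "\<forall>i\<in>F. \<exists>e>0. ball (\<Phi> i) e \<subseteq> X i"
    proof
      fix i assume i: "i \<in> F"
      then have "\<Phi> i \<in> X i" using X(1) F(2) PiE_mem[OF X(1), of i] by (auto simp: tfT)
      then show "\<exists>e>0. ball (\<Phi> i) e \<subseteq> X i" using X(2) by (meson openE)
    qed
    then obtain e where e: "\<And>i. i \<in> F \<Longrightarrow> 0 < e i" "\<And>i. i \<in> F \<Longrightarrow> ball (\<Phi> i) (e i) \<subseteq> X i" by metis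
    \<comment> \<open>Half of the least radius keeps the approximation strictly inside the balls;
      the inserted 1 covers an empty \<open>F\<close>.\<close>
    define e0 where "e0 = Min (insert 1 (e ` F)) / 2"
    have e0: "0 < e0" unfolding e0_def using F(1) e(1) by auto
    have e0_less: "e0 < e i" if "i \<in> F" for i
    proof -
      have "Min (insert 1 (e ` F)) \<le> e i" using F(1) that by (intro Min_le) auto
      then show ?thesis using e0 by (simp add: e0_def)
    qed
    \<comment> \<open>The error in \<open>finite_approx\<close> has a part proportional to
      \<open>norm v\<close> and a constant one; \<open>m\<close> bounds both factors, so a constant
      \<open>g\<close> suffices.\<close>
    define m where "m = Max (insert 1 (norm ` F))"
    have m: "1 \<le> m" "\<And>v. v \<in> F \<Longrightarrow> norm v \<le> m" unfolding m_def using F(1) by auto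
    have "\<exists>S\<in>?D. \<exists>\<Psi> C. fs.functional \<Psi> \<and> (\<forall>u\<in>\<E>. norm (\<Psi> u) \<le> C * norm u) \<and>
      (\<forall>x y. \<Psi> (tensor sX sY x y) = S x y) \<and> (\<forall>v\<in>F. norm (\<Phi> v - \<Psi> v) \<le> (e0 / m) * m)"
    proof (rule ex_NA_nu_approx[OF \<Phi>(1,2)])
      show "0 < e0 / m" using e0 m by simp
      fix S :: "('a, 'b, 'k) tensor_fun \<Rightarrow> 'k" and \<epsilon> :: real and u :: "('a, 'b, 'k) tensor_fun"
      assume S: "fs.functional S" "0 < \<epsilon>" "fs.almost_below S \<epsilon> (fs.norming_points u)"
      have "fs.norming_points u \<subseteq> topspace \<T>" by auto
      from fs.finite_approx[OF S(1) this S(3) less_imp_le[OF S(2)] F S(2)]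
      obtain c where c: "c \<in> conv_weights (fs.norming_points u)"
        "\<And>v. v \<in> F \<Longrightarrow> norm (comb c (\<lambda>p. evaluation p v) - S v) \<le> 2 * (\<epsilon> * norm v + \<epsilon>)"
        by blast
      have "norm (S v - comb c (\<lambda>p. evaluation p v)) \<le> 4 * \<epsilon> * m" if v: "v \<in> F" for v
      proof -
        have "\<epsilon> * norm v \<le> \<epsilon> * m" "\<epsilon> * 1 \<le> \<epsilon> * m" using S(2) m v by (auto intro: mult_left_mono)
        then show ?thesis using c(2)[OF v] by (simp add: norm_minus_commute)
      qed
      then show "\<exists>c\<in>conv_weights (fs.norming_points u). \<forall>v\<in>F. norm (S v - comb c (\<lambda>p. evaluation p v)) \<le> 4 * \<epsilon> * m"
        using c(1) by blast
    qed (use F m in auto)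
    then obtain S \<Psi> C where S: "S \<in> ?D" "fs.functional \<Psi>" "\<forall>u\<in>\<E>. norm (\<Psi> u) \<le> C * norm u"
      "\<And>x y. \<Psi> (tensor sX sY x y) = S x y" "\<And>v. v \<in> F \<Longrightarrow> norm (\<Phi> v - \<Psi> v) \<le> (e0 / m) * m" by metis
    have tfS: "tf S = restrict \<Psi> \<E>" by (rule tensor_functional_eqI[OF S(2) bspec[OF S(3)] S(4)])
    have "tf S \<in> PiE \<E> X"
      unfolding tfS
    proof (rule restrict_PiE_iff[THEN iffD2], rule ballI)
      fix i assume i: "i \<in> \<E>"
      show "\<Psi> i \<in> X i"
      proof (cases "i \<in> F")
        case True
        have "(e0 / m) * m = e0" using m(1) by simp
        then have "norm (\<Phi> i - \<Psi> i) < e i" using S(5)[OF True] e0_less[OF True] by linarith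
        then show ?thesis using e(2)[OF True] by (auto simp: dist_norm)
      next
        case False
        then show ?thesis using i by (simp add: F_def)
      qed
    qed
    then have "S \<in> U" using X(4) V(2) S(1) NA_nu_subset_integral by blast
    then show "\<exists>S. S \<in> ?D \<and> S \<in> U" using S(1) by blast
  qed
qed

lemma integral_norm_dense_NA_nu:
  assumes noell1: "\<not> contains_ell1 tensor_scale \<E>"
  shows "integral_norm_dense sX sY (NA_nu sX (K_dual sY) dual_scale)"
  unfolding integral_norm_dense_def
proof (intro conjI NA_nu_subset_integral ballI allI impI)
  let ?D = "NA_nu sX (K_dual sY) dual_scale"
  fix T and e :: real assume T: "T \<in> integral_operators sX sY" and e: "0 < e"
  obtain \<Phi> B where \<Phi>: "fs.functional \<Phi>" "\<And>u. u \<in> \<E> \<Longrightarrow> norm (\<Phi> u) \<le> B * norm u"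
      "\<And>x y. \<Phi> (tensor sX sY x y) = T x y"
    using integral_functional[OF T] by blast
  have "\<exists>S\<in>?D. \<exists>\<Psi> C. fs.functional \<Psi> \<and> (\<forall>u\<in>\<E>. norm (\<Psi> u) \<le> C * norm u) \<and>
      (\<forall>x y. \<Psi> (tensor sX sY x y) = S x y) \<and> (\<forall>v\<in>\<E>. norm (\<Phi> v - \<Psi> v) \<le> e / 4 * norm v)"
  proof (rule ex_NA_nu_approx[OF \<Phi>(1,2)])
    fix S :: "('a, 'b, 'k) tensor_fun \<Rightarrow> 'k" and \<epsilon> :: real and u :: "('a, 'b, 'k) tensor_fun"
      assume S: "fs.functional S" "0 < \<epsilon>" "compactin \<T> (fs.norming_points u)" "fs.almost_below S \<epsilon> (fs.norming_points u)"
    \<comment> \<open>With \<open>d = 2 * \<epsilon>\<close> the error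
      \<open>2 * \<epsilon> + d\<close> becomes the \<open>4 * \<epsilon>\<close> expected by
      \<open>ex_NA_nu_approx\<close>.\<close>
    from fs.norm_approx[OF noell1 S(1,3,4), of "2 * \<epsilon>"] S(2)
    show "\<exists>c\<in>conv_weights (fs.norming_points u). \<forall>v\<in>\<E>. norm (S v - comb c (\<lambda>p. evaluation p v)) \<le> 4 * \<epsilon> * norm v"
      by simp
  qed (use e in auto)
  then obtain S \<Psi> C where S: "S \<in> ?D" "fs.functional \<Psi>"
    "\<And>x y. \<Psi> (tensor sX sY x y) = S x y" "\<And>v. v \<in> \<E> \<Longrightarrow> norm (\<Phi> v - \<Psi> v) \<le> e / 4 * norm v" by metis
  \<comment> \<open>The series will have total at most twice \<open>e / 4\<close>, hence strictly
    less than \<open>e\<close>.\<close>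
  have e4: "0 < e / 4" using e by simp
  obtain I :: "(nat \<times> ('a \<Rightarrow>\<^sub>L 'k) \<times> ('b \<Rightarrow>\<^sub>L 'k)) set" and c
    where I: "countable I" "I \<noteq> {}" "\<And>i. i \<in> I \<Longrightarrow> 0 \<le> c i \<and> snd i \<in> topspace \<T>"
      "Infinite_Set_Sum.abs_summable_on c I" "infsetsum c I \<le> 2 * (e / 4)"
      "\<And>u. u \<in> \<E> \<Longrightarrow> \<Phi> u - \<Psi> u = infsetsum (\<lambda>i. c i *\<^sub>R evaluation (snd i) u) I"
    using fs.evaluation_series[OF noell1 fs.functional_minus[OF \<Phi>(1) S(2)] e4 S(4)] by blast
  have ser: "series I c snd" using I by (simp add: series_def)
  have "(T - S) x y = series_functional I c snd (tensor sX sY x y)" for x y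
    using I(6)[OF tensor_mem[of sX sY x y]] by (simp add: series_functional_def \<Phi>(3) S(3) blinfun.diff_left)
  then obtain \<mu> where \<mu>: "represents sX sY \<mu> (T - S)" "tv_norm \<T> \<mu> = infsetsum c I"
    using series_represents[OF ser] by blast
  have "integral_norm sX sY (T - S) \<le> tv_norm \<T> \<mu>"
    unfolding integral_norm_def
    by (rule cInf_lower) (use \<mu>(1) in \<open>auto intro!: bdd_belowI[where m = 0] simp: tv_norm_def\<close>)
  then have "integral_norm sX sY (T - S) < e" using \<mu>(2) I(5) e by linarith
  then show "\<exists>S\<in>?D. integral_norm sX sY (T - S) < e" using S(1) by blast
qed

end

theorem theorem2p3:
  fixes sX :: "'k::rc_field \<Rightarrow> 'a::banach \<Rightarrow> 'a"
    and sY :: "'k \<Rightarrow> 'b::banach \<Rightarrow> 'b"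
  assumes "K_space sX" and "K_space sY"
  shows "wstar_dense sX sY (NA_nu sX (K_dual sY) dual_scale) \<and>
    (\<not> contains_ell1 tensor_scale (inj_tensor sX sY) \<longrightarrow>
       integral_norm_dense sX sY (NA_nu sX (K_dual sY) dual_scale))"
  using wstar_dense_NA_nu integral_norm_dense_NA_nu by blast

end
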